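(* The number of Diophantine quadruples contained in $[1,x]$ is given, as $x\to\infty$, by the asymptotic formula \[ C x^{1/3}\log x + O\big( x^{1/3} (\log x)^{2/3+\sqrt{2}/6} (\log\log x)^{5/12} \big), \] where $C = \dfrac{2^{4/3}}{3\,\Gamma(2/3)^3} \approx 0.338285$.
   Context: A Diophantine $m$-tuple is a set $A$ of $m$ positive integers such that $ab+1$ is a perfect square for every pair $a,b$ of distinct elements of $A$. A Diophantine quadruple is a Diophantine $4$-tuple. $\Gamma$ is Euler's Gamma function. The count is of sets (unordered quadruples) all of whose elements are at most $x$. *)

theory Defs
  imports
    "HOL-Analysis.Analysis"
    "HOL-Computational_Algebra.Nth_Powers"
    "HOL-Library.Landau_Symbols"
begin

definition diophantine_tuple :: "nat \<Rightarrow> nat set \<Rightarrow> bool" where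
  "diophantine_tuple m A \<longleftrightarrow>
     finite A \<and> card A = m \<and> (\<forall>a\<in>A. 0 < a) \<and>
     (\<forall>a\<in>A. \<forall>b\<in>A. a \<noteq> b \<longrightarrow> is_square (a * b + 1))"

abbreviation diophantine_quadruple :: "nat set \<Rightarrow> bool" where
  "diophantine_quadruple \<equiv> diophantine_tuple 4"

definition diophantine_quadruples_upto :: "real \<Rightarrow> nat set set" where
  "diophantine_quadruples_upto x =
     {A. diophantine_quadruple A \<and> (\<forall>a\<in>A. real a \<le> x)}"

text \<open>So that the cardinality of this set is its genuine number of elements:\<close>

lemma finite_diophantine_quadruples_upto: "finite (diophantine_quadruples_upto x)"
proof (rule finite_subset)
  show "diophantine_quadruples_upto x \<subseteq> Pow {..nat \<lfloor>x\<rfloor>}"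
    by (auto simp: diophantine_quadruples_upto_def le_nat_floor)
qed simp

definition quadruple_constant :: real where
  "quadruple_constant = 2 powr (4 / 3) / (3 * Gamma (2 / 3) ^ 3)"

end

theory Submission
  imports Defs "HOL-Real_Asymp.Real_Asymp"
begin

text \<open>The error term is in fact \<open>O(x\<^sup>1\<^sup>/\<^sup>3)\<close>, and only elementary lattice point counting is needed.

  Apart from the doubly regular quadruples \<open>{a, b, a + b + 2r, 4r(a + r)(b + r)}\<close> with
  \<open>r\<^sup>2 = ab + 1\<close>, every quadruple in \<open>[1, x]\<close> is determined, up to \<open>x\<^sup>\<epsilon>\<close> choices, by a
  Diophantine pair with product below \<open>\<surd>x/4\<close>; there are only \<open>x\<^sup>1\<^sup>/\<^sup>4\<^sup>+\<^sup>\<epsilon>\<close> such pairs.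

  Doubly regular quadruples come from factorizations \<open>r + 1 = kl\<close>, \<open>r - 1 = mn\<close> with \<open>a = mk\<close>,
  \<open>b = nl\<close>, that is, from solutions of \<open>kl - mn = 2\<close>. By symmetry one may take \<open>m \<le> k\<close> (at the
  price of also allowing \<open>-2\<close>). For fixed coprime \<open>m, l\<close> the admissible \<open>k\<close> form an arithmetic
  progression modulo \<open>m\<close>, cut off at \<open>k/m = (x/4)\<^sup>1\<^sup>/\<^sup>3 (ml(m + l))\<^sup>-\<^sup>2\<^sup>/\<^sup>3 + O(1)\<close>, and only
  \<open>O(x\<^sup>1\<^sup>/\<^sup>3)\<close> pairs \<open>m, l\<close> contribute. The sum of \<open>(ml(m + l))\<^sup>-\<^sup>2\<^sup>/\<^sup>3\<close> over coprime pairs grows like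
  \<open>6/\<pi>\<^sup>2 B(1/3, 1/3)\<close> times the logarithm of the cutoff for \<open>m + l\<close>, and the reflection formula for
  \<open>\<Gamma>\<close> removes \<open>\<pi>\<close> from the constant.\<close>

section \<open>Regular and irregular quadruples\<close>

text \<open>Undoing a conjugation of extensions of a pair p, q multiplies a nonzero element by more
  than 4 p q. If a quadruple is not doubly regular, enough nonzero conjugates occur to leave a pair
  with product below sqrt d / 4, where one member may be a conjugate lying outside the quadruple.
  For doubly regular quadruples the obstacle is that a fibre over (m, l) can only be counted up to
  O(1), so there may be only O(x^(1/3)) pairs (m, l). This is the purpose of m <= k: it yields (m l
  (m + l))^2 <= 3 x. Both signs of k l - m n = 2 or -2 are needed because the gcd of a with r + 1 or
  the one with r - 1 may be the factor of size at least sqrt a; triples reached by both signs have k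
  <= 4 m and are again O(x^(1/3)). The cutoff m l (m + l) <= sqrt (3 x) corresponds to m + l up to
  order x^(1/6), hence a factor (log x) / 6 against 6 / pi^2. The two signs are cancelled by the two
  orders of a and b, which leaves (x/4)^(1/3) B(1/3, 1/3) / pi^2 log x.\<close>

definition dpair :: "nat \<Rightarrow> nat \<Rightarrow> bool" where
  "dpair a b \<longleftrightarrow> 0 < a \<and> 0 < b \<and> is_square (a * b + 1)"

text \<open>The larger root d of the regularity equation (p + q - n - d)^2 = 4 (p q + 1) (n d + 1),
  usually written d_+. For n = 0 it becomes p + q + 2 r, the regular extension of a pair to a
  triple. Real values avoid carrying the three square roots along.\<close>

definition dplus :: "real \<Rightarrow> real \<Rightarrow> real \<Rightarrow> real" where
  "dplus p q n = p + q + n + 2 * p * q * n + 2 * sqrt ((p * q + 1) * (p * n + 1) * (q * n + 1))"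

lemma dpair_commute: "dpair a b \<longleftrightarrow> dpair b a"
  by (auto simp: dpair_def mult.commute)

lemma dpairE:
  assumes "dpair a b"
  obtains r :: nat where "0 < r" "r\<^sup>2 = a * b + 1"
proof -
  obtain r where r: "a * b + 1 = r ^ 2"
    using assms by (auto simp: dpair_def is_nth_power_def)
  then have "r \<noteq> 0" by (intro notI) simp
  with r show ?thesis by (intro that[of r]) simp_all
qed

lemma dpair_neq: assumes "dpair a b" shows "a \<noteq> b"
proof
  assume "a = b"
  obtain r where r: "0 < r" "r\<^sup>2 = a * a + 1"
    using assms \<open>a = b\<close> by (metis dpairE)
  have a: "0 < a" using assms by (simp add: dpair_def)
  have "a < r" using r(2) by (intro power_less_imp_less_base[of a 2 r]) (simp_all add: power2_eq_square)
  moreover have "r < Suc a" using r a by (intro power_less_imp_less_base[of r 2 "Suc a"]) (simp_all add: power2_eq_square)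
  ultimately show False by simp
qed

lemma dplus_commute: "dplus p q n = dplus q p n" "dplus p q n = dplus q n p"
  by (simp_all add: dplus_def mult_ac add_ac)

text \<open>The linear part p + q + n alone accounts for the increments; the other terms only need
  to be monotone. Keeping the increments makes strict monotonicity immediate.\<close>

lemma dplus_mono:
  assumes "0 \<le> p" "p \<le> p'" "0 \<le> q" "q \<le> q'" "0 \<le> n" "n \<le> n'"
  shows "dplus p q n + ((p' - p) + (q' - q) + (n' - n)) \<le> dplus p' q' n'"
proof -
  have "p * q \<le> p' * q'" "p * n \<le> p' * n'" "q * n \<le> q' * n'"
    using assms by (auto intro!: mult_mono)
  moreover have "p * q * n \<le> p' * q' * n'"
    using assms by (auto intro!: mult_mono)
  moreover have "0 \<le> p * q" "0 \<le> p * n" "0 \<le> q * n" using assms by auto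
  ultimately have "(p * q + 1) * (p * n + 1) * (q * n + 1) \<le> (p' * q' + 1) * (p' * n' + 1) * (q' * n' + 1)"
    by (intro mult_mono) auto
  then have "sqrt ((p * q + 1) * (p * n + 1) * (q * n + 1)) \<le> sqrt ((p' * q' + 1) * (p' * n' + 1) * (q' * n' + 1))"
    by simp
  then show ?thesis using \<open>p * q * n \<le> p' * q' * n'\<close> unfolding dplus_def by linarith
qed

lemma dplus_strict_mono:
  assumes "0 \<le> p" "p \<le> p'" "0 \<le> q" "q \<le> q'" "0 \<le> n" "n \<le> n'" "p < p' \<or> q < q' \<or> n < n'"
  shows "dplus p q n < dplus p' q' n'"
  using dplus_mono[OF assms(1-6)] assms by linarith

text \<open>The root term contributes at least as much as 2 p q n does. This growth by a factor 4 p
  q is the source of every gap estimate below.\<close>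

lemma dplus_gt:
  assumes "0 < p" "0 < q" "0 \<le> n"
  shows "4 * p * q * n < dplus p q n"
proof -
  have "(p * q * n)\<^sup>2 = (p * q) * (p * n) * (q * n)" by (simp add: power2_eq_square)
  also have "\<dots> \<le> (p * q + 1) * (p * n + 1) * (q * n + 1)"
    using assms by (intro mult_mono) auto
  finally have "p * q * n \<le> sqrt ((p * q + 1) * (p * n + 1) * (q * n + 1))"
    by (rule real_le_rsqrt)
  then show ?thesis using assms unfolding dplus_def by linarith
qed

lemma dplus_0: "dplus p q 0 = p + q + 2 * sqrt (p * q + 1)"
  by (simp add: dplus_def)

text \<open>For integers p < q the product p q + 1 is at most q^2. So an element whose conjugate is
  0 is comparatively small, which contradicts \<open>dplus_gt\<close> when another conjugate is
  nonzero.\<close>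

lemma dplus_0_less:
  fixes p q :: nat
  assumes "p < q"
  shows "dplus p q 0 < 4 * real q"
proof -
  have "p * q + 1 \<le> q ^ 2"
  proof -
    have "Suc p * q \<le> q * q" using assms by (intro mult_right_mono) auto
    then show ?thesis using assms by (simp add: power2_eq_square)
  qed
  then have "real p * real q + 1 \<le> real q ^ 2" by (metis of_nat_1 of_nat_add of_nat_le_iff of_nat_mult of_nat_power)
  then have "sqrt (real p * real q + 1) \<le> real q" by (simp add: real_le_lsqrt)
  then show ?thesis using assms by (simp add: dplus_0)
qed

text \<open>The conjugate solution \<open>n' = p + q + n + 2pqn - 2ruv\<close>, with \<open>r, u, v\<close> the three
  square roots, again extends the pair, and \<open>n\<close> is recovered from it by \<open>dplus\<close>.\<close>

lemma dpair_descent: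
  assumes "dpair p q" "dpair p n" "dpair q n" "p < n" "q < n"
  obtains n' where "n' = 0 \<or> dpair p n' \<and> dpair q n'" "real n = dplus p q n'"
proof -
  obtain r u v :: nat where nat: "0 < r" "r\<^sup>2 = p * q + 1" "0 < u" "u\<^sup>2 = p * n + 1"
    "0 < v" "v\<^sup>2 = q * n + 1"
    using assms(1-3) by (metis dpairE)
  define P Q N R U V where "P = int p" and "Q = int q" and "N = int n" and "R = int r"
    and "U = int u" and "V = int v"
  note defs = P_def Q_def N_def R_def U_def V_def
  have pos: "0 < P" "0 < Q" "0 < N" "P < N" "Q < N" "0 < R" "0 < U" "0 < V"
    using nat assms by (auto simp: defs dpair_def)
  have sq: "R\<^sup>2 = P * Q + 1" "U\<^sup>2 = P * N + 1" "V\<^sup>2 = Q * N + 1"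
    using nat by (simp_all add: defs flip: of_nat_power of_nat_mult)
  define M where "M = P + Q + N + 2 * P * Q * N - 2 * R * U * V"
  \<comment> \<open>Since Q U^2 - P V^2 = Q - P, multiplying U sqrt Q + V sqrt P by the unit R -
    sqrt (P Q) of norm 1 gives X sqrt Q + Y sqrt P, the solution belonging to the conjugate.\<close>
  define X Y where "X = R * U - P * V" and "Y = R * V - Q * U"
  have X2: "X\<^sup>2 = P * M + 1"
    using sq unfolding X_def M_def by algebra
  have Y2: "Y\<^sup>2 = Q * M + 1"
    using sq unfolding Y_def M_def by algebra
  \<comment> \<open>Conjugation is an involution: from \<open>M\<close>, with the roots
    \<open>R\<close>, \<open>X\<close>, \<open>Y\<close> and the plus sign, it leads back to
    \<open>N\<close>.\<close>
  have NM: "N = P + Q + M + 2 * P * Q * M + 2 * R * X * Y"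
    using sq unfolding X_def Y_def M_def by algebra
  \<comment> \<open>The right side is positive because P < N; this fixes the sign of
    \<open>X\<close>, and Q < N does the same for \<open>Y\<close>.\<close>
  have "(R * U)\<^sup>2 - (P * V)\<^sup>2 = P * Q + 1 + P * (N - P)"
    using sq by algebra
  then have "(P * V)\<^sup>2 < (R * U)\<^sup>2"
    using pos by (smt (verit) mult_pos_pos)
  then have "0 < X" unfolding X_def
    using pos by (smt (verit) mult_pos_pos power_mono)
  have "(R * V)\<^sup>2 - (Q * U)\<^sup>2 = P * Q + 1 + Q * (N - Q)"
    using sq by algebra
  then have "(Q * U)\<^sup>2 < (R * V)\<^sup>2"
    using pos by (smt (verit) mult_pos_pos)
  then have "0 < Y" unfolding Y_def
    using pos by (smt (verit) mult_pos_pos power_mono)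
  have "0 < P * M + 1" using \<open>0 < X\<close> X2 by (metis zero_less_power)
  then have "0 \<le> M" using pos(1) by (smt (verit) mult_less_0_iff zero_less_mult_iff)
  define n' where "n' = nat M"
  have M: "M = int n'" using \<open>0 \<le> M\<close> by (simp add: n'_def)
  have sqn: "is_square (p * n' + 1)" 
  proof -
    have "int (p * n' + 1) = int ((nat X)\<^sup>2)" using X2 \<open>0 < X\<close> by (simp add: M defs)
    then show ?thesis unfolding is_nth_power_def by (metis of_nat_eq_iff)
  qed
  have sqn': "is_square (q * n' + 1)" 
  proof -
    have "int (q * n' + 1) = int ((nat Y)\<^sup>2)" using Y2 \<open>0 < Y\<close> by (simp add: M defs)
    then show ?thesis unfolding is_nth_power_def by (metis of_nat_eq_iff)
  qed
  show ?thesis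
  proof (rule that[of n'])
    show "n' = 0 \<or> dpair p n' \<and> dpair q n'"
      using sqn sqn' pos by (auto simp: dpair_def defs)
    have "(P * Q + 1) * (P * M + 1) * (Q * M + 1) = (R * X * Y)\<^sup>2"
      unfolding sq[symmetric] X2[symmetric] Y2[symmetric] by (simp add: power_mult_distrib)
    then have "real_of_int ((P * Q + 1) * (P * M + 1) * (Q * M + 1)) = real_of_int ((R * X * Y)\<^sup>2)"
      by simp
    then have "(real p * real q + 1) * (real p * real n' + 1) * (real q * real n' + 1) = (real_of_int (R * X * Y))\<^sup>2"
      by (simp add: M P_def Q_def)
    then have "sqrt ((real p * real q + 1) * (real p * real n' + 1) * (real q * real n' + 1)) = real_of_int (R * X * Y)"
      using pos \<open>0 < X\<close> \<open>0 < Y\<close> by (metis of_int_0_le_iff order_less_imp_le real_sqrt_unique zero_le_mult_iff)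
    moreover have "real n = real_of_int N" by (simp add: N_def)
    ultimately show "real n = dplus p q n'"
      by (simp add: NM dplus_def M P_def Q_def)
  qed
qed

text \<open>The proof compares three conjugates: \<open>e\<close> and \<open>f\<close> of d relative
  to b, c and a, c, and \<open>c'\<close> of c relative to a, b. Both irregular alternatives let the
  quadruple be rebuilt from one small pair: in \<open>small\<close> the other two elements extend p,
  q; in \<open>conjugate\<close> c extends e, b, then d is given by \<open>dplus\<close> and a
  extends b, c.\<close>

lemma quadruple_cases:
  assumes "a < b" "b < c" "c < d"
    and ab: "dpair a b" and ac: "dpair a c" and ad: "dpair a d"
    and bc: "dpair b c" and bd: "dpair b d" and cd: "dpair c d"
  obtains (regular) "real c = dplus a b 0" "real d = dplus a b c"
  | (small) p q where "p \<in> {a, b, c}" "q \<in> {a, b, c}" "p \<noteq> q" "16 * (real p * real q)\<^sup>2 < real d"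
  | (conjugate) e where "dpair e b" "dpair e c" "real d = dplus b c e" "16 * (real e * real b)\<^sup>2 < real d"
proof -
  have pos: "0 < a" "0 < b" "0 < c" "0 < d" using ab cd by (auto simp: dpair_def)
  obtain e where e: "e = 0 \<or> dpair b e \<and> dpair c e" "real d = dplus b c e"
    using dpair_descent[OF bc bd cd] assms by auto
  obtain f where f: "f = 0 \<or> dpair a f \<and> dpair c f" "real d = dplus a c f"
    using dpair_descent[OF ac ad cd] assms by auto
  obtain c' where c': "c' = 0 \<or> dpair a c' \<and> dpair b c'" "real c = dplus a b c'"
    using dpair_descent[OF ab ac bc] assms by auto
  have de: "4 * real b * real c * real e < real d"
    unfolding e(2) using pos by (intro dplus_gt) auto
  have df: "4 * real a * real c * real f < real d"
    unfolding f(2) using pos by (intro dplus_gt) auto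
  have four: "4 * real c \<le> 4 * real p * real c * real n" if "0 < p" "0 < n" for p n :: nat
  proof -
    have "1 * 1 \<le> real p * real n" using that by (intro mult_mono) auto
    from mult_left_mono[OF this, of "4 * real c"] show ?thesis by (simp add: algebra_simps)
  qed
  \<comment> \<open>If \<open>e\<close> were 0, then d < 4 c would force \<open>f\<close> to be 0 as
    well, and d would be the regular extension of both a, c and b, c.\<close>
  have "0 < e"
  proof (rule ccontr)
    assume "\<not> 0 < e"
    then have "real d < 4 * real c" using e(2) dplus_0_less[of b c] assms by simp
    then have "f = 0" using df four[of a f] pos by (cases "f = 0") linarith+
    then have "dplus a c 0 = dplus b c 0" using e(2) f(2) \<open>\<not> 0 < e\<close> by simp
    moreover have "dplus a c 0 < dplus b c 0" using assms by (intro dplus_strict_mono) auto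
    ultimately show False by simp
  qed
  then have eb: "dpair b e" "dpair c e" using e(1) by auto
  have "0 < f"
  proof (rule ccontr)
    assume "\<not> 0 < f"
    then have "real d < 4 * real c" using f(2) dplus_0_less[of a c] assms by simp
    then show False using de four[of b e] pos \<open>0 < e\<close> by linarith
  qed
  then have fa: "dpair a f" "dpair c f" using f(1) by auto
  \<comment> \<open>The two gaps 4 b e < c and 4 b c e < d multiply to the required bound on (e
    b)^2.\<close>
  have conj: thesis if "4 * real b * real e < real c"
  proof (rule conjugate[of e])
    have "16 * (real e * real b)\<^sup>2 = (4 * real b * real e) * (4 * real b * real e)"
      by (simp add: power2_eq_square)
    also have "\<dots> \<le> (4 * real b * real e) * real c"
      using that by (intro mult_left_mono) auto
    also have "\<dots> < real d" using de by (simp add: mult_ac)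
    finally show "16 * (real e * real b)\<^sup>2 < real d" .
  qed (use eb e in \<open>auto simp: dpair_commute\<close>)
  show thesis
  proof (cases "c' = 0")
    case c0: True
    have c: "real c = dplus a b 0" using c' c0 by simp
    have c4: "real c < 4 * real b" unfolding c by (intro dplus_0_less assms)
    \<comment> \<open>Here a, b, c is a regular triple, and e = a is exactly double regularity. If e
      < a, then c has a nonzero conjugate relative to b, e, since c is already the regular extension
      of the larger pair a, b.\<close>
    consider "e = a" | "e < a" | "a < e" "e < c" | "c < e"
      using dpair_neq[OF eb(2)] by fastforce
    then show thesis
    proof cases
      case 1
      then have "real d = dplus a b c" using e(2) by (metis dplus_commute)
      then show ?thesis using c regular by simp
    next
      case 2
      obtain e' where e': "e' = 0 \<or> dpair b e' \<and> dpair e e'" "real c = dplus b e e'"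
        using dpair_descent[of b e c] eb bc 2 assms by (auto simp: dpair_commute)
      have "0 < e'"
      proof (rule ccontr)
        assume "\<not> 0 < e'"
        then have "dplus b e 0 = dplus b a 0" using e'(2) c by (simp add: dplus_commute)
        moreover have "dplus b e 0 < dplus b a 0" using 2 by (intro dplus_strict_mono) auto
        ultimately show False by simp
      qed
      have "4 * real b * real e * 1 \<le> 4 * real b * real e * real e'" 
        using \<open>0 < e'\<close> by (intro mult_left_mono) auto
      also have "\<dots> < real c" unfolding e'(2) using pos \<open>0 < e\<close> by (intro dplus_gt) auto
      finally show ?thesis using conj by simp
    next
      case 3
      obtain e' where e': "e' = 0 \<or> dpair b e' \<and> dpair e e'" "real c = dplus b e e'"
        using dpair_descent[of b e c] eb bc 3 assms by (auto simp: dpair_commute)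
      \<comment> \<open>Both sides equal c, so an \<open>e\<close> strictly between a and c is
        impossible.\<close>
      have "dplus b a 0 < dplus b e e'" using 3 by (intro dplus_strict_mono) auto
      then have False using c e' by (simp add: dplus_commute)
      then show ?thesis ..
    next
      case 4
      \<comment> \<open>With e above c a second descent applies. A nonzero result gives e > 4 b c; a
        zero result makes e regular over b, c, and then the larger \<open>f\<close> descends over a,
        c to something nonzero.\<close>
      obtain e' where e': "e' = 0 \<or> dpair b e' \<and> dpair c e'" "real e = dplus b c e'"
        using dpair_descent[of b c e] eb bc 4 assms by auto
      have big: "16 * (real p * real c)\<^sup>2 < real d" 
        if "4 * real p * real c < real g" "4 * real p * real c * real g < real d" for p g
      proof -
        have "16 * (real p * real c)\<^sup>2 = (4 * real p * real c) * (4 * real p * real c)"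
          by (simp add: power2_eq_square)
        also have "\<dots> \<le> (4 * real p * real c) * real g"
          using that by (intro mult_left_mono) auto
        finally show ?thesis using that by linarith
      qed
      have gt: "4 * real p * real c < real g" if "real g = dplus p c h" "0 < h" "0 < p" for p g h :: nat
      proof -
        have "4 * real p * real c * 1 \<le> 4 * real p * real c * real h" 
          using that by (intro mult_left_mono) auto
        also have "\<dots> < real g" unfolding that using pos that by (intro dplus_gt) auto
        finally show ?thesis by simp
      qed
      show ?thesis
      proof (cases "e' = 0")
        case False
        then have "4 * real b * real c < real e" using gt[OF e'(2)] pos by simp
        from big[OF this de] show ?thesis by (intro small[of b c]) (use assms in auto)
      next
        case True
        have "\<not> f \<le> e"
        proof
          assume "f \<le> e"
          then have "dplus a c f < dplus b c e" using assms by (intro dplus_strict_mono) auto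
          then show False using e f by simp
        qed
        then have "a < f" "c < f" using 4 assms by auto
        then obtain f' where f': "f' = 0 \<or> dpair a f' \<and> dpair c f'" "real f = dplus a c f'"
          using dpair_descent[of a c f] fa ac by auto
        have "f' \<noteq> 0"
        proof
          assume "f' = 0"
          then have "real f < real e" unfolding f' e' True
            using assms by (intro dplus_strict_mono) auto
          then show False using \<open>\<not> f \<le> e\<close> by simp
        qed
        then have "4 * real a * real c < real f" using gt[OF f'(2)] pos by simp
        from big[OF this df] show ?thesis by (intro small[of a c]) (use assms in auto)
      qed
    qed
  next
    case False
    have "4 * real a * real b * 1 \<le> 4 * real a * real b * real c'" 
      using False by (intro mult_left_mono) auto
    also have "\<dots> < real c" unfolding c'(2) using pos by (intro dplus_gt) auto
    finally have c4: "4 * real a * real b < real c" by simp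
    \<comment> \<open>Now 4 a b < c. If e >= a, this multiplies with 4 b c e < d to bound (a b)^2;
      if e < a, the product e b inherits the gap.\<close>
    show thesis
    proof (cases "a \<le> e")
      case True
      have "16 * (real a * real b)\<^sup>2 = (4 * real a * real b) * (4 * real b * real a)"
        by (simp add: power2_eq_square)
      also have "\<dots> \<le> real c * (4 * real b * real e)"
        using c4 True by (intro mult_mono) auto
      also have "\<dots> < real d" using de by (simp add: mult_ac)
      finally show ?thesis by (intro small[of a b]) (use assms in auto)
    next
      case False
      have "4 * real b * real e \<le> 4 * real b * real a" using False by (intro mult_left_mono) auto
      then show ?thesis using c4 by (intro conj) (simp add: mult_ac)
    qed
  qed
qed

section \<open>Counting the sporadic quadruples\<close>

lemma card_divisors_prime_power_mult_le:
  fixes p m :: nat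
  assumes "prime p" "0 < m"
  shows "card {d. d dvd p ^ a * m} \<le> (a + 1) * card {d. d dvd m}"
proof -
  have "{d. d dvd p ^ a * m} \<subseteq> (\<lambda>(i, d). p ^ i * d) ` ({..a} \<times> {d. d dvd m})"
  proof
    fix d assume "d \<in> {d. d dvd p ^ a * m}"
    then obtain u v where uv: "d = u * v" "u dvd p ^ a" "v dvd m"
      using division_decomp by blast
    then obtain i where "i \<le> a" "u = p ^ i" using divides_primepow_nat[OF assms(1)] by blast
    then show "d \<in> (\<lambda>(i, d). p ^ i * d) ` ({..a} \<times> {d. d dvd m})" using uv by force
  qed
  moreover have "finite ({..a} \<times> {d. d dvd m})" using assms by (simp add: finite_divisors_nat)
  ultimately have "card {d. d dvd p ^ a * m} \<le> card ({..a} \<times> {d. d dvd m})"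
    by (meson surj_card_le)
  then show ?thesis by (simp only: card_cartesian_product card_atMost Suc_eq_plus1)
qed

text \<open>Prime powers are split off one at a time. A prime p with p^e >= 2 costs no constant,
  because a + 1 <= 2^a; each of the finitely many smaller primes costs one factor
  \<open>C\<close>.\<close>

lemma divisor_bound:
  fixes e :: real
  assumes e: "0 < e"
  obtains K where "1 \<le> K" "\<And>n::nat. 0 < n \<Longrightarrow> real (card {d. d dvd n}) \<le> K * real n powr e"
proof -
  \<comment> \<open>Chosen so that C (1 + a e ln 2) >= a + 1, whence a + 1 <= C 2^(a e) for every
    a.\<close>
  define C where "C = 1 + 1 / (e * ln 2)"
  define P where "P = nat \<lceil>2 powr (1 / e)\<rceil>"
  have C1: "1 \<le> C" using e by (simp add: C_def)
  have small: "real a + 1 \<le> C * (real p ^ a) powr e" if "2 \<le> p" for p a :: nat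
  proof -
    have "real a + 1 \<le> C * (1 + real a * (e * ln 2))"
    proof -
      have "C * (1 + real a * (e * ln 2)) = real a * (e * ln 2) + real a + 1 + 1 / (e * ln 2)"
        using e by (simp add: C_def field_simps)
      then show ?thesis using e by (simp add: add_nonneg_nonneg)
    qed
    also have "\<dots> \<le> C * exp (real a * (e * ln 2))"
      using C1 exp_ge_add_one_self by (intro mult_left_mono) auto
    also have "\<dots> = C * 2 powr (real a * e)" by (simp add: powr_def mult_ac)
    also have "\<dots> \<le> C * real p powr (real a * e)"
      using that C1 e by (intro mult_left_mono powr_mono2) auto
    also have "real p powr (real a * e) = (real p ^ a) powr e"
      using that by (simp add: powr_powr flip: powr_realpow)
    finally show ?thesis .
  qed
  have large: "real a + 1 \<le> (real p ^ a) powr e" if "P \<le> p" "2 \<le> p" for p a :: nat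
  proof -
    have "2 powr (1 / e) \<le> real p" using that by (simp add: P_def nat_le_iff ceiling_le_iff)
    then have "(2 powr (1 / e)) powr e \<le> real p powr e" using e by (intro powr_mono2) auto
    then have 2: "2 \<le> real p powr e" using e by (simp add: powr_powr)
    have "real a + 1 \<le> 2 ^ a"
    proof -
      have "a + 1 \<le> 2 ^ a" by (induction a) auto
      then have "real (a + 1) \<le> real (2 ^ a)" by (simp only: of_nat_le_iff)
      then show ?thesis by simp
    qed
    also have "\<dots> \<le> (real p powr e) ^ a" using 2 by (intro power_mono) auto
    also have "\<dots> = (real p ^ a) powr e"
      using that by (simp add: powr_powr mult.commute flip: powr_realpow)
    finally show ?thesis .
  qed
  have main: "real (card {d. d dvd n}) \<le> C ^ card (prime_factors n \<inter> {..<P}) * real n powr e" if "0 < n" for n :: nat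
    using that
  proof (induction n rule: less_induct)
    case (less n)
    show ?case
    proof (cases "n = 1")
      case False
      obtain p where p: "prime p" "p dvd n" using prime_factor_nat False by blast
      obtain m where m: "n = p ^ multiplicity p n * m" "\<not> p dvd m"
        using multiplicity_decompose'[of n p] p less.prems by (metis not_prime_unit gr_implies_not0)
      define a where "a = multiplicity p n"
      have n: "n = p ^ a * m" using m by (simp add: a_def)
      have "0 < m" using m(2) by (intro Nat.gr0I) auto
      have "0 < a" using p less.prems by (simp add: a_def prime_multiplicity_gt_zero_iff)
      have p2: "2 \<le> p" using p prime_ge_2_nat by blast
      have "1 < p ^ a" using \<open>0 < a\<close> p2 by (intro one_less_power) auto
      then have "m < n" using \<open>0 < m\<close> n by simp
      have pf: "prime_factors n = insert p (prime_factors m)"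
      proof -
        have "prime_factors (p ^ a * m) = prime_factors (p ^ a) \<union> prime_factors m"
          using \<open>0 < m\<close> p2 by (intro prime_factors_product) auto
        then show ?thesis using n p \<open>0 < a\<close> by (simp add: prime_factorization_prime_power)
      qed
      have pn: "p \<notin> prime_factors m" using m(2) by auto
      have "real (card {d. d dvd n}) \<le> (real a + 1) * real (card {d. d dvd m})"
      proof -
        have "card {d. d dvd n} \<le> (a + 1) * card {d. d dvd m}"
          unfolding n by (rule card_divisors_prime_power_mult_le[OF p(1) \<open>0 < m\<close>])
        then have "real (card {d. d dvd n}) \<le> real ((a + 1) * card {d. d dvd m})" by (simp only: of_nat_le_iff)
        then show ?thesis by (simp only: of_nat_mult of_nat_add of_nat_1)
      qed
      also have "\<dots> \<le> (real a + 1) * (C ^ card (prime_factors m \<inter> {..<P}) * real m powr e)"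
        using less.IH[OF \<open>m < n\<close> \<open>0 < m\<close>] by (intro mult_left_mono) auto
      also have "\<dots> \<le> C ^ card (prime_factors n \<inter> {..<P}) * ((real p ^ a) powr e * real m powr e)"
      proof (cases "p < P")
        case True
        have "card (prime_factors n \<inter> {..<P}) = Suc (card (prime_factors m \<inter> {..<P}))"
          using True pn by (simp add: pf)
        moreover have "(real a + 1) * (C ^ card (prime_factors m \<inter> {..<P}) * real m powr e)
            \<le> (C * (real p ^ a) powr e) * (C ^ card (prime_factors m \<inter> {..<P}) * real m powr e)"
          using small[OF p2] C1 by (intro mult_right_mono) auto
        ultimately show ?thesis by (simp add: mult_ac)
      next
        case False
        have "prime_factors n \<inter> {..<P} = prime_factors m \<inter> {..<P}"
          using False by (auto simp: pf)
        moreover have "(real a + 1) * (C ^ card (prime_factors m \<inter> {..<P}) * real m powr e)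
            \<le> (real p ^ a) powr e * (C ^ card (prime_factors m \<inter> {..<P}) * real m powr e)"
          using large[OF _ p2] False C1 by (intro mult_right_mono) auto
        ultimately show ?thesis by (simp add: mult_ac)
      qed
      also have "(real p ^ a) powr e * real m powr e = real n powr e"
        by (simp add: n powr_mult)
      finally show ?thesis .
    qed simp
  qed
  show thesis
  proof (rule that[of "C ^ P"])
    show "1 \<le> C ^ P" using C1 by (simp add: one_le_power)
    fix n :: nat assume "0 < n"
    have "card (prime_factors n \<inter> {..<P}) \<le> card {..<P}" by (intro card_mono) auto
    then have "C ^ card (prime_factors n \<inter> {..<P}) \<le> C ^ P" using C1 by (intro power_increasing) auto
    then show "real (card {d. d dvd n}) \<le> C ^ P * real n powr e"
      using main[OF \<open>0 < n\<close>] by (meson mult_right_mono order_trans powr_ge_zero)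
  qed
qed

section \<open>Extensions of a pair: square roots of 1 modulo q, and descent\<close>

lemma card_sqrt_one_mod_le:
  fixes q :: nat
  assumes "0 < q"
  shows "finite {v::int. 0 < v \<and> v < int q \<and> int q dvd v\<^sup>2 - 1}"
    and "card {v::int. 0 < v \<and> v < int q \<and> int q dvd v\<^sup>2 - 1} \<le> 2 * card {d. d dvd q}"
proof -
  define S where "S = {v::int. 0 < v \<and> v < int q \<and> int q dvd v\<^sup>2 - 1}"
  \<comment> \<open>With g = gcd(v - 1, q) and h = q / g one has g | v - 1 and h | v + 1, so g
    determines v modulo lcm(g, h). As gcd(g, h) divides 2, this may be only half of q; the Boolean
    tells in which half of the interval v lies.\<close>
  define \<phi> where "\<phi> = (\<lambda>v::int. (nat (gcd (v - 1) (int q)), int q \<le> 2 * v))"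
  have fin: "finite ({d. d dvd q} \<times> (UNIV :: bool set))" using assms by (simp add: finite_divisors_nat)
  have sub: "\<phi> ` S \<subseteq> {d. d dvd q} \<times> UNIV"
  proof
    fix z assume "z \<in> \<phi> ` S"
    then obtain v where v: "z = \<phi> v" by blast
    have "int (nat (gcd (v - 1) (int q))) dvd int q" by simp
    then show "z \<in> {d. d dvd q} \<times> UNIV" unfolding v \<phi>_def by (simp only: of_nat_dvd_iff) simp
  qed
  have inj: "inj_on \<phi> S"
  proof (rule inj_onI)
    fix v w assume vw: "v \<in> S" "w \<in> S" "\<phi> v = \<phi> w"
    define g where "g = gcd (v - 1) (int q)"
    have gw: "g = gcd (w - 1) (int q)" 
    proof -
      have "nat (gcd (v - 1) (int q)) = nat (gcd (w - 1) (int q))" using vw(3) by (simp add: \<phi>_def)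
      then show ?thesis by (subst (asm) eq_nat_nat_iff) (auto simp: g_def)
    qed
    have "0 < g" using assms by (simp add: g_def)
    obtain h where h: "int q = g * h" unfolding g_def by (metis dvd_def gcd_dvd2)
    have "0 < h" using h \<open>0 < g\<close> assms by (metis of_nat_0_less_iff zero_less_mult_pos)
    have *: "g dvd u - 1" "h dvd u + 1" if "u \<in> S" "g = gcd (u - 1) (int q)" for u
    proof -
      show "g dvd u - 1" using that by simp
      then obtain k where k: "u - 1 = g * k" by blast
      have "coprime ((u - 1) div g) (int q div g)" using that assms by (simp add: div_gcd_coprime)
      then have cop: "coprime k h" using \<open>0 < g\<close> k h by simp
      have "int q dvd (u - 1) * (u + 1)" using that(1) by (simp add: S_def power2_eq_square algebra_simps)
      then have "g * h dvd g * (k * (u + 1))" by (simp add: k h mult.assoc)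
      then have "h dvd k * (u + 1)" using \<open>0 < g\<close> by simp
      then show "h dvd u + 1" using cop by (metis coprime_commute coprime_dvd_mult_right_iff)
    qed
    note v = *[OF vw(1) g_def] and w = *[OF vw(2) gw]
    have "gcd g h dvd (v + 1) - (v - 1)" using v by (meson dvd_diff dvd_trans gcd_dvd1 gcd_dvd2)
    then have two: "gcd g h dvd 2" by simp
    have "g dvd v - w" using dvd_diff[OF v(1) w(1)] by simp
    moreover have "h dvd v - w" using dvd_diff[OF v(2) w(2)] by simp
    ultimately have "lcm g h dvd v - w" by (rule lcm_least)
    then have "lcm g h * gcd g h dvd (v - w) * 2" using two by (rule mult_dvd_mono)
    moreover have "int q dvd lcm g h * gcd g h" using \<open>0 < g\<close> \<open>0 < h\<close> by (simp add: h lcm_mult_gcd)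
    ultimately have "int q dvd (v - w) * 2" by (rule dvd_trans[rotated])
    moreover have "\<bar>(v - w) * 2\<bar> < int q" using vw by (auto simp: \<phi>_def S_def)
    ultimately show "v = w" using dvd_imp_le_int[of "(v - w) * 2" "int q"] by force
  qed
  show "finite S" using fin sub inj by (meson finite_imageD finite_subset)
  have "card S \<le> card ({d. d dvd q} \<times> (UNIV :: bool set))"
    using card_inj_on_le[OF inj sub fin] .
  then show "card S \<le> 2 * card {d. d dvd q}" by (simp add: card_cartesian_product)
qed

definition extensions :: "nat \<Rightarrow> nat \<Rightarrow> real \<Rightarrow> nat set" where
  "extensions p q x = {n. dpair p n \<and> dpair q n \<and> real n \<le> x}"

lemma finite_extensions: "finite (extensions p q x)"
  by (rule finite_subset[of _ "{..nat \<lfloor>x\<rfloor>}"]) (auto simp: extensions_def le_nat_floor)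

lemma extensions_commute: "extensions p q x = extensions q p x"
  by (auto simp: extensions_def)

text \<open>The root v of q n + 1 is below q when n < q, it satisfies v^2 = 1 modulo q, and it
  determines n.\<close>

lemma card_small_extensions_le:
  assumes "dpair p q"
  shows "finite {n. dpair p n \<and> dpair q n \<and> n < q}"
    and "card {n. dpair p n \<and> dpair q n \<and> n < q} \<le> 2 * card {d. d dvd q}"
proof -
  define E where "E = {n. dpair p n \<and> dpair q n \<and> n < q}"
  show fin: "finite E" by (rule finite_subset[of _ "{..<q}"]) (auto simp: E_def)
  have q: "0 < q" using assms by (simp add: dpair_def)
  define V where "V = {v::int. 0 < v \<and> v < int q \<and> int q dvd v\<^sup>2 - 1}"
  have "E \<subseteq> (\<lambda>v. nat ((v\<^sup>2 - 1) div int q)) ` V"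
  proof
    fix n assume n: "n \<in> E"
    then obtain v where v: "0 < v" "v\<^sup>2 = q * n + 1" unfolding E_def by (blast elim: dpairE)
    have "0 < n" "n < q" using n by (auto simp: E_def dpair_def)
    have "q * n + 1 < q\<^sup>2"
    proof -
      have "q \<noteq> 1" using \<open>0 < n\<close> \<open>n < q\<close> by simp
      have "q * n + q \<le> q * q" using \<open>n < q\<close> by (metis Suc_leI mult_Suc_right add.commute mult_le_mono2)
      then show ?thesis using q \<open>q \<noteq> 1\<close> by (simp add: power2_eq_square)
    qed
    then have "v < q" using v(2) by (metis power_less_imp_less_base zero_le)
    have iv: "(int v)\<^sup>2 - 1 = int q * int n" using v(2) by (simp flip: of_nat_power)
    then have "int v \<in> V" using v(1) \<open>v < q\<close> by (simp add: V_def)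
    moreover have "n = nat (((int v)\<^sup>2 - 1) div int q)" using iv q by simp
    ultimately show "n \<in> (\<lambda>v. nat ((v\<^sup>2 - 1) div int q)) ` V" by blast
  qed
  then have "card E \<le> card V" using card_sqrt_one_mod_le(1)[OF q] unfolding V_def by (meson surj_card_le)
  also have "\<dots> \<le> 2 * card {d. d dvd q}" unfolding V_def by (rule card_sqrt_one_mod_le(2)[OF q])
  finally show "card E \<le> 2 * card {d. d dvd q}" .
qed

text \<open>Repeated descent over p, q ends below q or at 0, and takes at most logarithmically many
  steps. Every extension is thus given by a starting point and a number of iterations.\<close>

lemma card_extensions_le:
  assumes pq: "dpair p q" "p < q" and x: "1 \<le> x"
  shows "real (card (extensions p q x)) \<le> (2 + ln x) * (2 * real (card {d. d dvd q}) + 1)"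
proof -
  \<comment> \<open>On the orbits considered \<open>dplus\<close> has natural values; the floor only
    turns it into a function on \<open>nat\<close>.\<close>
  define f where "f = (\<lambda>n::nat. nat \<lfloor>dplus p q n\<rfloor>)"
  define E where "E = insert 0 {n. dpair p n \<and> dpair q n \<and> n < q}"
  define J where "J = nat \<lfloor>log 4 (4 * x)\<rfloor>"
  have pos: "0 < p" "0 < q" using pq by (auto simp: dpair_def)
  \<comment> \<open>A step from a nonzero m gains a factor 4; the step from 0 gains none, hence 4 n
    in place of n.\<close>
  have orbit: "\<exists>j e. e \<in> E \<and> n = (f ^^ j) e \<and> 4 ^ j \<le> 4 * n" if "dpair p n" "dpair q n" for n
    using that
  proof (induction n rule: less_induct)
    case (less n)
    have n: "0 < n" "n \<noteq> q" using less.prems dpair_neq by (auto simp: dpair_def)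
    show ?case
    proof (cases "n < q")
      case True
      then have "n \<in> E" using less.prems by (simp add: E_def)
      then show ?thesis using n by (intro exI[of _ 0] exI[of _ n]) simp
    next
      case False
      then have "p < n" "q < n" using n pq by auto
      then obtain m where m: "m = 0 \<or> dpair p m \<and> dpair q m" "real n = dplus p q m"
        using dpair_descent[OF pq(1) less.prems] by blast
      have nf: "n = f m" by (simp add: f_def flip: m(2))
      show ?thesis
      proof (cases "m = 0")
        case True
        then show ?thesis using nf n by (intro exI[of _ 1] exI[of _ 0]) (simp add: E_def)
      next
        case False
        have "4 * real p * real q * real m < real n" unfolding m(2) using pos by (intro dplus_gt) auto
        then have "real (4 * p * q * m) < real n" by simp
        then have "4 * p * q * m < n" by (simp only: of_nat_less_iff)
        moreover have "4 * m * 1 \<le> 4 * m * (p * q)" using pos by (intro mult_le_mono2) (simp add: Suc_le_eq)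
        moreover have "4 * m * (p * q) = 4 * p * q * m" by simp
        ultimately have "4 * m < n" by linarith
        then obtain j e where je: "e \<in> E" "m = (f ^^ j) e" "4 ^ j \<le> 4 * m"
          using less.IH[of m] m(1) False by auto
        then show ?thesis using nf \<open>4 * m < n\<close> by (intro exI[of _ "Suc j"] exI[of _ e]) auto
      qed
    qed
  qed
  have fin: "finite E" using card_small_extensions_le(1)[OF pq(1)] by (simp add: E_def)
  have "extensions p q x \<subseteq> (\<lambda>(j, e). (f ^^ j) e) ` ({..J} \<times> E)"
  proof
    fix n assume "n \<in> extensions p q x"
    then have n: "dpair p n" "dpair q n" "real n \<le> x" by (auto simp: extensions_def)
    then obtain j e where je: "e \<in> E" "n = (f ^^ j) e" "4 ^ j \<le> 4 * n" using orbit by blast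
    have "real (4 ^ j) \<le> real (4 * n)" using je(3) by (simp only: of_nat_le_iff)
    then have "4 ^ j \<le> 4 * x" using n(3) by simp
    then have "4 powr real j \<le> 4 * x" by (simp add: powr_realpow)
    then have "real j \<le> log 4 (4 * x)" using x by (simp add: le_log_iff)
    then have "j \<le> J" by (simp add: J_def le_nat_floor)
    then show "n \<in> (\<lambda>(j, e). (f ^^ j) e) ` ({..J} \<times> E)" using je by force
  qed
  then have "card (extensions p q x) \<le> card ({..J} \<times> E)"
    using fin by (meson finite_SigmaI finite_atMost surj_card_le)
  then have "card (extensions p q x) \<le> (J + 1) * card E" by (simp only: card_cartesian_product card_atMost Suc_eq_plus1)
  then have "real (card (extensions p q x)) \<le> real ((J + 1) * card E)" by (simp only: of_nat_le_iff)
  also have "\<dots> = (real J + 1) * real (card E)" by (simp only: of_nat_mult of_nat_add of_nat_1)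
  also have "\<dots> \<le> (2 + ln x) * (2 * real (card {d. d dvd q}) + 1)"
  proof (rule mult_mono)
    have "real J \<le> log 4 (4 * x)" unfolding J_def using x by (intro of_nat_floor) simp
    also have "\<dots> = 1 + ln x / ln 4" using x by (simp add: log_def ln_mult add_divide_distrib)
    also have "ln x / ln 4 \<le> ln x / 1"
    proof (intro divide_left_mono)
      have "exp 1 \<le> (4::real)" using exp_le by simp
      then show "1 \<le> ln (4::real)" by (simp add: ln_ge_iff)
    qed (use x in auto)
    finally show "real J + 1 \<le> 2 + ln x" by simp
    have "card E \<le> Suc (card {n. dpair p n \<and> dpair q n \<and> n < q})" unfolding E_def
      using card_insert_le_m1 by (simp add: card_insert_if fin)
    also have "\<dots> \<le> 2 * card {d. d dvd q} + 1" using card_small_extensions_le(2)[OF pq(1)] by simp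
    finally have "real (card E) \<le> real (2 * card {d. d dvd q} + 1)" by (simp only: of_nat_le_iff)
    then show "real (card E) \<le> 2 * real (card {d. d dvd q}) + 1" by simp
  qed (use x in auto)
  finally show ?thesis .
qed

text \<open>One factor x^e absorbs the logarithm, the other the divisor function.\<close>

lemma extensions_bound:
  fixes e :: real
  assumes e: "0 < e"
  obtains K where "1 \<le> K" "\<And>p q x. dpair p q \<Longrightarrow> real p \<le> x \<Longrightarrow> real q \<le> x \<Longrightarrow>
    real (card (extensions p q x)) \<le> K * x powr (2 * e)"
proof -
  obtain D where D: "1 \<le> D" "\<And>n::nat. 0 < n \<Longrightarrow> real (card {d. d dvd n}) \<le> D * real n powr e"
    using divisor_bound[OF e] by blast
  define K where "K = (2 + 1 / e) * (2 * D + 1)"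
  have le: "real (card (extensions p q x)) \<le> K * x powr (2 * e)"
    if "dpair p q" "p < q" "real q \<le> x" for p q x
  proof -
    have pos: "0 < q" "1 \<le> x" using that by (auto simp: dpair_def)
    have x1: "1 \<le> x powr e" using pos e by (simp add: ge_one_powr_ge_zero)
    have "real (card (extensions p q x)) \<le> (2 + ln x) * (2 * real (card {d. d dvd q}) + 1)"
      using that pos by (intro card_extensions_le)
    also have "\<dots> \<le> ((2 + 1 / e) * x powr e) * ((2 * D + 1) * x powr e)"
    proof (rule mult_mono)
      have "ln x \<le> x powr e / e" using ln_powr_bound pos e by blast
      then show "2 + ln x \<le> (2 + 1 / e) * x powr e" using x1 by (simp add: algebra_simps)
      have "real (card {d. d dvd q}) \<le> D * real q powr e" using D pos by blast
      also have "\<dots> \<le> D * x powr e" using that D e by (intro mult_left_mono powr_mono2) auto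
      finally show "2 * real (card {d. d dvd q}) + 1 \<le> (2 * D + 1) * x powr e"
        using x1 by (simp add: algebra_simps)
    qed (use pos e in auto)
    also have "\<dots> = K * (x powr e * x powr e)" by (simp add: K_def)
    also have "x powr e * x powr e = x powr (2 * e)" by (simp flip: powr_add)
    finally show ?thesis .
  qed
  show thesis
  proof (rule that[of K])
    have "1 * 1 \<le> (2 + 1 / e) * (2 * D + 1)" using e D by (intro mult_mono) auto
    then show "1 \<le> K" by (simp add: K_def)
    fix p q x assume "dpair p q" "real p \<le> x" "real q \<le> x"
    moreover have "p < q \<or> q < p" using dpair_neq[OF \<open>dpair p q\<close>] by auto
    ultimately show "real (card (extensions p q x)) \<le> K * x powr (2 * e)"
      using le dpair_commute extensions_commute by metis
  qed
qed

section \<open>Diophantine pairs with product below sqrt x / 4\<close>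

definition small_pairs :: "real \<Rightarrow> (nat \<times> nat) set" where
  "small_pairs x = {(p, q). dpair p q \<and> 16 * (real p * real q)\<^sup>2 < x}"

lemma small_pairsD:
  assumes "(p, q) \<in> small_pairs x"
  shows "dpair p q" "16 * (real p * real q)\<^sup>2 < x" "real p \<le> x" "real q \<le> x"
    "real p * real q + 1 \<le> x powr (1 / 2)"
proof -
  show pq: "dpair p q" "16 * (real p * real q)\<^sup>2 < x" using assms by (auto simp: small_pairs_def)
  have "0 < p" "0 < q" using pq(1) by (auto simp: dpair_def)
  then have m: "1 \<le> p * q" by (simp add: Suc_le_eq)
  define m where "m = real p * real q"
  have m1: "1 \<le> m" 
  proof -
    have "real 1 \<le> real (p * q)" using m by (simp only: of_nat_le_iff)
    then show ?thesis by (simp add: m_def)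
  qed
  have "(m + 1)\<^sup>2 \<le> (4 * m)\<^sup>2" using m1 by (intro power_mono) auto
  also have "\<dots> < x" using pq(2) by (simp add: m_def power2_eq_square)
  finally have x: "(m + 1)\<^sup>2 < x" .
  then have "m + 1 \<le> sqrt x" by (simp add: real_le_rsqrt)
  moreover have "0 < x" using x zero_le_power2[of "m + 1"] by linarith
  ultimately show "real p * real q + 1 \<le> x powr (1 / 2)" by (simp add: powr_half_sqrt m_def)
  have "m * 1 \<le> m * m" using m1 by (intro mult_left_mono) auto
  moreover have "(m + 1)\<^sup>2 = m * m + 2 * m + 1" by (simp add: power2_eq_square algebra_simps)
  ultimately have mx: "m \<le> x" using x m1 by linarith
  have "real p * 1 \<le> real p * real q" "1 * real q \<le> real p * real q"
    using \<open>0 < p\<close> \<open>0 < q\<close> by (intro mult_mono; simp)+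
  then show "real p \<le> x" "real q \<le> x" using mx by (auto simp: m_def)
qed

text \<open>A pair is a number r with r^2 = p q + 1, so r <= x^(1/4), together with a divisor p of
  r^2 - 1.\<close>

lemma small_pairs_bound:
  fixes e :: real
  assumes e: "0 < e"
  obtains K where "0 \<le> K" "\<And>x. 1 \<le> x \<Longrightarrow> finite (small_pairs x)"
    "\<And>x. 1 \<le> x \<Longrightarrow> real (card (small_pairs x)) \<le> K * x powr (1 / 4 + e)"
proof -
  obtain D where D: "1 \<le> D" "\<And>n::nat. 0 < n \<Longrightarrow> real (card {d. d dvd n}) \<le> D * real n powr e"
    using divisor_bound[OF e] by blast
  have main: "finite (small_pairs x) \<and> real (card (small_pairs x)) \<le> D * x powr (1 / 4 + e)" if x: "1 \<le> x" for x
  proof -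
    define R where "R = {r::nat. 2 \<le> r \<and> real r ^ 2 \<le> x powr (1 / 2)}"
    have half: "(x powr (1 / 4))\<^sup>2 = x powr (1 / 2)" using x by (simp add: powr_power)
    have R: "R \<subseteq> {1..nat \<lfloor>x powr (1 / 4)\<rfloor>}"
    proof
      fix r assume "r \<in> R"
      then have "real r ^ 2 \<le> (x powr (1 / 4))\<^sup>2" "2 \<le> r" by (auto simp: R_def half)
      then have "real r \<le> x powr (1 / 4)" by (meson power2_le_imp_le powr_ge_zero)
      then show "r \<in> {1..nat \<lfloor>x powr (1 / 4)\<rfloor>}" using \<open>2 \<le> r\<close> by (simp add: le_nat_floor)
    qed
    then have finR: "finite R" by (rule finite_subset) simp
    have "card R \<le> nat \<lfloor>x powr (1 / 4)\<rfloor>" using card_mono[OF _ R] by simp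
    then have cR: "real (card R) \<le> x powr (1 / 4)" by (meson of_nat_floor of_nat_le_iff order_trans powr_ge_zero)
    define S where "S = (SIGMA r:R. {d. d dvd r\<^sup>2 - 1})"
    have r1: "0 < r\<^sup>2 - 1" if "r \<in> R" for r
    proof -
      have "2\<^sup>2 \<le> r\<^sup>2" using that unfolding R_def by (intro power_mono) auto
      then show ?thesis by simp
    qed
    have finS: "finite S" unfolding S_def using finR r1 by (intro finite_SigmaI) (auto simp: finite_divisors_nat)
    have "small_pairs x \<subseteq> (\<lambda>(r, d). (d, (r\<^sup>2 - 1) div d)) ` S"
    proof
      fix z assume "z \<in> small_pairs x"
      then obtain p q where z: "z = (p, q)" "(p, q) \<in> small_pairs x" by (cases z) auto
      note pq = small_pairsD[OF z(2)]
      obtain r where r: "0 < r" "r\<^sup>2 = p * q + 1" using dpairE[OF pq(1)] by blast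
      have p: "0 < p" "0 < q" using pq(1) by (auto simp: dpair_def)
      have "real (r\<^sup>2) \<le> x powr (1 / 2)" unfolding r(2) using pq(5) by simp
      moreover have "r \<noteq> 1" using r(2) p by auto
      ultimately have "r \<in> R" using r(1) by (simp add: R_def)
      then have "(r, p) \<in> S" using r(2) by (simp add: S_def)
      moreover have "z = (p, (r\<^sup>2 - 1) div p)" using z r p by simp
      ultimately show "z \<in> (\<lambda>(r, d). (d, (r\<^sup>2 - 1) div d)) ` S" by force
    qed
    then have fin: "finite (small_pairs x)" and "card (small_pairs x) \<le> card S"
      using finS by (auto intro: finite_surj surj_card_le)
    then have "real (card (small_pairs x)) \<le> real (card S)" by simp
    also have "\<dots> = (\<Sum>r\<in>R. real (card {d. d dvd r\<^sup>2 - 1}))"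
      unfolding S_def using finR r1 by (subst card_SigmaI) (auto simp: finite_divisors_nat)
    also have "\<dots> \<le> (\<Sum>r\<in>R. D * x powr e)"
    proof (rule sum_mono)
      fix r assume r: "r \<in> R"
      have "real (card {d. d dvd r\<^sup>2 - 1}) \<le> D * real (r\<^sup>2 - 1) powr e" using D r1[OF r] by blast
      also have "real (r\<^sup>2 - 1) \<le> x"
      proof -
        have "real (r\<^sup>2 - 1) \<le> real r ^ 2" by (metis diff_le_self of_nat_le_iff of_nat_power)
        also have "\<dots> \<le> x powr (1 / 2)" using r by (simp add: R_def)
        also have "\<dots> \<le> x powr 1" using x by (intro powr_mono) auto
        finally show ?thesis using x by simp
      qed
      then have "D * real (r\<^sup>2 - 1) powr e \<le> D * x powr e"
        using D(1) e by (intro mult_left_mono powr_mono2) auto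
      finally show "real (card {d. d dvd r\<^sup>2 - 1}) \<le> D * x powr e" .
    qed
    also have "\<dots> = real (card R) * (D * x powr e)" by simp
    also have "\<dots> \<le> x powr (1 / 4) * (D * x powr e)" using cR D(1) by (intro mult_right_mono) auto
    also have "\<dots> = D * x powr (1 / 4 + e)" by (simp add: powr_add)
    finally show ?thesis using fin by simp
  qed
  show thesis using D(1) main by (intro that[of D]) auto
qed

section \<open>Assembling the sporadic quadruples\<close>

definition sporadic_quadruples :: "real \<Rightarrow> nat set set" where
  "sporadic_quadruples x = {{a, b, c, d} | a b c d. a < b \<and> b < c \<and> c < d \<and>
     dpair a b \<and> dpair a c \<and> dpair a d \<and> dpair b c \<and> dpair b d \<and> dpair c d \<and> real d \<le> x \<and>
     \<not> (real c = dplus a b 0 \<and> real d = dplus a b c)}"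

text \<open>The first union covers the alternative \<open>small\<close> of
  \<open>quadruple_cases\<close>, the second \<open>conjugate\<close>. The floor is applied to a
  value that equals the natural number d.\<close>

lemma sporadic_quadruples_subset:
  "sporadic_quadruples x \<subseteq>
     (\<Union>(p, q)\<in>small_pairs x. (\<lambda>(c, d). {p, q, c, d}) ` (extensions p q x \<times> extensions p q x)) \<union>
     (\<Union>(e, b)\<in>small_pairs x. \<Union>c\<in>extensions e b x. (\<lambda>a. {a, b, c, nat \<lfloor>dplus b c e\<rfloor>}) ` extensions b c x)"
  (is "_ \<subseteq> ?U \<union> ?V")
proof
  fix A assume "A \<in> sporadic_quadruples x"
  then obtain a b c d where A: "A = {a, b, c, d}" and lt: "a < b" "b < c" "c < d"
    and pairs: "dpair a b" "dpair a c" "dpair a d" "dpair b c" "dpair b d" "dpair c d"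
    and dx: "real d \<le> x" and nreg: "\<not> (real c = dplus a b 0 \<and> real d = dplus a b c)"
    unfolding sporadic_quadruples_def by blast
  show "A \<in> ?U \<union> ?V"
    using lt pairs
  proof (cases rule: quadruple_cases)
    case regular
    then show ?thesis using nreg by blast
  next
    case (small p q)
    have *: "A \<in> ?U" if "(p, q) \<in> small_pairs x" "A = {p, q, u, v}" "u \<in> extensions p q x" "v \<in> extensions p q x" for p q u v
      using that by (intro UN_I[of "(p, q)"]) (auto intro!: rev_image_eqI[of "(u, v)"])
    have sm: "16 * (real p * real q)\<^sup>2 < x" using small(4) dx by linarith
    have le: "real a \<le> x" "real b \<le> x" "real c \<le> x" using lt dx by auto
    note sym = pairs[THEN iffD1[OF dpair_commute]]
    consider "{p, q} = {a, b}" | "{p, q} = {a, c}" | "{p, q} = {b, c}" using small(1-3) by auto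
    then have "A \<in> ?U"
    proof cases
      case 1
      show ?thesis
        by (rule *[of p q c d])
          (use 1 A sm pairs sym le dx in \<open>auto simp: doubleton_eq_iff small_pairs_def extensions_def\<close>)
    next
      case 2
      show ?thesis
        by (rule *[of p q b d])
          (use 2 A sm pairs sym le dx in \<open>auto simp: doubleton_eq_iff small_pairs_def extensions_def\<close>)
    next
      case 3
      show ?thesis
        by (rule *[of p q a d])
          (use 3 A sm pairs sym le dx in \<open>auto simp: doubleton_eq_iff small_pairs_def extensions_def\<close>)
    qed
    then show ?thesis ..
  next
    case (conjugate e)
    have "(e, b) \<in> small_pairs x" using conjugate dx by (simp add: small_pairs_def)
    moreover have "c \<in> extensions e b x" using conjugate pairs lt dx by (simp add: extensions_def)
    moreover have "a \<in> extensions b c x" using pairs lt dx by (simp add: extensions_def dpair_commute)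
    moreover have "A = {a, b, c, nat \<lfloor>dplus b c e\<rfloor>}" using A by (simp flip: conjugate(3))
    ultimately have "A \<in> ?V" by blast
    then show ?thesis ..
  qed
qed

lemma card_UN_bound:
  fixes M :: real
  assumes "finite I" "\<And>i. i \<in> I \<Longrightarrow> finite (F i)" "\<And>i. i \<in> I \<Longrightarrow> real (card (F i)) \<le> M"
  shows "real (card (\<Union>i\<in>I. F i)) \<le> real (card I) * M"
proof -
  have "card (\<Union>i\<in>I. F i) \<le> (\<Sum>i\<in>I. card (F i))" using assms(1) by (rule card_UN_le)
  then have "real (card (\<Union>i\<in>I. F i)) \<le> real (\<Sum>i\<in>I. card (F i))" by (simp only: of_nat_le_iff)
  also have "\<dots> = (\<Sum>i\<in>I. real (card (F i)))" by simp
  also have "\<dots> \<le> real (card I) * M" using assms(3) by (rule sum_bounded_above)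
  finally show ?thesis .
qed

lemma card_sporadic_quadruples:
  obtains K where "0 \<le> K" "\<And>x. 1 \<le> x \<Longrightarrow> finite (sporadic_quadruples x)"
    "\<And>x. 1 \<le> x \<Longrightarrow> real (card (sporadic_quadruples x)) \<le> K * x powr (1 / 3)"
proof -
  \<comment> \<open>The small pairs cost 1/4 + e and the two extensions 2 e each; 1/4 + 5 e =
    1/3.\<close>
  define e :: real where "e = 1 / 60"
  obtain P where P: "0 \<le> P" "\<And>x. 1 \<le> x \<Longrightarrow> finite (small_pairs x)"
    "\<And>x. 1 \<le> x \<Longrightarrow> real (card (small_pairs x)) \<le> P * x powr (1 / 4 + e)"
    using small_pairs_bound[of e] by (auto simp: e_def)
  obtain E where E: "1 \<le> E" "\<And>p q x. dpair p q \<Longrightarrow> real p \<le> x \<Longrightarrow> real q \<le> x \<Longrightarrow>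
      real (card (extensions p q x)) \<le> E * x powr (2 * e)"
    using extensions_bound[of e] by (auto simp: e_def)
  have main: "finite (sporadic_quadruples x) \<and> real (card (sporadic_quadruples x)) \<le> (2 * P * E\<^sup>2) * x powr (1 / 3)"
    if x: "1 \<le> x" for x
  proof -
    define M where "M = E * x powr (2 * e)"
    have M: "0 \<le> M" using E by (simp add: M_def)
    define U where "U = (\<Union>z\<in>small_pairs x. case z of (p, q) \<Rightarrow>
      (\<lambda>(c, d). {p, q, c, d}) ` (extensions p q x \<times> extensions p q x))"
    define V where "V = (\<Union>z\<in>small_pairs x. case z of (e, b) \<Rightarrow> \<Union>c\<in>extensions e b x.
      (\<lambda>a. {a, b, c, nat \<lfloor>dplus b c e\<rfloor>}) ` extensions b c x)"
    have sub: "sporadic_quadruples x \<subseteq> U \<union> V"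
      using sporadic_quadruples_subset unfolding U_def V_def .
    have finU: "finite U" unfolding U_def using P(2)[OF x] by (auto simp: finite_extensions)
    have finV: "finite V" unfolding V_def using P(2)[OF x] by (auto simp: finite_extensions)
    have "real (card U) \<le> real (card (small_pairs x)) * M\<^sup>2"
      unfolding U_def
    proof (rule card_UN_bound[OF P(2)[OF x]])
      fix z assume z: "z \<in> small_pairs x"
      obtain p q where pq: "z = (p, q)" by (cases z)
      note pq' = small_pairsD[OF z[unfolded pq]]
      let ?S = "extensions p q x \<times> extensions p q x"
      have "card ((\<lambda>(c, d). {p, q, c, d}) ` ?S) \<le> card ?S" by (intro card_image_le) (simp add: finite_extensions)
      then have "real (card ((\<lambda>(c, d). {p, q, c, d}) ` ?S)) \<le> real (card ?S)" by (simp only: of_nat_le_iff)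
      also have "\<dots> = real (card (extensions p q x)) * real (card (extensions p q x))"
        by (simp only: card_cartesian_product of_nat_mult)
      also have "\<dots> \<le> M * M" unfolding M_def using E(2)[OF pq'(1,3,4)] E(1) by (intro mult_mono) auto
      finally show "real (card (case z of (p, q) \<Rightarrow> (\<lambda>(c, d). {p, q, c, d}) ` (extensions p q x \<times> extensions p q x))) \<le> M\<^sup>2"
        by (simp add: pq power2_eq_square)
    qed (auto simp: finite_extensions)
    moreover have "real (card V) \<le> real (card (small_pairs x)) * M\<^sup>2"
      unfolding V_def
    proof (rule card_UN_bound[OF P(2)[OF x]])
      fix z assume z: "z \<in> small_pairs x"
      obtain e b where eb: "z = (e, b)" by (cases z)
      note eb' = small_pairsD[OF z[unfolded eb]]
      have "real (card (\<Union>c\<in>extensions e b x. (\<lambda>a. {a, b, c, nat \<lfloor>dplus b c e\<rfloor>}) ` extensions b c x))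
          \<le> real (card (extensions e b x)) * M"
      proof (rule card_UN_bound)
        fix c assume "c \<in> extensions e b x"
        then have c: "dpair b c" "real c \<le> x" by (auto simp: extensions_def)
        have "card ((\<lambda>a. {a, b, c, nat \<lfloor>dplus b c e\<rfloor>}) ` extensions b c x) \<le> card (extensions b c x)"
          by (intro card_image_le finite_extensions)
        then have "real (card ((\<lambda>a. {a, b, c, nat \<lfloor>dplus b c e\<rfloor>}) ` extensions b c x)) \<le> real (card (extensions b c x))"
          by (simp only: of_nat_le_iff)
        also have "\<dots> \<le> M" unfolding M_def using E(2) c eb' by blast
        finally show "real (card ((\<lambda>a. {a, b, c, nat \<lfloor>dplus b c e\<rfloor>}) ` extensions b c x)) \<le> M" .
      qed (auto simp: finite_extensions)
      also have "\<dots> \<le> M * M" unfolding M_def using E(2)[OF eb'(1,3,4)] E(1) by (intro mult_mono) auto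
      finally show "real (card (case z of (e, b) \<Rightarrow> \<Union>c\<in>extensions e b x.
          (\<lambda>a. {a, b, c, nat \<lfloor>dplus b c e\<rfloor>}) ` extensions b c x)) \<le> M\<^sup>2"
        by (simp add: eb power2_eq_square)
    qed (auto simp: finite_extensions)
    moreover have "real (card (sporadic_quadruples x)) \<le> real (card U) + real (card V)"
    proof -
      have "card (sporadic_quadruples x) \<le> card (U \<union> V)" using finU finV sub by (intro card_mono) auto
      also have "\<dots> \<le> card U + card V" by (rule card_Un_le)
      finally show ?thesis by linarith
    qed
    ultimately have "real (card (sporadic_quadruples x)) \<le> 2 * (real (card (small_pairs x)) * M\<^sup>2)" by linarith
    also have "\<dots> \<le> 2 * ((P * x powr (1 / 4 + e)) * M\<^sup>2)"
      using P(3)[OF x] by (intro mult_left_mono mult_right_mono) auto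
    also have "\<dots> = (2 * P * E\<^sup>2) * (x powr (1 / 4 + e) * x powr (2 * e) * x powr (2 * e))"
      by (simp add: M_def power2_eq_square)
    also have "x powr (1 / 4 + e) * x powr (2 * e) * x powr (2 * e) = x powr (1 / 3)"
      by (simp add: e_def flip: powr_add)
    finally show ?thesis using finU finV sub finite_subset[of "sporadic_quadruples x" "U \<union> V"] by simp
  qed
  show thesis using main P(1) by (intro that[of "2 * P * E\<^sup>2"]) auto
qed

section \<open>The weighted sum over coprime pairs\<close>

text \<open>The profile of the weights (m l (m + l))^(-2/3) along m + l = s: with t = m / s the
  weight is the kernel at t divided by s^2.\<close>

definition beta_kernel :: "real \<Rightarrow> real" where
  "beta_kernel t = t powr (- 2 / 3) * (1 - t) powr (- 2 / 3)"

abbreviation beta_third :: real where "beta_third \<equiv> Beta (1 / 3) (1 / 3)"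

lemma beta_kernel_has_integral: "(beta_kernel has_integral beta_third) {0..1}"
  using has_integral_Beta_real[of "1/3" "1/3"] by (simp add: beta_kernel_def[abs_def])

lemma beta_kernel_integrable:
  assumes "0 \<le> a" "b \<le> 1"
  shows "beta_kernel integrable_on {a..b}"
proof (rule integrable_on_subinterval)
  show "beta_kernel integrable_on {0..1}"
    using beta_kernel_has_integral by (rule has_integral_integrable)
qed (use assms in auto)

lemma beta_kernel_nonneg: "0 \<le> beta_kernel t"
  by (simp add: beta_kernel_def)

lemma beta_kernel_eq: "0 < t \<Longrightarrow> t < 1 \<Longrightarrow> beta_kernel t = (t * (1 - t)) powr (- 2 / 3)"
  by (simp add: beta_kernel_def powr_mult)

lemma beta_kernel_antimono:
  assumes "0 < u" "u < 1" "0 < v" "v < 1" "u * (1 - u) \<le> v * (1 - v)"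
  shows "beta_kernel v \<le> beta_kernel u"
  unfolding beta_kernel_eq[OF assms(1,2)] beta_kernel_eq[OF assms(3,4)]
  using assms by (intro powr_mono2') auto

definition beta_cell :: "nat \<Rightarrow> nat \<Rightarrow> real" where
  "beta_cell s k = integral {real k / real s..real (Suc k) / real s} beta_kernel"

lemma sum_beta_cell:
  assumes "0 < s"
  shows "(\<Sum>k<s. beta_cell s k) = beta_third"
proof -
  define \<Phi> where "\<Phi> = (\<lambda>k::nat. integral {0..real k / real s} beta_kernel)"
  have "beta_cell s k = \<Phi> (Suc k) - \<Phi> k" if "k < s" for k
  proof -
    have "\<Phi> k + beta_cell s k = \<Phi> (Suc k)"
      unfolding \<Phi>_def beta_cell_def
    proof (rule Henstock_Kurzweil_Integration.integral_combine)
      show "real k / real s \<le> real (Suc k) / real s" by (intro divide_right_mono) auto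
      have "real (Suc k) / real s \<le> 1" using that by simp
      then show "beta_kernel integrable_on {0..real (Suc k) / real s}" by (intro beta_kernel_integrable) auto
    qed simp
    then show ?thesis by simp
  qed
  then have "(\<Sum>k<s. beta_cell s k) = (\<Sum>k<s. \<Phi> (Suc k) - \<Phi> k)" by (intro sum.cong) auto
  also have "\<dots> = \<Phi> s - \<Phi> 0" by (rule sum_lessThan_telescope)
  also have "\<dots> = beta_third"
    using assms beta_kernel_has_integral by (simp add: \<Phi>_def integral_unique)
  finally show ?thesis .
qed

lemma beta_cell_nonneg: "0 \<le> beta_cell s k"
proof (cases "beta_kernel integrable_on {real k / real s..real (Suc k) / real s}")
  case True
  then show ?thesis unfolding beta_cell_def using beta_kernel_nonneg by (rule integral_nonneg)
next
  case False
  then show ?thesis unfolding beta_cell_def by (metis not_integrable_integral order_refl)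
qed

lemma beta_cell_ge:
  assumes k: "k < s" and u: "0 < u" "u < 1"
    and le: "\<And>t. real k / real s \<le> t \<Longrightarrow> t \<le> real (Suc k) / real s \<Longrightarrow> 0 < t \<Longrightarrow> t < 1 \<Longrightarrow> t * (1 - t) \<le> u * (1 - u)"
  shows "beta_kernel u / real s \<le> beta_cell s k"
proof -
  let ?I = "{real k / real s..real (Suc k) / real s}"
  have s: "0 < real s" using k by simp
  \<comment> \<open>As \<open>0 powr\<close> is 0, the kernel vanishes at 0 and 1, where it should
    be infinite. The constant is changed at these two points, which leaves its integral alone and
    makes the pointwise comparison true.\<close>
  define g where "g = (\<lambda>t::real. if t \<in> {0, 1} then 0 else beta_kernel u)"
  have "real (Suc k) / real s - real k / real s = 1 / real s" by (simp add: diff_divide_distrib[symmetric])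
  moreover have "real k / real s \<le> real (Suc k) / real s" by (intro divide_right_mono) auto
  ultimately have "((\<lambda>t. beta_kernel u) has_integral beta_kernel u / real s) ?I"
    using has_integral_const_real[of "beta_kernel u" "real k / real s" "real (Suc k) / real s"]
    by (simp del: of_nat_Suc)
  then have "(g has_integral beta_kernel u / real s) ?I"
    by (rule has_integral_spike_finite[of "{0, 1}", rotated 2]) (auto simp: g_def)
  moreover have "(beta_kernel has_integral beta_cell s k) ?I"
    unfolding beta_cell_def using k by (intro integrable_integral beta_kernel_integrable) auto
  moreover have "g t \<le> beta_kernel t" if "t \<in> ?I" for t
  proof (cases "t \<in> {0, 1}")
    case False
    have "real (Suc k) / real s \<le> 1" "0 \<le> real k / real s" using k by auto
    then have "0 \<le> t" "t \<le> 1" using that unfolding atLeastAtMost_iff by linarith+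
    then have "0 < t" "t < 1" using False by auto
    then show ?thesis using that u le[of t] False by (auto simp: g_def intro!: beta_kernel_antimono)
  qed (auto simp: g_def beta_kernel_nonneg)
  ultimately show ?thesis by (rule has_integral_le)
qed

text \<open>No constant dominates the kernel on a cell touching 0 or 1, so the two end cells are
  left to a separate estimate.\<close>

lemma beta_cell_le:
  assumes k: "0 < k" "Suc k < s" and u: "0 < u" "u < 1"
    and le: "\<And>t. real k / real s \<le> t \<Longrightarrow> t \<le> real (Suc k) / real s \<Longrightarrow> 0 < t \<Longrightarrow> t < 1 \<Longrightarrow> u * (1 - u) \<le> t * (1 - t)"
  shows "beta_cell s k \<le> beta_kernel u / real s"
proof -
  let ?I = "{real k / real s..real (Suc k) / real s}"
  have s: "0 < real s" using k by simp
  have "real (Suc k) / real s - real k / real s = 1 / real s" by (simp add: diff_divide_distrib[symmetric])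
  moreover have "real k / real s \<le> real (Suc k) / real s" by (intro divide_right_mono) auto
  ultimately have "((\<lambda>t. beta_kernel u) has_integral beta_kernel u / real s) ?I"
    using has_integral_const_real[of "beta_kernel u" "real k / real s" "real (Suc k) / real s"]
    by (simp del: of_nat_Suc)
  moreover have "(beta_kernel has_integral beta_cell s k) ?I"
    unfolding beta_cell_def using k by (intro integrable_integral beta_kernel_integrable) auto
  moreover have "beta_kernel t \<le> beta_kernel u" if "t \<in> ?I" for t
  proof -
    have "real (Suc k) / real s < 1" "0 < real k / real s" using k by auto
    then have "0 < t" "t < 1" using that by (auto simp del: of_nat_Suc)
    then show ?thesis using that u le[of t] by (auto intro!: beta_kernel_antimono)
  qed
  ultimately show ?thesis by (intro has_integral_le[of beta_kernel "beta_cell s k" ?I "\<lambda>t. beta_kernel u"])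
qed

text \<open>On an end cell the nonsingular factor is at most 2^(2/3) <= 2, and the singular one
  integrates to 3 s^(-1/3).\<close>

lemma beta_cell_end_le:
  assumes "2 \<le> s"
  shows "beta_cell s 0 \<le> 6 * real s powr (- 1 / 3)"
    and "beta_cell s (s - 1) \<le> 6 * real s powr (- 1 / 3)"
proof -
  define c where "c = 1 / real s"
  have c: "0 < c" "c \<le> 1 / 2" using assms by (auto simp: c_def field_simps)
  have half: "u powr (- 2 / 3) \<le> 2" if "1 / 2 \<le> u" for u :: real
  proof -
    have "u powr (- 2 / 3) \<le> (1 / 2) powr (- 2 / 3)" using that by (intro powr_mono2') auto
    also have "\<dots> = 2 powr (2 / 3)" by (simp add: powr_divide powr_minus field_simps)
    also have "\<dots> \<le> 2 powr 1" by (intro powr_mono) auto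
    finally show ?thesis by simp
  qed
  have val: "6 * c powr (1 / 3) = 6 * real s powr (- 1 / 3)"
    using assms by (simp add: c_def powr_divide powr_minus field_simps)
  have "((\<lambda>t::real. t powr (- 2 / 3)) has_integral (c powr (- 2 / 3 + 1) / (- 2 / 3 + 1))) {0..c}"
    using c by (intro has_integral_powr_from_0) auto
  from has_integral_mult_right[OF this, of 2]
  have "((\<lambda>t::real. 2 * t powr (- 2 / 3)) has_integral 6 * c powr (1 / 3)) {0..c}" by simp
  moreover have "(beta_kernel has_integral beta_cell s 0) {0..c}"
    unfolding beta_cell_def c_def using assms
    by (simp, intro integrable_integral beta_kernel_integrable) auto
  moreover have "beta_kernel t \<le> 2 * t powr (- 2 / 3)" if "t \<in> {0..c}" for t
  proof -
    have "t powr (- 2 / 3) * (1 - t) powr (- 2 / 3) \<le> t powr (- 2 / 3) * 2"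
      using that c by (intro mult_left_mono half) auto
    then show ?thesis by (simp add: beta_kernel_def)
  qed
  ultimately show "beta_cell s 0 \<le> 6 * real s powr (- 1 / 3)"
    unfolding val[symmetric]
    by (intro has_integral_le[of beta_kernel "beta_cell s 0" "{0..c}" "\<lambda>t. 2 * t powr (- 2 / 3)"])
  define F where "F = (\<lambda>t::real. - 6 * (1 - t) powr (1 / 3))"
  have "((\<lambda>t::real. 2 * (1 - t) powr (- 2 / 3)) has_integral F 1 - F (1 - c)) {1 - c..1}"
  proof (rule fundamental_theorem_of_calculus_interior)
    show "continuous_on {1 - c..1} F" unfolding F_def
      by (intro continuous_intros continuous_on_powr') auto
    show "(F has_vector_derivative 2 * (1 - t) powr (- 2 / 3)) (at t)" if "t \<in> {1 - c<..<1}" for t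
      unfolding F_def has_real_derivative_iff_has_vector_derivative[symmetric]
      using that by (auto intro!: derivative_eq_intros simp: powr_diff field_simps powr_minus)
  qed (use c in auto)
  then have "((\<lambda>t::real. 2 * (1 - t) powr (- 2 / 3)) has_integral 6 * c powr (1 / 3)) {1 - c..1}"
    by (simp add: F_def)
  moreover have "(beta_kernel has_integral beta_cell s (s - 1)) {1 - c..1}"
  proof -
    have "real (s - 1) / real s = 1 - c" "real (Suc (s - 1)) / real s = 1"
      using assms by (auto simp: c_def field_simps)
    then have "beta_cell s (s - 1) = integral {1 - c..1} beta_kernel"
      unfolding beta_cell_def by (simp only:)
    then show ?thesis using c
      by (simp add: beta_kernel_integrable integrable_integral)
  qed
  moreover have "beta_kernel t \<le> 2 * (1 - t) powr (- 2 / 3)" if "t \<in> {1 - c..1}" for t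
  proof -
    have "t powr (- 2 / 3) * (1 - t) powr (- 2 / 3) \<le> 2 * (1 - t) powr (- 2 / 3)"
      using that c by (intro mult_right_mono half) auto
    then show ?thesis by (simp add: beta_kernel_def)
  qed
  ultimately show "beta_cell s (s - 1) \<le> 6 * real s powr (- 1 / 3)"
    unfolding val[symmetric]
    by (intro has_integral_le[of beta_kernel "beta_cell s (s - 1)" "{1 - c..1}" "\<lambda>t. 2 * (1 - t) powr (- 2 / 3)"])
qed

lemma sum_inj_le:
  fixes f g :: "nat \<Rightarrow> real"
  assumes "finite B" "inj_on j A" "j ` A \<subseteq> B" "\<And>i. i \<in> A \<Longrightarrow> f i \<le> g (j i)" "\<And>i. i \<in> B \<Longrightarrow> 0 \<le> g i"
  shows "sum f A \<le> sum g B"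
proof -
  have "sum f A \<le> (\<Sum>i\<in>A. g (j i))" using assms by (intro sum_mono) auto
  also have "\<dots> = sum g (j ` A)" using assms by (simp add: sum.reindex)
  also have "\<dots> \<le> sum g B" using assms by (intro sum_mono2) auto
  finally show ?thesis .
qed

text \<open>The kernel decreases on \<open>(0, 1/2]\<close> and increases on \<open>[1/2, 1)\<close>, so the sample at \<open>m/s\<close>
  is compared with the cell to its left or to its right, whichever lies on the far side of 1/2
  (for the upper bound) or on the near side (for the lower bound).\<close>

lemma beta_riemann_sum:
  assumes s: "2 \<le> s"
  shows "(\<Sum>m\<in>{1..<s}. beta_kernel (real m / real s) / real s) \<le> beta_third"
    and "beta_third - 12 * real s powr (- 1 / 3) \<le> (\<Sum>m\<in>{1..<s}. beta_kernel (real m / real s) / real s)"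
proof -
  have s0: "0 < real s" using s by simp
  let ?j = "\<lambda>m. if 2 * m \<le> s then m - 1 else m"
  have "(\<Sum>m\<in>{1..<s}. beta_kernel (real m / real s) / real s) \<le> (\<Sum>k<s. beta_cell s k)"
  proof (rule sum_inj_le[where j = ?j])
    show "inj_on ?j {1..<s}" by (rule inj_onI) (auto split: if_splits)
    show "?j ` {1..<s} \<subseteq> {..<s}" by auto
    fix m assume m: "m \<in> {1..<s}"
    show "beta_kernel (real m / real s) / real s \<le> beta_cell s (?j m)"
    proof (rule beta_cell_ge)
      fix t assume t: "real (?j m) / real s \<le> t" "t \<le> real (Suc (?j m)) / real s" "0 < t" "t < 1"
      define u where "u = real m / real s"
      \<comment> \<open>This product equals u (1 - u) - t (1 - t), the quantity that orders the
        kernel values.\<close>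
      have "0 \<le> (u - t) * (1 - t - u)"
      proof (cases "2 * m \<le> s")
        case True
        then have "2 * u \<le> 1" unfolding u_def using s0 by (simp add: field_simps)
        moreover have "t \<le> u" using t True m by (simp add: u_def del: of_nat_Suc)
        ultimately show ?thesis by (intro mult_nonneg_nonneg) auto
      next
        case False
        then have "1 \<le> 2 * u" unfolding u_def using s0 by (simp add: field_simps)
        moreover have "u \<le> t" using t False m by (simp add: u_def del: of_nat_Suc)
        ultimately show ?thesis by (intro mult_nonpos_nonpos) auto
      qed
      then show "t * (1 - t) \<le> real m / real s * (1 - real m / real s)"
        unfolding u_def[symmetric] by (simp add: algebra_simps)
    qed (use m s in auto)
  qed (auto simp: beta_cell_nonneg)
  then show "(\<Sum>m\<in>{1..<s}. beta_kernel (real m / real s) / real s) \<le> beta_third"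
    using s by (simp add: sum_beta_cell)
  \<comment> \<open>2 k + 1 <= s says that the midpoint of the cell is at most 1/2; the chosen
    endpoint is the one farther from 1/2, where the kernel is larger. The two end cells are missing,
    which costs 12 s^(-1/3).\<close>
  let ?i = "\<lambda>k. if 2 * k + 1 \<le> s then k else Suc k"
  have "(\<Sum>k\<in>{1..<s - 1}. beta_cell s k) \<le> (\<Sum>m\<in>{1..<s}. beta_kernel (real m / real s) / real s)"
  proof (rule sum_inj_le[where j = ?i])
    show "inj_on ?i {1..<s - 1}" by (rule inj_onI) (auto split: if_splits)
    show "?i ` {1..<s - 1} \<subseteq> {1..<s}" by auto
    fix k assume k: "k \<in> {1..<s - 1}"
    show "beta_cell s k \<le> beta_kernel (real (?i k) / real s) / real s"
    proof (rule beta_cell_le)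
      fix t assume t: "real k / real s \<le> t" "t \<le> real (Suc k) / real s" "0 < t" "t < 1"
      define u where "u = real (?i k) / real s"
      have "0 \<le> (t - u) * (1 - t - u)"
      proof (cases "2 * k + 1 \<le> s")
        case True
        then have "u \<le> t" using t by (simp add: u_def)
        have "real (2 * k + 1) \<le> real s" using True by (simp only: of_nat_le_iff)
        then have "u + real (Suc k) / real s \<le> 1" using True s0 by (simp add: u_def field_simps)
        then show ?thesis using \<open>u \<le> t\<close> t by (intro mult_nonneg_nonneg) auto
      next
        case False
        then have "t \<le> u" using t by (simp add: u_def)
        have "real s \<le> real (2 * k + 1)" using False by (simp only: of_nat_le_iff)
        then have "1 \<le> u + real k / real s" using False s0 by (simp add: u_def field_simps)
        then show ?thesis using \<open>t \<le> u\<close> t by (intro mult_nonpos_nonpos) auto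
      qed
      then show "real (?i k) / real s * (1 - real (?i k) / real s) \<le> t * (1 - t)"
        unfolding u_def[symmetric] by (simp add: algebra_simps)
    qed (use k s in \<open>auto split: if_splits\<close>)
  qed (auto simp: beta_kernel_nonneg)
  moreover have "(\<Sum>k<s. beta_cell s k) = beta_cell s 0 + (\<Sum>k\<in>{1..<s - 1}. beta_cell s k) + beta_cell s (s - 1)"
  proof -
    have "{..<s} = insert 0 (insert (s - 1) {1..<s - 1})" using s by auto
    then show ?thesis using s by simp
  qed
  ultimately show "beta_third - 12 * real s powr (- 1 / 3) \<le> (\<Sum>m\<in>{1..<s}. beta_kernel (real m / real s) / real s)"
    using beta_cell_end_le[OF s] sum_beta_cell[of s] s by simp
qed

section \<open>Weights summed over the antidiagonals m + l = s\<close>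

definition pair_weight :: "nat \<Rightarrow> nat \<Rightarrow> real" where
  "pair_weight m l = (real m * real l * (real m + real l)) powr (- 2 / 3)"

definition pairs_upto :: "nat \<Rightarrow> (nat \<times> nat) set" where
  "pairs_upto L = {(m, l). 0 < m \<and> 0 < l \<and> m + l \<le> L}"

definition coprime_pairs_upto :: "nat \<Rightarrow> (nat \<times> nat) set" where
  "coprime_pairs_upto L = {(m, l) \<in> pairs_upto L. coprime m l}"

abbreviation weight_sum :: "(nat \<times> nat) set \<Rightarrow> real" where
  "weight_sum A \<equiv> (\<Sum>(m, l)\<in>A. pair_weight m l)"

lemma pair_weight_nonneg: "0 \<le> pair_weight m l"
  by (simp add: pair_weight_def)

lemma finite_pairs_upto: "finite (pairs_upto L)"
  by (rule finite_subset[of _ "{..L} \<times> {..L}"]) (auto simp: pairs_upto_def)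

lemma finite_coprime_pairs_upto: "finite (coprime_pairs_upto L)"
  by (rule finite_subset[OF _ finite_pairs_upto[of L]]) (auto simp: coprime_pairs_upto_def)

lemma cube_mult_powr:
  fixes s y :: real
  assumes "0 < s"
  shows "(s ^ 3 * y) powr (- 2 / 3) = y powr (- 2 / 3) / s\<^sup>2"
proof -
  have "(s ^ 3) powr (- 2 / 3) = (s powr 3) powr (- 2 / 3)" using assms by simp
  also have "\<dots> = s powr (- 2)" by (simp only: powr_powr) simp
  also have "\<dots> = 1 / s\<^sup>2" using assms powr_minus_divide[of s 2] by simp
  finally show ?thesis unfolding powr_mult by simp
qed

text \<open>Homogeneity of degree -2: sorting pairs by their gcd g therefore produces the summable
  weights 1/g^2.\<close>

lemma pair_weight_scale:
  assumes "0 < g"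
  shows "pair_weight (g * m) (g * l) = pair_weight m l / (real g)\<^sup>2"
proof -
  have "real (g * m) * real (g * l) * (real (g * m) + real (g * l)) = real g ^ 3 * (real m * real l * (real m + real l))"
    by (simp add: algebra_simps power3_eq_cube)
  then show ?thesis using assms unfolding pair_weight_def by (simp only: cube_mult_powr of_nat_0_less_iff)
qed

text \<open>With m = u s the form m l (m + l) is s^3 u (1 - u), so the sum is 1/s times the Riemann
  sum of the kernel.\<close>

lemma antidiagonal_weight_sum:
  assumes "2 \<le> s"
  shows "\<bar>(\<Sum>m\<in>{1..<s}. pair_weight m (s - m)) - beta_third / real s\<bar> \<le> 12 * real s powr (- 4 / 3)"
proof -
  define S where "S = (\<Sum>m\<in>{1..<s}. beta_kernel (real m / real s) / real s)"
  have s: "0 < real s" using assms by simp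
  have "pair_weight m (s - m) = beta_kernel (real m / real s) / real s / real s" if m: "m \<in> {1..<s}" for m
  proof -
    define u where "u = real m / real s"
    have u: "0 < u" "u < 1" using m by (auto simp: u_def)
    have ms: "real m = u * real s" using s by (simp add: u_def)
    have sms: "real (s - m) = (1 - u) * real s"
      using m ms by (simp add: of_nat_diff left_diff_distrib)
    have "real m * real (s - m) * (real m + real (s - m)) = (u * real s) * ((1 - u) * real s) * (u * real s + (1 - u) * real s)"
      by (simp only: ms sms)
    also have "\<dots> = real s ^ 3 * (u * (1 - u))" by (simp add: algebra_simps power3_eq_cube)
    finally have "pair_weight m (s - m) = beta_kernel u / (real s)\<^sup>2"
      unfolding pair_weight_def beta_kernel_eq[OF u] using s by (simp only: cube_mult_powr)
    then show ?thesis by (simp add: u_def power2_eq_square)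
  qed
  then have "(\<Sum>m\<in>{1..<s}. pair_weight m (s - m)) = S / real s"
    unfolding S_def sum_divide_distrib by (intro sum.cong) auto
  then have "(\<Sum>m\<in>{1..<s}. pair_weight m (s - m)) - beta_third / real s = (S - beta_third) / real s"
    by (simp add: diff_divide_distrib)
  also have "\<bar>\<dots>\<bar> = \<bar>S - beta_third\<bar> / real s" using s by simp
  also have "\<dots> \<le> 12 * real s powr (- 1 / 3) / real s"
    using beta_riemann_sum[OF assms] powr_ge_zero[of "real s" "- 1 / 3"] s unfolding S_def[symmetric]
    by (intro divide_right_mono) (auto simp: abs_le_iff)
  also have "\<dots> = 12 * (real s powr (- 1 / 3) / real s)" by simp
  also have "real s powr (- 1 / 3) / real s = real s powr (- 1 / 3 - 1)"
    using s powr_diff[of "real s" "- 1 / 3" 1] by simp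
  also have "- 1 / 3 - 1 = (- 4 / 3 :: real)" by simp
  finally show ?thesis .
qed

lemma sum_powr_bounded:
  fixes e :: real
  assumes "e < -1"
  obtains K where "\<And>n. (\<Sum>k=1..n. real k powr e) \<le> K"
proof
  fix n
  show "(\<Sum>k=1..n. real k powr e) \<le> suminf (\<lambda>k. real k powr e)"
  proof (rule sum_le_suminf)
    show "summable (\<lambda>k. real k powr e)" using assms by (simp only: summable_real_powr_iff)
  qed auto
qed

lemma sum_inverse_nat_bounds:
  assumes "1 \<le> L"
  shows "\<bar>(\<Sum>s=1..L. 1 / real s) - ln (real L)\<bar> \<le> 1"
proof -
  have h: "(\<Sum>s=1..L. 1 / real s) = harm L" by (simp add: harm_def inverse_eq_divide)
  have "ln (real L) \<le> ln (real L + 1)" using assms by simp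
  also have "\<dots> \<le> harm L" by (rule ln_le_harm)
  finally have 1: "ln (real L) \<le> harm L" .
  have "harm L - ln (real L) \<le> harm 1 - ln (real 1)"
    using euler_mascheroni_sequence_decreasing[of 1 L] assms by simp
  then have "harm L - ln (real L) \<le> 1" by (simp add: harm_def)
  then show ?thesis using 1 unfolding h by linarith
qed

text \<open>Each antidiagonal contributes \<open>beta_third\<close> / s up to a summable error, and
  the harmonic sum supplies the logarithm.\<close>

lemma pairs_upto_weight_sum:
  obtains K where "0 \<le> K" "\<And>L. 1 \<le> L \<Longrightarrow> \<bar>weight_sum (pairs_upto L) - beta_third * ln (real L)\<bar> \<le> K"
proof -
  obtain C where C: "\<And>n. (\<Sum>k=1..n. real k powr (- 4 / 3)) \<le> C"
    using sum_powr_bounded[of "- 4 / 3"] by auto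
  have B: "0 \<le> beta_third" by (rule has_integral_nonneg[OF beta_kernel_has_integral]) (rule beta_kernel_nonneg)
  define f where "f = (\<lambda>s. \<Sum>m\<in>{1..<s}. pair_weight m (s - m))"
  have H: "weight_sum (pairs_upto L) = (\<Sum>s=1..L. f s)" for L
  proof -
    have "(\<Sum>s=1..L. f s) = (\<Sum>(s, m)\<in>(SIGMA s:{1..L}. {1..<s}). pair_weight m (s - m))"
      unfolding f_def by (subst sum.Sigma) auto
    also have "\<dots> = weight_sum (pairs_upto L)"
      by (rule sum.reindex_bij_witness[of _ "\<lambda>(m, l). (m + l, m)" "\<lambda>(s, m). (m, s - m)"])
        (auto simp: pairs_upto_def)
    finally show ?thesis ..
  qed
  \<comment> \<open>The antidiagonal s = 1 is empty, so its error is \<open>beta_third\<close>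
    itself; hence the enlarged constant.\<close>
  have f: "\<bar>f s - beta_third * (1 / real s)\<bar> \<le> (12 + beta_third) * real s powr (- 4 / 3)" if "1 \<le> s" for s
  proof (cases "s = 1")
    case True
    then show ?thesis using B by (simp add: f_def)
  next
    case False
    then have "\<bar>f s - beta_third * (1 / real s)\<bar> \<le> 12 * real s powr (- 4 / 3)"
      using antidiagonal_weight_sum[of s] that by (simp add: f_def)
    also have "\<dots> \<le> (12 + beta_third) * real s powr (- 4 / 3)" using B by (intro mult_right_mono) auto
    finally show ?thesis .
  qed
  have main: "\<bar>weight_sum (pairs_upto L) - beta_third * ln (real L)\<bar> \<le> (12 + beta_third) * C + beta_third" if "1 \<le> L" for L
  proof -
    define h where "h = (\<Sum>s=1..L. 1 / real s)"
    have "weight_sum (pairs_upto L) - beta_third * h = (\<Sum>s=1..L. f s - beta_third * (1 / real s))"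
      unfolding H h_def sum_subtractf sum_distrib_left ..
    also have "\<bar>\<dots>\<bar> \<le> (\<Sum>s=1..L. \<bar>f s - beta_third * (1 / real s)\<bar>)" by (rule sum_abs)
    also have "\<dots> \<le> (\<Sum>s=1..L. (12 + beta_third) * real s powr (- 4 / 3))" using f by (intro sum_mono) auto
    also have "\<dots> = (12 + beta_third) * (\<Sum>s=1..L. real s powr (- 4 / 3))" by (simp only: sum_distrib_left)
    also have "\<dots> \<le> (12 + beta_third) * C" using B C by (intro mult_left_mono) auto
    finally have 1: "\<bar>weight_sum (pairs_upto L) - beta_third * h\<bar> \<le> (12 + beta_third) * C" .
    have "\<bar>beta_third * h - beta_third * ln (real L)\<bar> = beta_third * \<bar>h - ln (real L)\<bar>"
      using B by (simp add: abs_mult flip: right_diff_distrib)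
    also have "\<dots> \<le> beta_third * 1" using B sum_inverse_nat_bounds[OF that] unfolding h_def by (intro mult_left_mono) auto
    finally show ?thesis using 1 by linarith
  qed
  have "0 \<le> C" using C[of 0] by simp
  then show thesis using main B by (intro that[of "(12 + beta_third) * C + beta_third"]) auto
qed

section \<open>From all pairs to coprime pairs\<close>

lemma pairs_upto_weight_sum_gcd:
  "weight_sum (pairs_upto L) = (\<Sum>g=1..L. weight_sum (coprime_pairs_upto (L div g)) / (real g)\<^sup>2)"
proof -
  have "(\<Sum>g=1..L. weight_sum (coprime_pairs_upto (L div g)) / (real g)\<^sup>2)
      = (\<Sum>g=1..L. \<Sum>z\<in>coprime_pairs_upto (L div g). case z of (m, l) \<Rightarrow> pair_weight (g * m) (g * l))"
    by (intro sum.cong) (auto simp: sum_divide_distrib pair_weight_scale intro!: sum.cong)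
  also have "\<dots> = (\<Sum>(g, m, l)\<in>(SIGMA g:{1..L}. coprime_pairs_upto (L div g)). pair_weight (g * m) (g * l))"
    by (subst sum.Sigma) (auto simp: finite_coprime_pairs_upto)
  also have "\<dots> = weight_sum (pairs_upto L)"
  proof (rule sum.reindex_bij_witness[of _ "\<lambda>(m, l). (gcd m l, m div gcd m l, l div gcd m l)" "\<lambda>(g, m, l). (g * m, g * l)"])
    fix z assume z: "z \<in> (SIGMA g:{1..L}. coprime_pairs_upto (L div g))"
    obtain g m l where gml: "z = (g, m, l)" by (cases z)
    have h: "1 \<le> g" "0 < m" "0 < l" "m + l \<le> L div g" "coprime m l"
      using z by (auto simp: gml coprime_pairs_upto_def pairs_upto_def)
    have "gcd (g * m) (g * l) = g * gcd m l" by (rule gcd_mult_distrib_nat[symmetric])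
    then have "gcd (g * m) (g * l) = g" using h by (simp only: coprime_iff_gcd_eq_1 mult_1_right)
    then show "(case case z of (g, m, l) \<Rightarrow> (g * m, g * l) of (m, l) \<Rightarrow> (gcd m l, m div gcd m l, l div gcd m l)) = z"
      using h by (simp add: gml)
    have "g * (m + l) \<le> g * (L div g)" using h by (intro mult_le_mono2)
    also have "\<dots> \<le> L" by simp
    finally have "g * (m + l) \<le> L" .
    then show "(case z of (g, m, l) \<Rightarrow> (g * m, g * l)) \<in> pairs_upto L"
      using h by (simp add: gml pairs_upto_def algebra_simps)
    show "(case case z of (g, m, l) \<Rightarrow> (g * m, g * l) of (m, l) \<Rightarrow> pair_weight m l) = (case z of (g, m, l) \<Rightarrow> pair_weight (g * m) (g * l))"
      by (simp add: gml)
  next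
    fix z assume z: "z \<in> pairs_upto L"
    obtain m l where ml: "z = (m, l)" by (cases z)
    have h: "0 < m" "0 < l" "m + l \<le> L" using z by (auto simp: ml pairs_upto_def)
    define g where "g = gcd m l"
    have "g \<le> m" unfolding g_def using h by (intro gcd_le1_nat) auto
    then have "g \<le> L" using h by linarith
    then have g: "0 < g" "g \<le> L" using h by (simp_all add: g_def)
    obtain m' l' where m': "m = g * m'" "l = g * l'" unfolding g_def by (meson dvdE gcd_dvd1 gcd_dvd2)
    have cop: "coprime m' l'" 
    proof -
      have "coprime (m div g) (l div g)" unfolding g_def using h by (intro div_gcd_coprime) auto
      then show ?thesis using g by (simp add: m')
    qed
    show "(case case z of (m, l) \<Rightarrow> (gcd m l, m div gcd m l, l div gcd m l) of (g, m, l) \<Rightarrow> (g * m, g * l)) = z"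
      by (simp add: ml)
    have mg: "m div g = m'" "l div g = l'" using g by (simp_all add: m')
    have m'l': "0 < m'" "0 < l'" using h by (auto simp: m')
    have "m' + l' \<le> L div g"
      using h g by (simp add: m' less_eq_div_iff_mult_less_eq algebra_simps)
    then show "(case z of (m, l) \<Rightarrow> (gcd m l, m div gcd m l, l div gcd m l)) \<in> (SIGMA g:{1..L}. coprime_pairs_upto (L div g))"
      using g cop m'l' by (simp add: ml g_def[symmetric] mg coprime_pairs_upto_def pairs_upto_def)
  qed
  finally show ?thesis ..
qed

text \<open>The lower bound holds because the partial sums plus 1/n decrease to pi^2 / 6, by
  comparison with 1/n - 1/(n + 1).\<close>

lemma sum_inverse_squares_tail:
  assumes "1 \<le> L"
  shows "(\<Sum>g=1..L. 1 / (real g)\<^sup>2) \<le> pi\<^sup>2 / 6" "pi\<^sup>2 / 6 - 1 / real L \<le> (\<Sum>g=1..L. 1 / (real g)\<^sup>2)"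
proof -
  define S where "S = (\<lambda>n. \<Sum>g=1..n. 1 / (real g)\<^sup>2)"
  have lim: "S \<longlonglongrightarrow> pi\<^sup>2 / 6"
  proof -
    have "S = (\<lambda>n. \<Sum>k<n. 1 / (real k + 1)\<^sup>2)"
      unfolding S_def by (rule ext, rule sum.reindex_bij_witness[of _ Suc "\<lambda>k. k - 1"]) (auto simp: of_nat_diff)
    then show ?thesis using inverse_squares_sums by (simp add: sums_def add.commute)
  qed
  have "incseq S" by (rule incseq_SucI) (simp add: S_def)
  then show "S L \<le> pi\<^sup>2 / 6" using lim by (rule incseq_le)
  have step: "1 / (real (Suc n))\<^sup>2 \<le> 1 / real n - 1 / real (Suc n)" if "1 \<le> n" for n
  proof -
    have "1 / (real (Suc n))\<^sup>2 \<le> 1 / (real n * real (Suc n))"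
      using that by (intro divide_left_mono) (auto simp: power2_eq_square)
    also have "\<dots> = 1 / real n - 1 / real (Suc n)" using that by (simp add: field_simps)
    finally show ?thesis .
  qed
  have "decseq (\<lambda>n. S (n + L) + 1 / real (n + L))"
  proof (rule decseq_SucI)
    fix n
    show "S (Suc n + L) + 1 / real (Suc n + L) \<le> S (n + L) + 1 / real (n + L)"
      using step[of "n + L"] assms by (simp add: S_def)
  qed
  moreover have "(\<lambda>n. S (n + L) + 1 / real (n + L)) \<longlonglongrightarrow> pi\<^sup>2 / 6 + 0"
    by (intro tendsto_add LIMSEQ_ignore_initial_segment[OF lim] LIMSEQ_ignore_initial_segment[of "\<lambda>n. 1 / real n"] lim_1_over_n)
  ultimately have "pi\<^sup>2 / 6 + 0 \<le> S (0 + L) + 1 / real (0 + L)" by (rule decseq_ge)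
  then show "pi\<^sup>2 / 6 - 1 / real L \<le> S L" by simp
qed

text \<open>Since L div g is within a factor 2 of L / g, its logarithm is ln L - ln g + O(1), and (1
  + ln g) / g^2 is summable. Cutting the sum of 1/g^2 at L costs ln L times 1/L.\<close>

lemma sum_log_quotients:
  obtains K where "0 \<le> K" "\<And>L. 1 \<le> L \<Longrightarrow>
    \<bar>(\<Sum>g=1..L. ln (real (L div g)) / (real g)\<^sup>2) - pi\<^sup>2 / 6 * ln (real L)\<bar> \<le> K"
proof -
  obtain C where C: "\<And>n. (\<Sum>k=1..n. real k powr (- 3 / 2)) \<le> C"
    using sum_powr_bounded[of "- 3 / 2"] by auto
  have "0 \<le> C" using C[of 0] by simp
  have main: "\<bar>(\<Sum>g=1..L. ln (real (L div g)) / (real g)\<^sup>2) - pi\<^sup>2 / 6 * ln (real L)\<bar> \<le> 3 * C + 1" if L: "1 \<le> L" for L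
  proof -
    define Z where "Z = (\<Sum>g=1..L. 1 / (real g)\<^sup>2)"
    have summand: "\<bar>ln (real (L div g)) / (real g)\<^sup>2 - ln (real L) * (1 / (real g)\<^sup>2)\<bar> \<le> 3 * real g powr (- 3 / 2)"
      if g: "g \<in> {1..L}" for g
    proof -
      have g0: "0 < real g" using g by simp
      define q where "q = L div g"
      have q1: "1 \<le> q" using g by (simp add: q_def Suc_le_eq div_greater_zero_iff)
      have "g * q \<le> L" by (simp add: q_def)
      then have "real g * real q \<le> real L" by (simp flip: of_nat_mult)
      moreover have "L \<le> 2 * (g * q)"
      proof -
        have "L < g + g * q" unfolding q_def by (rule dividend_less_times_div) (use g in simp)
        moreover have "g * 1 \<le> g * q" using q1 by (intro mult_le_mono2)
        ultimately show ?thesis by linarith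
      qed
      then have "real L \<le> real (2 * (g * q))" by (simp only: of_nat_le_iff)
      then have "real L \<le> 2 * (real g * real q)" by simp
      ultimately have lq: "ln (real g * real q) \<le> ln (real L)" "ln (real L) \<le> ln (2 * (real g * real q))"
        using g0 q1 L by (auto intro!: ln_mono)
      have "ln (real g * real q) = ln (real g) + ln (real q)"
        "ln (2 * (real g * real q)) = ln 2 + (ln (real g) + ln (real q))"
        using g0 q1 by (auto simp: ln_mult)
      moreover have "0 \<le> ln (real g)" using g by simp
      moreover have "0 \<le> ln (2::real)" by simp
      ultimately have "\<bar>ln (real q) - ln (real L)\<bar> \<le> ln 2 + ln (real g)"
        using lq by linarith
      also have "ln 2 \<le> (1::real)" using ln_2_less_1 by simp
      also have "1 \<le> real g powr (1 / 2)" using g by (intro ge_one_powr_ge_zero) auto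
      also have "ln (real g) \<le> real g powr (1 / 2) / (1 / 2)" using g by (intro ln_powr_bound) auto
      finally have "\<bar>ln (real q) - ln (real L)\<bar> \<le> 3 * real g powr (1 / 2)" by simp
      then have "\<bar>ln (real q) - ln (real L)\<bar> / (real g)\<^sup>2 \<le> 3 * real g powr (1 / 2) / (real g)\<^sup>2"
        by (intro divide_right_mono) auto
      also have "\<dots> = 3 * (real g powr (1 / 2) * real g powr (- 2))"
        using g0 by (simp add: powr_minus field_simps)
      also have "\<dots> = 3 * real g powr (- 3 / 2)" by (simp flip: powr_add)
      finally have "\<bar>(ln (real q) - ln (real L)) / (real g)\<^sup>2\<bar> \<le> 3 * real g powr (- 3 / 2)" by simp
      then show ?thesis by (simp add: q_def diff_divide_distrib)
    qed
    have "(\<Sum>g=1..L. ln (real (L div g)) / (real g)\<^sup>2) - ln (real L) * Z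
        = (\<Sum>g=1..L. ln (real (L div g)) / (real g)\<^sup>2 - ln (real L) * (1 / (real g)\<^sup>2))"
      unfolding Z_def sum_subtractf sum_distrib_left ..
    also have "\<bar>\<dots>\<bar> \<le> (\<Sum>g=1..L. \<bar>ln (real (L div g)) / (real g)\<^sup>2 - ln (real L) * (1 / (real g)\<^sup>2)\<bar>)" by (rule sum_abs)
    also have "\<dots> \<le> (\<Sum>g=1..L. 3 * real g powr (- 3 / 2))" using summand by (intro sum_mono)
    also have "\<dots> \<le> 3 * C" using C[of L] by (simp flip: sum_distrib_left)
    finally have 1: "\<bar>(\<Sum>g=1..L. ln (real (L div g)) / (real g)\<^sup>2) - ln (real L) * Z\<bar> \<le> 3 * C" .
    have lnL: "0 \<le> ln (real L)" "ln (real L) \<le> real L" using L ln_le_minus_one[of "real L"] by auto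
    have "\<bar>Z - pi\<^sup>2 / 6\<bar> \<le> 1 / real L" using sum_inverse_squares_tail[OF L] unfolding Z_def by linarith
    then have "ln (real L) * \<bar>Z - pi\<^sup>2 / 6\<bar> \<le> real L * (1 / real L)" using lnL by (intro mult_mono) auto
    also have "\<dots> = 1" using L by simp
    also have "ln (real L) * \<bar>Z - pi\<^sup>2 / 6\<bar> = \<bar>ln (real L) * Z - pi\<^sup>2 / 6 * ln (real L)\<bar>"
      using lnL(1) by (simp add: abs_mult_pos' right_diff_distrib mult.commute)
    finally show ?thesis using 1 by linarith
  qed
  show thesis using main \<open>0 \<le> C\<close> by (intro that[of "3 * C + 1"]) auto
qed

text \<open>The term 1/4 plus a telescoping tail of 1/2. A bound below 1 is what the inversion below
  needs as contraction factor.\<close>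

lemma sum_inverse_squares_from_2: "2 \<le> L \<Longrightarrow> (\<Sum>g=2..L. 1 / (real g)\<^sup>2) \<le> 3 / 4 - 1 / real L"
proof (induction L rule: dec_induct)
  case base
  then show ?case by (simp add: numeral_2_eq_2)
next
  case (step n)
  have "1 / (real (Suc n))\<^sup>2 \<le> 1 / (real n * real (Suc n))"
    using step by (intro divide_left_mono) (auto simp: power2_eq_square)
  also have "\<dots> = 1 / real n - 1 / real (Suc n)" using step by (simp add: field_simps)
  finally show ?case using step by simp
qed

text \<open>The relation \<open>H(L) = \<Sum>\<^sub>g S(L/g)/g\<^sup>2\<close> between the sum over all pairs and the sum over coprime
  pairs is inverted without the Moebius function: the error \<open>E(L)\<close> in the asymptotics of \<open>S\<close>
  satisfies \<open>E(L) = O(1) - \<Sum>\<^sub>g\<^sub>\<ge>\<^sub>2 E(L/g)/g\<^sup>2\<close>, where the weights \<open>1/g\<^sup>2\<close> sum to less than 1.\<close>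

lemma coprime_pairs_upto_weight_sum:
  obtains K where "0 \<le> K" "\<And>L. 1 \<le> L \<Longrightarrow>
    \<bar>weight_sum (coprime_pairs_upto L) - 6 / pi\<^sup>2 * beta_third * ln (real L)\<bar> \<le> K"
proof -
  obtain A where A: "0 \<le> A" "\<And>L. 1 \<le> L \<Longrightarrow> \<bar>weight_sum (pairs_upto L) - beta_third * ln (real L)\<bar> \<le> A"
    using pairs_upto_weight_sum by blast
  obtain Q where Q: "0 \<le> Q" "\<And>L. 1 \<le> L \<Longrightarrow>
      \<bar>(\<Sum>g=1..L. ln (real (L div g)) / (real g)\<^sup>2) - pi\<^sup>2 / 6 * ln (real L)\<bar> \<le> Q"
    using sum_log_quotients by blast
  define \<kappa> where "\<kappa> = 6 / pi\<^sup>2 * beta_third"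
  define E where "E = (\<lambda>L. weight_sum (coprime_pairs_upto L) - \<kappa> * ln (real L))"
  define M where "M = A + \<bar>\<kappa>\<bar> * Q"
  have M: "0 \<le> M" using A Q by (simp add: M_def)
  \<comment> \<open>\<open>\<kappa>\<close> is chosen so that the main terms cancel:
    \<open>\<kappa>\<close> pi^2 / 6 = \<open>beta_third\<close>.\<close>
  have conv: "\<bar>\<Sum>g=1..L. E (L div g) / (real g)\<^sup>2\<bar> \<le> M" if L: "1 \<le> L" for L
  proof -
    define T where "T = (\<Sum>g=1..L. ln (real (L div g)) / (real g)\<^sup>2)"
    have "(\<Sum>g=1..L. E (L div g) / (real g)\<^sup>2) = weight_sum (pairs_upto L) - \<kappa> * T"
      unfolding E_def T_def pairs_upto_weight_sum_gcd diff_divide_distrib sum_subtractf sum_distrib_left by simp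
    moreover have "\<kappa> * (pi\<^sup>2 / 6 * ln (real L)) = beta_third * ln (real L)" by (simp add: \<kappa>_def)
    moreover have "\<bar>\<kappa> * T - \<kappa> * (pi\<^sup>2 / 6 * ln (real L))\<bar> \<le> \<bar>\<kappa>\<bar> * Q"
      using Q(2)[OF L] unfolding T_def right_diff_distrib[symmetric] abs_mult by (intro mult_left_mono) auto
    ultimately show ?thesis using A(2)[OF L] unfolding M_def by linarith
  qed
  \<comment> \<open>4 M is the fixed point of B = M + 3/4 B, so the bound reproduces itself in the
    induction.\<close>
  have main: "\<bar>E L\<bar> \<le> 4 * M" if "1 \<le> L" for L
    using that
  proof (induction L rule: less_induct)
    case (less L)
    have "(\<Sum>g=1..L. E (L div g) / (real g)\<^sup>2) = E L + (\<Sum>g=2..L. E (L div g) / (real g)\<^sup>2)"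
      using less.prems by (subst sum.atLeast_Suc_atMost) (auto simp: numeral_2_eq_2)
    then have "\<bar>E L\<bar> \<le> M + \<bar>\<Sum>g=2..L. E (L div g) / (real g)\<^sup>2\<bar>" using conv[OF less.prems] by linarith
    also have "\<bar>\<Sum>g=2..L. E (L div g) / (real g)\<^sup>2\<bar> \<le> (\<Sum>g=2..L. \<bar>E (L div g) / (real g)\<^sup>2\<bar>)" by (rule sum_abs)
    also have "\<dots> \<le> (\<Sum>g=2..L. 4 * M * (1 / (real g)\<^sup>2))"
    proof (rule sum_mono)
      fix g assume g: "g \<in> {2..L}"
      have "L div g < L" using g by (intro div_less_dividend) auto
      moreover have "1 \<le> L div g" using g by (simp add: Suc_le_eq div_greater_zero_iff)
      ultimately have "\<bar>E (L div g)\<bar> \<le> 4 * M" using less.IH by blast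
      then have "\<bar>E (L div g)\<bar> / (real g)\<^sup>2 \<le> 4 * M / (real g)\<^sup>2" by (intro divide_right_mono) auto
      then show "\<bar>E (L div g) / (real g)\<^sup>2\<bar> \<le> 4 * M * (1 / (real g)\<^sup>2)" by simp
    qed
    also have "\<dots> = 4 * M * (\<Sum>g=2..L. 1 / (real g)\<^sup>2)" by (simp only: sum_distrib_left)
    also have "\<dots> \<le> 4 * M * (3 / 4)"
    proof (intro mult_left_mono)
      show "(\<Sum>g=2..L. 1 / (real g)\<^sup>2) \<le> 3 / 4"
      proof (cases "2 \<le> L")
        case True
        have "0 \<le> 1 / real L" by simp
        then show ?thesis using sum_inverse_squares_from_2[OF True] by linarith
      qed auto
    qed (use M in auto)
    finally show ?case by simp
  qed
  show thesis using main M by (intro that[of "4 * M"]) (auto simp: E_def \<kappa>_def)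
qed

section \<open>Regions bounded by the cubic form m l (m + l)\<close>

definition pair_form :: "nat \<Rightarrow> nat \<Rightarrow> real" where
  "pair_form m l = real m * real l * (real m + real l)"

definition region :: "real \<Rightarrow> (nat \<times> nat) set" where
  "region Y = {(m, l). 0 < m \<and> 0 < l \<and> pair_form m l \<le> Y}"

definition coprime_region :: "real \<Rightarrow> (nat \<times> nat) set" where
  "coprime_region Y = {(m, l) \<in> region Y. coprime m l}"

lemma pair_weight_form: "pair_weight m l = pair_form m l powr (- 2 / 3)"
  by (simp add: pair_weight_def pair_form_def)

lemma pair_form_commute: "pair_form m l = pair_form l m"
  by (simp add: pair_form_def mult.commute add.commute)

lemma pair_form_ge:
  assumes "0 < m" "0 < l"
  shows "real m * (real l)\<^sup>2 \<le> pair_form m l" "real m \<le> pair_form m l" "real l \<le> pair_form m l"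
proof -
  have 1: "1 \<le> real m" "1 \<le> real l" using assms by auto
  have "pair_form m l = real m * (real l)\<^sup>2 + real l * (real m)\<^sup>2"
    by (simp add: pair_form_def power2_eq_square algebra_simps)
  moreover have "real m * 1 \<le> real m * (real l)\<^sup>2" "real l * 1 \<le> real l * (real m)\<^sup>2"
    using 1 by (intro mult_left_mono one_le_power; simp)+
  moreover have "0 \<le> real m" "0 \<le> real l" by auto
  ultimately show "real m * (real l)\<^sup>2 \<le> pair_form m l" "real m \<le> pair_form m l" "real l \<le> pair_form m l"
    by linarith+
qed

lemma finite_region: "finite (region Y)"
proof (rule finite_subset)
  show "region Y \<subseteq> {..nat \<lfloor>Y\<rfloor>} \<times> {..nat \<lfloor>Y\<rfloor>}"
  proof
    fix z assume "z \<in> region Y"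
    then obtain m l where z: "z = (m, l)" "0 < m" "0 < l" "pair_form m l \<le> Y" by (auto simp: region_def)
    then have "real m \<le> Y" "real l \<le> Y" using pair_form_ge[of m l] by linarith+
    then show "z \<in> {..nat \<lfloor>Y\<rfloor>} \<times> {..nat \<lfloor>Y\<rfloor>}" by (simp add: z le_nat_floor)
  qed
qed simp

lemma finite_coprime_region: "finite (coprime_region Y)"
  by (rule finite_subset[OF _ finite_region[of Y]]) (auto simp: coprime_region_def)

text \<open>With a and b the cube roots of n + 1 and n, 1 = a^3 - b^3 <= 3 (a - b) a^2, so the terms
  telescope.\<close>

lemma sum_powr_minus_two_thirds: "(\<Sum>m=1..n. real m powr (- 2 / 3)) \<le> 3 * real n powr (1 / 3)"
proof (induction n)
  case (Suc n)
  define a where "a = real (Suc n) powr (1 / 3)"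
  define b where "b = real n powr (1 / 3)"
  have a: "0 < a" by (simp add: a_def)
  have b: "0 \<le> b" "b \<le> a" by (auto simp: a_def b_def intro!: powr_mono2)
  have "a ^ 3 = real (Suc n)" unfolding a_def by (simp add: powr_power)
  moreover have "b ^ 3 = real n" unfolding b_def by (cases "n = 0") (simp_all add: powr_power)
  ultimately have "1 = (a - b) * (a\<^sup>2 + a * b + b\<^sup>2)"
    by (simp add: algebra_simps power2_eq_square power3_eq_cube)
  also have "\<dots> \<le> (a - b) * (a\<^sup>2 + a * a + a\<^sup>2)"
    using a b by (intro mult_left_mono add_mono mult_mono power_mono) auto
  also have "\<dots> = 3 * (a - b) * a\<^sup>2" by (simp add: power2_eq_square)
  finally have "1 / a\<^sup>2 \<le> 3 * (a - b)" using a by (simp add: divide_le_eq)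
  moreover have "1 / a\<^sup>2 = real (Suc n) powr (- 2 / 3)"
  proof -
    have "a\<^sup>2 = real (Suc n) powr (2 / 3)" unfolding a_def by (simp add: powr_power)
    then show ?thesis using powr_minus_divide[of "real (Suc n)" "2 / 3"] by simp
  qed
  ultimately show ?case using Suc.IH unfolding a_def b_def by simp
qed simp

lemma sum_inverse_squares_from:
  assumes "1 \<le> M"
  shows "(\<Sum>l=M..N. 1 / (real l)\<^sup>2) \<le> 2 / real M"
proof (cases "M \<le> N")
  case True
  have term_le: "1 / (real n)\<^sup>2 \<le> 2 / real n - 2 / real (Suc n)" if "1 \<le> n" for n
  proof -
    have "1 / (real n)\<^sup>2 = 2 / (real n * (2 * real n))" by (simp add: power2_eq_square)
    also have "\<dots> \<le> 2 / (real n * real (Suc n))"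
      using that by (intro divide_left_mono mult_left_mono mult_pos_pos) auto
    also have "\<dots> = 2 / real n - 2 / real (Suc n)" using that by (simp add: field_simps)
    finally show ?thesis .
  qed
  have "(\<Sum>l=M..N. 1 / (real l)\<^sup>2) \<le> 2 / real M - 2 / real (Suc N)"
    using True
  proof (induction N rule: dec_induct)
    case base
    show ?case using term_le[OF assms] by simp
  next
    case (step N)
    then show ?case using term_le[of "Suc N"] by simp
  qed
  moreover have "0 \<le> 2 / real (Suc N)" by simp
  ultimately show ?thesis by linarith
qed (use assms in simp)

text \<open>Here m l^2 <= Y and the weight is at most m^(-2/3) l^(-4/3). Summing over m <= Y / l^2
  leaves 3 Y^(1/3) / l^2, and l exceeds L / 2, which is of order Y^(1/3).\<close>

lemma half_region_weight:
  assumes Y: "0 < Y" and L: "Y powr (1 / 3) \<le> real L + 1"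
  shows "(\<Sum>(m, l)\<in>{(m, l) \<in> region Y. m \<le> l \<and> L < m + l}. pair_weight m l) \<le> 12"
proof -
  define T where "T = {(m, l) \<in> region Y. m \<le> l \<and> L < m + l}"
  define M where "M = Suc (L div 2)"
  define N where "N = nat \<lfloor>Y\<rfloor>"
  define y where "y = (\<lambda>l::nat. nat \<lfloor>Y / (real l)\<^sup>2\<rfloor>)"
  define f where "f = (\<lambda>m l. real m powr (- 2 / 3) * real l powr (- 4 / 3))"
  define U where "U = (SIGMA l:{M..N}. {1..y l})"
  have sub: "(\<lambda>(m, l). (l, m)) ` T \<subseteq> U"
  proof
    fix z assume "z \<in> (\<lambda>(m, l). (l, m)) ` T"
    then obtain m l where z: "z = (l, m)" "0 < m" "0 < l" "pair_form m l \<le> Y" "m \<le> l" "L < m + l"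
      by (auto simp: T_def region_def)
    have "real m * (real l)\<^sup>2 \<le> Y" "real l \<le> Y" using pair_form_ge[OF z(2,3)] z(4) by linarith+
    then have "real m \<le> Y / (real l)\<^sup>2" "l \<le> N" using z by (auto simp: field_simps N_def le_nat_floor)
    then have "m \<le> y l" "l \<le> N" by (auto simp: y_def le_nat_floor)
    then show "z \<in> U" using z by (auto simp: U_def M_def)
  qed
  have fin: "finite U" by (simp add: U_def)
  have inj: "inj_on (\<lambda>(m, l). (l, m)) T" by (auto simp: inj_on_def)
  have le: "pair_weight m l \<le> f m l" if "(m, l) \<in> T" for m l
  proof -
    have ml: "0 < m" "0 < l" using that by (auto simp: T_def region_def)
    have "pair_weight m l \<le> (real m * (real l)\<^sup>2) powr (- 2 / 3)"
      unfolding pair_weight_form using pair_form_ge[OF ml] ml by (intro powr_mono2') auto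
    also have "\<dots> = real m powr (- 2 / 3) * (real l)\<^sup>2 powr (- 2 / 3)" by (rule powr_mult)
    also have "(real l)\<^sup>2 powr (- 2 / 3) = (real l powr 2) powr (- 2 / 3)" using ml by simp
    also have "\<dots> = real l powr (- 4 / 3)" by (simp only: powr_powr) simp
    finally show ?thesis by (simp add: f_def)
  qed
  have "(\<Sum>(m, l)\<in>T. pair_weight m l) \<le> (\<Sum>(m, l)\<in>T. f m l)"
    using le by (intro sum_mono) auto
  also have "\<dots> = (\<Sum>(l, m)\<in>(\<lambda>(m, l). (l, m)) ` T. f m l)"
    using inj by (subst sum.reindex) (auto intro!: sum.cong)
  also have "\<dots> \<le> (\<Sum>(l, m)\<in>U. f m l)"
    using fin sub by (intro sum_mono2) (auto simp: f_def)
  also have "\<dots> = (\<Sum>l=M..N. \<Sum>m=1..y l. f m l)"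
    unfolding U_def by (subst sum.Sigma) auto
  also have "\<dots> \<le> (\<Sum>l=M..N. 3 * Y powr (1 / 3) * (1 / (real l)\<^sup>2))"
  proof (rule sum_mono)
    fix l assume "l \<in> {M..N}"
    then have l: "0 < real l" by (auto simp: M_def)
    have "(\<Sum>m=1..y l. f m l) = (\<Sum>m=1..y l. real m powr (- 2 / 3)) * real l powr (- 4 / 3)"
      by (simp add: f_def sum_distrib_right)
    also have "\<dots> \<le> (3 * real (y l) powr (1 / 3)) * real l powr (- 4 / 3)"
      using sum_powr_minus_two_thirds by (intro mult_right_mono) auto
    also have "\<dots> \<le> (3 * (Y powr (1 / 3) / real l powr (2 / 3))) * real l powr (- 4 / 3)"
    proof -
      have "real (y l) powr (1 / 3) \<le> (Y / (real l)\<^sup>2) powr (1 / 3)"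
      proof (rule powr_mono2)
        show "real (y l) \<le> Y / (real l)\<^sup>2" unfolding y_def using Y by (intro of_nat_floor) auto
      qed auto
      also have "(Y / (real l)\<^sup>2) powr (1 / 3) = Y powr (1 / 3) / (real l powr 2) powr (1 / 3)"
      proof -
        have "(real l)\<^sup>2 = real l powr 2" using l by simp
        then show ?thesis by (simp only: powr_divide)
      qed
      also have "\<dots> = Y powr (1 / 3) / real l powr (2 / 3)" by (simp only: powr_powr) simp
      finally show ?thesis by (intro mult_right_mono mult_left_mono) auto
    qed
    also have "\<dots> = 3 * Y powr (1 / 3) * (real l powr (- 4 / 3) / real l powr (2 / 3))" by simp
    also have "real l powr (- 4 / 3) / real l powr (2 / 3) = real l powr (- 2)"
      using powr_diff[of "real l" "- 4 / 3" "2 / 3"] by simp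
    also have "\<dots> = 1 / (real l)\<^sup>2" using l powr_minus_divide[of "real l" 2] by simp
    finally show "(\<Sum>m=1..y l. f m l) \<le> 3 * Y powr (1 / 3) * (1 / (real l)\<^sup>2)"
      by simp
  qed
  also have "\<dots> = 3 * Y powr (1 / 3) * (\<Sum>l=M..N. 1 / (real l)\<^sup>2)" by (simp only: sum_distrib_left)
  also have "\<dots> \<le> 3 * Y powr (1 / 3) * (2 / real M)"
    by (intro mult_left_mono sum_inverse_squares_from) (auto simp: M_def)
  also have "\<dots> \<le> 3 * (2 * real M) * (2 / real M)"
  proof -
    have "L + 1 \<le> 2 * M" unfolding M_def by presburger
    then have "real (L + 1) \<le> real (2 * M)" by (simp only: of_nat_le_iff)
    then have "Y powr (1 / 3) \<le> 2 * real M" using L by simp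
    then show ?thesis by (intro mult_right_mono mult_left_mono) auto
  qed
  also have "\<dots> = 12"
  proof -
    have "0 < real M" by (simp add: M_def)
    then show ?thesis by simp
  qed
  finally show ?thesis by (simp add: T_def)
qed

text \<open>The cusps of the region along both axes carry bounded weight, so the region may be
  replaced by a triangle.\<close>

lemma region_weight_outside:
  assumes Y: "0 < Y" and L: "Y powr (1 / 3) \<le> real L + 1"
  shows "weight_sum (region Y - pairs_upto L) \<le> 24"
proof -
  define T where "T = {(m, l) \<in> region Y. m \<le> l \<and> L < m + l}"
  define T' where "T' = {(m, l) \<in> region Y. l \<le> m \<and> L < m + l}"
  have fin: "finite T" "finite T'"
    by (rule finite_subset[OF _ finite_region[of Y]]; auto simp: T_def T'_def)+
  have "weight_sum T' = weight_sum T"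
    by (rule sum.reindex_bij_witness[of _ "\<lambda>(m, l). (l, m)" "\<lambda>(m, l). (l, m)"])
      (auto simp: T_def T'_def region_def pair_form_commute add.commute pair_weight_form)
  have "weight_sum (region Y - pairs_upto L) \<le> weight_sum (T \<union> T')"
    using fin by (intro sum_mono2) (auto simp: T_def T'_def region_def pairs_upto_def pair_weight_nonneg)
  also have "\<dots> \<le> weight_sum T + weight_sum T'"
    using fin by (simp add: sum_Un sum_nonneg pair_weight_nonneg split: prod.split)
  also have "\<dots> \<le> 24"
    using half_region_weight[OF assms] \<open>weight_sum T' = weight_sum T\<close> by (simp add: T_def)
  finally show ?thesis .
qed

lemma pairs_upto_subset_region:
  assumes "real L \<le> Y powr (1 / 3)" "0 < Y"
  shows "pairs_upto L \<subseteq> region Y"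
proof
  fix z assume "z \<in> pairs_upto L"
  then obtain m l where z: "z = (m, l)" "0 < m" "0 < l" "m + l \<le> L" by (auto simp: pairs_upto_def)
  have "real (m + l) \<le> real L" using z by (simp only: of_nat_le_iff)
  then have "pair_form m l \<le> real L * real L * real L"
    unfolding pair_form_def by (intro mult_mono) auto
  also have "\<dots> = real L ^ 3" by (simp add: power3_eq_cube)
  also have "\<dots> \<le> (Y powr (1 / 3)) ^ 3" using assms by (intro power_mono) auto
  also have "\<dots> = Y" using assms by (simp add: powr_power)
  finally show "z \<in> region Y" using z by (simp add: region_def)
qed

text \<open>In the region every weight is at least Y^(-2/3), so bounded weight outside the triangle
  means O(Y^(2/3)) points there.\<close>

lemma card_region_le:
  assumes Y: "1 \<le> Y"
  shows "real (card (region Y)) \<le> 25 * Y powr (2 / 3)"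
proof -
  define L where "L = nat \<lfloor>Y powr (1 / 3)\<rfloor>"
  have L: "real L \<le> Y powr (1 / 3)" "Y powr (1 / 3) \<le> real L + 1"
    unfolding L_def by (auto intro: of_nat_floor)
  have "card (region Y) \<le> card (pairs_upto L \<union> (region Y - pairs_upto L))"
    by (intro card_mono) (auto simp: finite_region finite_pairs_upto)
  also have "\<dots> \<le> card (pairs_upto L) + card (region Y - pairs_upto L)" by (rule card_Un_le)
  finally have "real (card (region Y)) \<le> real (card (pairs_upto L)) + real (card (region Y - pairs_upto L))"
    by linarith
  also have "real (card (pairs_upto L)) \<le> Y powr (2 / 3)"
  proof -
    have "card (pairs_upto L) \<le> card ({1..L} \<times> {1..L})"
      by (intro card_mono) (auto simp: pairs_upto_def)
    then have "real (card (pairs_upto L)) \<le> real (L * L)" by (simp only: of_nat_le_iff card_cartesian_product card_atLeastAtMost) simp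
    also have "\<dots> = (real L)\<^sup>2" by (simp add: power2_eq_square)
    also have "\<dots> \<le> (Y powr (1 / 3))\<^sup>2" using L by (intro power_mono) auto
    also have "\<dots> = Y powr (2 / 3)" using Y by (simp add: powr_power)
    finally show ?thesis .
  qed
  also have "real (card (region Y - pairs_upto L)) \<le> 24 * Y powr (2 / 3)"
  proof -
    have "real (card (region Y - pairs_upto L)) = (\<Sum>z\<in>region Y - pairs_upto L. 1)" by simp
    also have "\<dots> \<le> (\<Sum>z\<in>region Y - pairs_upto L. Y powr (2 / 3) * (case z of (m, l) \<Rightarrow> pair_weight m l))"
    proof (rule sum_mono)
      fix z assume "z \<in> region Y - pairs_upto L"
      then obtain m l where z: "z = (m, l)" "0 < m" "0 < l" "pair_form m l \<le> Y" by (auto simp: region_def)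
      have "0 < pair_form m l" using z by (simp add: pair_form_def)
      then have "Y powr (- 2 / 3) \<le> pair_weight m l" unfolding pair_weight_form using z by (intro powr_mono2') auto
      then have "Y powr (2 / 3) * Y powr (- 2 / 3) \<le> Y powr (2 / 3) * pair_weight m l" by (intro mult_left_mono) auto
      moreover have "Y powr (2 / 3) * Y powr (- 2 / 3) = 1" using Y by (simp flip: powr_add)
      ultimately show "1 \<le> Y powr (2 / 3) * (case z of (m, l) \<Rightarrow> pair_weight m l)" by (simp add: z)
    qed
    also have "\<dots> = Y powr (2 / 3) * weight_sum (region Y - pairs_upto L)" by (simp only: sum_distrib_left)
    also have "\<dots> \<le> Y powr (2 / 3) * 24" using L Y by (intro mult_left_mono region_weight_outside) auto
    finally show ?thesis by simp
  qed
  finally show ?thesis by simp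
qed

text \<open>The triangle has side about Y^(1/3), and ln (Y^(1/3)) turns the factor 6 / pi^2 into 2 /
  pi^2.\<close>

lemma coprime_region_weight:
  obtains K where "0 \<le> K" "\<And>Y. 1 \<le> Y \<Longrightarrow>
    \<bar>weight_sum (coprime_region Y) - 2 / pi\<^sup>2 * beta_third * ln Y\<bar> \<le> K"
proof -
  obtain A where A: "0 \<le> A" "\<And>L. 1 \<le> L \<Longrightarrow>
    \<bar>weight_sum (coprime_pairs_upto L) - 6 / pi\<^sup>2 * beta_third * ln (real L)\<bar> \<le> A"
    using coprime_pairs_upto_weight_sum by blast
  define \<kappa> where "\<kappa> = 6 / pi\<^sup>2 * beta_third"
  have main: "\<bar>weight_sum (coprime_region Y) - \<kappa> / 3 * ln Y\<bar> \<le> A + 24 + \<bar>\<kappa>\<bar>" if Y: "1 \<le> Y" for Y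
  proof -
    define L where "L = nat \<lfloor>Y powr (1 / 3)\<rfloor>"
    have L: "real L \<le> Y powr (1 / 3)" "Y powr (1 / 3) \<le> real L + 1"
      unfolding L_def by (auto intro: of_nat_floor)
    have Y1: "1 \<le> Y powr (1 / 3)" using Y by (intro ge_one_powr_ge_zero) auto
    have L1: "1 \<le> L" unfolding L_def using Y1 by (simp add: le_nat_floor)
    have sub: "coprime_pairs_upto L \<subseteq> coprime_region Y"
      using pairs_upto_subset_region[OF L(1)] Y by (auto simp: coprime_pairs_upto_def coprime_region_def)
    have "weight_sum (coprime_region Y) = weight_sum (coprime_region Y - coprime_pairs_upto L) + weight_sum (coprime_pairs_upto L)"
      using sub by (intro sum.subset_diff finite_coprime_region)
    moreover have "weight_sum (coprime_region Y - coprime_pairs_upto L) \<le> weight_sum (region Y - pairs_upto L)"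
      by (intro sum_mono2) (auto simp: finite_region coprime_region_def coprime_pairs_upto_def pair_weight_nonneg)
    moreover have "weight_sum (region Y - pairs_upto L) \<le> 24" using L Y by (intro region_weight_outside) auto
    moreover have "0 \<le> weight_sum (coprime_region Y - coprime_pairs_upto L)"
      by (intro sum_nonneg) (auto simp: pair_weight_nonneg)
    ultimately have 1: "\<bar>weight_sum (coprime_region Y) - weight_sum (coprime_pairs_upto L)\<bar> \<le> 24" by linarith
    have lnY: "ln (Y powr (1 / 3)) = 1 / 3 * ln Y" using Y by (simp add: ln_powr)
    have "ln (real L) \<le> ln (Y powr (1 / 3))" using L L1 by (intro ln_mono) auto
    moreover have "ln (Y powr (1 / 3)) \<le> ln (2 * real L)" using L L1 Y1 by (intro ln_mono) auto
    moreover have "ln (2 * real L) = ln 2 + ln (real L)" using L1 by (simp add: ln_mult)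
    moreover have "ln 2 \<le> (1::real)" using ln_2_less_1 by simp
    ultimately have "\<bar>ln (real L) - 1 / 3 * ln Y\<bar> \<le> 1" unfolding lnY by linarith
    then have "\<bar>\<kappa>\<bar> * \<bar>ln (real L) - 1 / 3 * ln Y\<bar> \<le> \<bar>\<kappa>\<bar> * 1" by (intro mult_left_mono) auto
    then have "\<bar>\<kappa> * ln (real L) - \<kappa> / 3 * ln Y\<bar> \<le> \<bar>\<kappa>\<bar>" by (simp add: right_diff_distrib flip: abs_mult)
    then show ?thesis using 1 A(2)[OF L1] unfolding \<kappa>_def[symmetric] by linarith
  qed
  show thesis using main A(1) by (intro that[of "A + 24 + \<bar>\<kappa>\<bar>"]) (auto simp: \<kappa>_def)
qed

section \<open>Counting the doubly regular quadruples\<close>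

definition height :: "int \<Rightarrow> int \<Rightarrow> int \<Rightarrow> int" where
  "height a b r = 4 * r * (a + r) * (b + r)"

text \<open>Only k is recorded, since it determines n. The root r = m n + \<open>\<sigma>\<close> is
  the midpoint of m n and k l, so r + \<open>\<sigma>\<close> = k l and r - \<open>\<sigma>\<close>
  = m n.\<close>

definition fibre :: "int \<Rightarrow> real \<Rightarrow> int \<Rightarrow> int \<Rightarrow> int set" where
  "fibre \<sigma> x m l = {k. m \<le> k \<and> (\<exists>n>0. k * l - m * n = 2 * \<sigma> \<and>
     real_of_int (height (m * k) (n * l) (m * n + \<sigma>)) \<le> x)}"

text \<open>The solution T of 4 v^2 T^3 = x. Because k l is close to m n, the height is about 4 v^2
  (k / m)^3 with v = m l (m + l), so T is the expected cutoff for k / m.\<close>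

definition threshold :: "real \<Rightarrow> real \<Rightarrow> real" where
  "threshold x v = (x / 4) powr (1 / 3) * v powr (- 2 / 3)"

lemma threshold_cube:
  assumes "0 < x" "0 < v"
  shows "threshold x v ^ 3 * (4 * v\<^sup>2) = x"
proof -
  have "((x / 4) powr (1 / 3)) ^ 3 = x / 4" using assms by (simp add: powr_power)
  moreover have "(v powr (- 2 / 3)) ^ 3 = 1 / v\<^sup>2"
    using assms powr_minus_divide[of v 2] by (simp add: powr_power)
  ultimately show ?thesis using assms by (simp add: threshold_def power_mult_distrib)
qed

text \<open>The factors r, m k + r and m (n l + r) are close to l k, (m + l) k and l (m + l) k;
  replacing k by k + 2 m covers the deviations. The extra factor m clears the denominator of n = (k
  l - 2 s) / m. A shift of k by 2 m moves k / m by only 2.\<close>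

lemma height_upper:
  fixes k l m n s :: real
  assumes pos: "1 \<le> m" "1 \<le> l" "m \<le> k" "0 < n" and s: "\<bar>s\<bar> = 1" and eq: "k * l - m * n = 2 * s"
    and r: "0 \<le> m * n + s"
  shows "m * (4 * (m * n + s) * (m * k + (m * n + s)) * (n * l + (m * n + s))) \<le> 4 * (l * (m + l))\<^sup>2 * (k + 2 * m) ^ 3"
proof -
  define r where "r = m * n + s"
  have rk: "r = k * l - s" "0 \<le> r" "m * n = k * l - 2 * s" using eq r by (simp_all add: r_def)
  have s1: "s \<le> 1" "- 1 \<le> s" using s by auto
  have lm: "1 \<le> l * m" using mult_mono[of 1 l 1 m] pos by simp
  have 1: "r \<le> l * (k + 2 * m)" using rk s1 lm by (simp add: algebra_simps)
  have "1 \<le> m * m" using mult_mono[of 1 m 1 m] pos by simp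
  then have 2: "m * k + r \<le> (m + l) * (k + 2 * m)" using rk s1 lm by (simp add: algebra_simps)
  have E: "m * (n * l + r) = (k * l - 2 * s) * l + m * (k * l - s)"
  proof -
    have "m * (n * l + r) = (m * n) * l + m * r" by (simp add: algebra_simps)
    then show ?thesis by (simp only: rk)
  qed
  have "l * 1 \<le> l * (l * m)" "m * 1 \<le> m * (l * m)" using pos lm by (intro mult_left_mono; simp)+
  moreover have "s * l \<ge> - 1 * l" "s * m \<ge> - 1 * m" using s1 pos by (intro mult_right_mono; simp)+
  moreover have "(l * (m + l)) * (k + 2 * m) - m * (n * l + r) = 2 * (l * (l * m)) + 2 * (m * (l * m)) + 2 * (s * l) + s * m"
    unfolding E by (simp add: algebra_simps)
  ultimately have 3: "m * (n * l + r) \<le> (l * (m + l)) * (k + 2 * m)" using pos by linarith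
  have k: "0 \<le> m * k + r" "0 \<le> m * (n * l + r)" "0 \<le> k + 2 * m" using pos rk by auto
  have "m * (4 * r * (m * k + r) * (n * l + r)) = 4 * r * (m * k + r) * (m * (n * l + r))" by simp
  also have "\<dots> \<le> 4 * (l * (k + 2 * m)) * ((m + l) * (k + 2 * m)) * ((l * (m + l)) * (k + 2 * m))"
  proof -
    have nn: "0 \<le> l * (k + 2 * m)" "0 \<le> (m + l) * (k + 2 * m)" using pos by auto
    have "r * (m * k + r) \<le> (l * (k + 2 * m)) * ((m + l) * (k + 2 * m))"
      by (rule mult_mono[OF 1 2 nn(1) k(1)])
    then have "r * (m * k + r) * (m * (n * l + r)) \<le> (l * (k + 2 * m)) * ((m + l) * (k + 2 * m)) * ((l * (m + l)) * (k + 2 * m))"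
      by (rule mult_mono[OF _ 3 mult_nonneg_nonneg[OF nn] k(2)])
    then show ?thesis by simp
  qed
  also have "\<dots> = 4 * (l * (m + l))\<^sup>2 * (k + 2 * m) ^ 3"
    by (simp add: power2_eq_square power3_eq_cube)
  finally show ?thesis by (simp add: r_def)
qed

lemma height_lower:
  fixes k l m n s :: real
  assumes pos: "1 \<le> m" "1 \<le> l" "2 * m \<le> k" "0 < n" and s: "\<bar>s\<bar> = 1" and eq: "k * l - m * n = 2 * s"
  shows "4 * (l * (m + l))\<^sup>2 * (k - 2 * m) ^ 3 \<le> m * (4 * (m * n + s) * (m * k + (m * n + s)) * (n * l + (m * n + s)))"
proof -
  define r where "r = m * n + s"
  have rk: "r = k * l - s" "m * n = k * l - 2 * s" using eq by (simp_all add: r_def)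
  have s1: "s \<le> 1" "- 1 \<le> s" using s by auto
  have lm: "1 \<le> l * m" using mult_mono[of 1 l 1 m] pos by simp
  have 1: "l * (k - 2 * m) \<le> r" using rk s1 lm by (simp add: algebra_simps)
  have "1 \<le> m * m" using mult_mono[of 1 m 1 m] pos by simp
  then have 2: "(m + l) * (k - 2 * m) \<le> m * k + r" using rk s1 lm by (simp add: algebra_simps)
  have E: "m * (n * l + r) = (k * l - 2 * s) * l + m * (k * l - s)"
  proof -
    have "m * (n * l + r) = (m * n) * l + m * r" by (simp add: algebra_simps)
    then show ?thesis by (simp only: rk)
  qed
  have "l * 1 \<le> l * (l * m)" "m * 1 \<le> m * (l * m)" using pos lm by (intro mult_left_mono; simp)+
  moreover have "s * l \<le> 1 * l" "s * m \<le> 1 * m" using s1 pos by (intro mult_right_mono; simp)+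
  moreover have "m * (n * l + r) - (l * (m + l)) * (k - 2 * m) = 2 * (l * (l * m)) + 2 * (m * (l * m)) - 2 * (s * l) - s * m"
    unfolding E by (simp add: algebra_simps)
  ultimately have 3: "(l * (m + l)) * (k - 2 * m) \<le> m * (n * l + r)" using pos by linarith
  have k: "0 \<le> k - 2 * m" "0 \<le> l" "0 \<le> m + l" using pos by auto
  have nn: "0 \<le> l * (k - 2 * m)" "0 \<le> (m + l) * (k - 2 * m)" "0 \<le> (l * (m + l)) * (k - 2 * m)"
    using k by auto
  have "4 * (l * (m + l))\<^sup>2 * (k - 2 * m) ^ 3 = 4 * ((l * (k - 2 * m)) * ((m + l) * (k - 2 * m)) * ((l * (m + l)) * (k - 2 * m)))"
    by (simp add: power2_eq_square power3_eq_cube)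
  also have "\<dots> \<le> 4 * (r * (m * k + r) * (m * (n * l + r)))"
  proof -
    have "(l * (k - 2 * m)) * ((m + l) * (k - 2 * m)) \<le> r * (m * k + r)"
      by (rule mult_mono[OF 1 2]) (use 1 nn in linarith)+
    moreover have "0 \<le> r * (m * k + r)" using 1 2 nn by (intro mult_nonneg_nonneg) linarith+
    ultimately have "(l * (k - 2 * m)) * ((m + l) * (k - 2 * m)) * ((l * (m + l)) * (k - 2 * m))
        \<le> r * (m * k + r) * (m * (n * l + r))"
      using 3 nn(3) by (intro mult_mono[of _ "r * (m * k + r)"])
    then show ?thesis by (rule mult_left_mono) simp
  qed
  also have "\<dots> = m * (4 * r * (m * k + r) * (n * l + r))" by simp
  finally show ?thesis by (simp add: r_def)
qed

text \<open>Here m <= k takes effect: m l <= 2 r, m (m + l) <= 2 (m k + r) and l (m + l) <= 3 (n l +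
  r). Consequently only pairs in \<open>region\<close> (sqrt (3 x)) have a nonempty fibre.\<close>

lemma height_ge_form:
  fixes k l m n \<sigma> :: int
  assumes pos: "0 < m" "0 < l" "m \<le> k" "0 < n" and s: "\<bar>\<sigma>\<bar> = 1" and eq: "k * l - m * n = 2 * \<sigma>"
  shows "(m * l * (m + l))\<^sup>2 \<le> 3 * height (m * k) (n * l) (m * n + \<sigma>)"
proof -
  define r where "r = m * n + \<sigma>"
  have rk: "r = k * l - \<sigma>" using eq by (simp add: r_def)
  have "1 \<le> m * n" "1 \<le> k * l" using pos by (simp_all add: int_one_le_iff_zero_less)
  then have r1: "1 \<le> r" using s rk r_def by (cases "\<sigma> = 1") auto
  have kl: "m * l \<le> k * l" using pos by (intro mult_right_mono) auto
  have 1: "m * l \<le> 2 * r" using kl rk s r1 by linarith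
  have "m * m \<le> m * k" using pos by (intro mult_left_mono) auto
  moreover have "0 \<le> m * m" by simp
  ultimately have 2: "m * (m + l) \<le> 2 * (m * k + r)" using 1 unfolding distrib_left by linarith
  have "m * (l - 2) \<le> m * n"
  proof -
    have "m * l - 2 \<le> m * n" using eq kl s by linarith
    then show ?thesis using pos by (simp add: algebra_simps)
  qed
  then have "l - 2 \<le> n" using pos by (simp add: mult_le_cancel_left)
  then have "l \<le> 3 * n" using pos by linarith
  then have "l * l \<le> 3 * n * l" using pos by (intro mult_right_mono) auto
  then have 3: "l * (m + l) \<le> 3 * (n * l + r)" using 1 r1 by (simp add: algebra_simps)
  have "(m * l * (m + l))\<^sup>2 = (m * l) * (m * (m + l)) * (l * (m + l))" by (simp add: power2_eq_square)
  also have "\<dots> \<le> (2 * r) * (2 * (m * k + r)) * (3 * (n * l + r))"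
  proof -
    have nn: "0 \<le> m * (m + l)" "0 \<le> 2 * r" "0 \<le> l * (m + l)" "0 \<le> 2 * (m * k + r)" using pos r1 by auto
    have "(m * l) * (m * (m + l)) \<le> (2 * r) * (2 * (m * k + r))"
      by (rule mult_mono[OF 1 2 nn(2) nn(1)])
    then show ?thesis
      by (rule mult_mono[OF _ 3 mult_nonneg_nonneg[OF nn(2) nn(4)] nn(3)])
  qed
  also have "\<dots> = 3 * height (m * k) (n * l) r" by (simp add: height_def algebra_simps)
  finally show ?thesis by (simp add: r_def)
qed

lemma card_residue_class:
  fixes m c :: int and \<tau> :: real
  assumes m: "0 < m" and \<tau>: "0 \<le> \<tau>"
  defines "A \<equiv> {k. m \<le> k \<and> real_of_int k \<le> real_of_int m * \<tau> \<and> m dvd k - c}"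
  shows "finite A" "\<tau> - 2 \<le> real (card A)" "real (card A) \<le> \<tau>"
proof -
  define c' where "c' = c mod m"
  \<comment> \<open>With the residue c' in [0, m), the conditions k >= m and k <= m
    \<open>\<tau>\<close> on k = c' + j m become 1 <= j <= \<open>\<beta>\<close>, and
    \<open>\<beta>\<close> lies within 1 of \<open>\<tau>\<close>.\<close>
  define \<beta> where "\<beta> = \<tau> - real_of_int c' / real_of_int m"
  have c': "0 \<le> c'" "c' < m" using m by (auto simp: c'_def)
  have "0 \<le> real_of_int c' / real_of_int m" "real_of_int c' / real_of_int m \<le> 1" using c' by auto
  then have \<beta>: "\<tau> - 1 \<le> \<beta>" "\<beta> \<le> \<tau>" by (auto simp: \<beta>_def)
  have dv: "m dvd k - c \<longleftrightarrow> m dvd k - c'" for k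
  proof -
    have "k - c' = (k - c) + m * (c div m)" unfolding c'_def by (simp add: minus_mult_div_eq_mod[symmetric])
    then show ?thesis using dvd_add_left_iff[of m "m * (c div m)" "k - c"] by (simp only: dvd_triv_left)
  qed
  have A: "A = (\<lambda>j. c' + j * m) ` {1..\<lfloor>\<beta>\<rfloor>}"
  proof (intro equalityI subsetI)
    fix k assume "k \<in> A"
    then have k: "m \<le> k" "real_of_int k \<le> real_of_int m * \<tau>" "m dvd k - c'" by (auto simp: A_def dv)
    from k(3) obtain j where "k - c' = m * j" by (rule dvdE)
    then have j: "k = c' + j * m" by (simp add: algebra_simps)
    have "0 < j"
    proof (rule ccontr)
      assume "\<not> 0 < j"
      then have "j * m \<le> 0" using m by (simp add: mult_nonpos_nonneg)
      then show False using k(1) j c' by linarith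
    qed
    have "real_of_int c' + real_of_int j * real_of_int m \<le> real_of_int m * \<tau>" using k(2) j by simp
    then have "real_of_int j \<le> \<beta>" using m by (simp add: \<beta>_def field_simps)
    then show "k \<in> (\<lambda>j. c' + j * m) ` {1..\<lfloor>\<beta>\<rfloor>}" using j \<open>0 < j\<close> by (auto simp: le_floor_iff)
  next
    fix k assume "k \<in> (\<lambda>j. c' + j * m) ` {1..\<lfloor>\<beta>\<rfloor>}"
    then obtain j where "j \<in> {1..\<lfloor>\<beta>\<rfloor>}" "k = c' + j * m" by (rule imageE)
    then have j: "k = c' + j * m" "1 \<le> j" "real_of_int j \<le> \<beta>" by (simp_all add: le_floor_iff)
    have "1 * m \<le> j * m" using j m by (intro mult_right_mono) auto
    then have "m \<le> k" using j(1) c' by linarith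
    moreover have "real_of_int k \<le> real_of_int m * \<tau>"
      using j(3) m by (simp add: j(1) \<beta>_def field_simps)
    ultimately show "k \<in> A" by (simp add: A_def dv j(1))
  qed
  show "finite A" by (simp add: A)
  have "card A = card {1..\<lfloor>\<beta>\<rfloor>}"
    unfolding A using m by (intro card_image) (auto simp: inj_on_def)
  then have cA: "card A = nat \<lfloor>\<beta>\<rfloor>" by simp
  show "\<tau> - 2 \<le> real (card A)" unfolding cA using \<beta> by linarith
  show "real (card A) \<le> \<tau>" unfolding cA using \<beta> \<tau> by linarith
qed

text \<open>Multiply by the inverse of l modulo m, taken from a Bezout relation.\<close>

lemma residue_class_exists:
  fixes m l c :: int
  assumes "coprime m l"
  obtains c' where "\<And>k. m dvd k * l - c \<longleftrightarrow> m dvd k - c'"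
proof -
  obtain u v where uv: "u * m + v * l = 1"
    using bezout_int[of m l] assms by (auto simp: coprime_iff_gcd_eq_1)
  show thesis
  proof (rule that[of "v * c"])
    fix k
    have "(k - v * c) * l = (k * l - c) + m * (u * c)"
      using uv by algebra
    then have "m dvd k * l - c \<longleftrightarrow> m dvd (k - v * c) * l" by (simp add: dvd_add_left_iff)
    also have "\<dots> \<longleftrightarrow> m dvd k - v * c" using assms by (simp add: coprime_dvd_mult_left_iff)
    finally show "m dvd k * l - c \<longleftrightarrow> m dvd k - v * c" .
  qed
qed

text \<open>By the two height estimates the fibre lies between progressions modulo m with cutoffs T
  - 2 and T + 2 for k / m, up to two small elements. The third bound serves to count the triples
  produced by both signs.\<close>

lemma fibre_card:
  fixes m l :: nat and \<sigma> :: int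
  assumes ml: "0 < m" "0 < l" "coprime m l" and \<sigma>: "\<bar>\<sigma>\<bar> = 1" and x: "0 < x"
  defines "T \<equiv> threshold x (pair_form m l)"
  shows "finite (fibre \<sigma> x (int m) (int l))"
    and "\<bar>real (card (fibre \<sigma> x (int m) (int l))) - T\<bar> \<le> 6"
    and "real (card {k \<in> fibre \<sigma> x (int m) (int l). k \<le> 4 * int m}) \<le> 4"
proof -
  define F where "F = fibre \<sigma> x (int m) (int l)"
  have cop: "coprime (int m) (int l)" using ml by simp
  obtain c where c: "\<And>k. int m dvd k * int l - 2 * \<sigma> \<longleftrightarrow> int m dvd k - c"
    using residue_class_exists[OF cop] by blast
  define C where "C \<tau> = {k. int m \<le> k \<and> real_of_int k \<le> real_of_int (int m) * \<tau> \<and> int m dvd k - c}" for \<tau> :: real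
  have m0: "0 < int m" using ml by simp
  note C = card_residue_class[OF m0, of _ c, folded C_def]
  have v0: "0 < pair_form m l" using ml by (simp add: pair_form_def)
  have T0: "0 \<le> T" by (simp add: T_def threshold_def)
  have T3: "T ^ 3 * (4 * (pair_form m l)\<^sup>2) = x" unfolding T_def using x v0 by (rule threshold_cube)
  have vm: "(pair_form m l)\<^sup>2 = (real m)\<^sup>2 * (real l * (real m + real l))\<^sup>2"
    by (simp add: pair_form_def power_mult_distrib)
  define W where "W = real l * (real m + real l)"
  have W: "0 < W" using ml by (simp add: W_def)
  \<comment> \<open>Writes the bound m x so that both height estimates reduce to comparing k - 2 m
    or k + 2 m with m T.\<close>
  have mx: "4 * W\<^sup>2 * (real m * T) ^ 3 = real m * x"
    unfolding T3[symmetric] vm W_def[symmetric] by (simp add: power2_eq_square power3_eq_cube)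
  have \<sigma>1: "\<bar>real_of_int \<sigma>\<bar> = 1" using arg_cong[OF \<sigma>, of real_of_int] by simp
  have m1: "1 \<le> real m" "1 \<le> real l" using ml by auto
  have dvd: "int m dvd k - c" if "k \<in> F" for k
  proof -
    obtain n where "k * int l - int m * n = 2 * \<sigma>" using \<open>k \<in> F\<close> by (auto simp: F_def fibre_def)
    then have "k * int l - 2 * \<sigma> = int m * n" by simp
    then show ?thesis using c[of k] by simp
  qed
  have upper: "F \<subseteq> C (T + 2)"
  proof
    fix k assume k: "k \<in> F"
    then obtain n where n: "int m \<le> k" "0 < n" "k * int l - int m * n = 2 * \<sigma>"
      "real_of_int (height (int m * k) (n * int l) (int m * n + \<sigma>)) \<le> x"
      by (auto simp: F_def fibre_def)
    have "real_of_int k \<le> real m * (T + 2)"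
    proof (cases "2 * int m \<le> k")
      case False
      then have "real_of_int k \<le> real m * 2" by linarith
      also have "\<dots> \<le> real m * (T + 2)" using T0 by (intro mult_left_mono) auto
      finally show ?thesis .
    next
      case True
      have eq: "real_of_int k * real l - real m * real_of_int n = 2 * real_of_int \<sigma>"
        using arg_cong[OF n(3), of real_of_int] by simp
      have h: "real_of_int (height (int m * k) (n * int l) (int m * n + \<sigma>)) =
        4 * (real m * real_of_int n + real_of_int \<sigma>) * (real m * real_of_int k + (real m * real_of_int n + real_of_int \<sigma>)) *
          (real_of_int n * real l + (real m * real_of_int n + real_of_int \<sigma>))"
        by (simp add: height_def)
      have "2 * real m \<le> real_of_int k" using True by linarith
      then have "4 * W\<^sup>2 * (real_of_int k - 2 * real m) ^ 3 \<le> real m * real_of_int (height (int m * k) (n * int l) (int m * n + \<sigma>))"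
        unfolding h W_def using n by (intro height_lower[OF m1 _ _ \<sigma>1 eq]) auto
      also have "\<dots> \<le> real m * x" using n by (intro mult_left_mono) auto
      also have "\<dots> = 4 * W\<^sup>2 * (real m * T) ^ 3" by (rule mx[symmetric])
      finally have "(real_of_int k - 2 * real m) ^ 3 \<le> (real m * T) ^ 3" using W by simp
      then have "\<not> real m * T < real_of_int k - 2 * real m"
        using power_strict_mono[of "real m * T" "real_of_int k - 2 * real m" 3] T0 by auto
      then show ?thesis by (simp add: algebra_simps)
    qed
    then show "k \<in> C (T + 2)" using n dvd[OF k] by (simp add: C_def)
  qed
  have fin: "finite F" using finite_subset[OF upper] C(1)[of "T + 2"] T0 by simp
  then show "finite F" .
  have "card F \<le> card (C (T + 2))" using upper C(1)[of "T + 2"] T0 by (intro card_mono) auto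
  then have up: "real (card F) \<le> T + 2" using C(3)[of "T + 2"] T0 by linarith
  have low: "T - 6 \<le> real (card F)"
  proof (cases "T \<le> 4")
    case False
    \<comment> \<open>Without 1 and 2 one has k l >= 3, so k l - 2 \<open>\<sigma>\<close> and hence
      n is positive. The loss of 6 consists of 2 for the cutoff, 2 for the progression and 2 for the
      removed elements.\<close>
    have "C (T - 2) - {1, 2} \<subseteq> F"
    proof
      fix k assume "k \<in> C (T - 2) - {1, 2}"
      then have k: "int m \<le> k" "real_of_int k \<le> real m * (T - 2)" "int m dvd k - c" "k \<noteq> 1" "k \<noteq> 2"
        by (auto simp: C_def)
      then have "int m dvd k * int l - 2 * \<sigma>" using c by blast
      then obtain n where n: "k * int l - 2 * \<sigma> = int m * n" by blast
      have k3: "3 \<le> k" using k m0 by linarith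
      have "k * 1 \<le> k * int l" using ml k3 by (intro mult_left_mono) auto
      then have "0 < int m * n" using n k3 \<sigma> by linarith
      then have n0: "0 < n" using m0 by (simp add: zero_less_mult_iff)
      have n': "k * int l - int m * n = 2 * \<sigma>" using n by simp
      have eq: "real_of_int k * real l - real m * real_of_int n = 2 * real_of_int \<sigma>"
        using arg_cong[OF n', of real_of_int] by simp
      have h: "real_of_int (height (int m * k) (n * int l) (int m * n + \<sigma>)) =
        4 * (real m * real_of_int n + real_of_int \<sigma>) * (real m * real_of_int k + (real m * real_of_int n + real_of_int \<sigma>)) *
          (real_of_int n * real l + (real m * real_of_int n + real_of_int \<sigma>))"
        by (simp add: height_def)
      have km: "real m \<le> real_of_int k" using k(1) by linarith
      have "0 \<le> int m * n + \<sigma>" using \<open>0 < int m * n\<close> \<sigma> by linarith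
      then have "0 \<le> real_of_int (int m * n + \<sigma>)" by (simp only: of_int_0_le_iff)
      then have r0: "0 \<le> real m * real_of_int n + real_of_int \<sigma>" by simp
      have n1: "0 < real_of_int n" using n0 by simp
      have "real m * real_of_int (height (int m * k) (n * int l) (int m * n + \<sigma>)) \<le> 4 * W\<^sup>2 * (real_of_int k + 2 * real m) ^ 3"
        unfolding h W_def by (rule height_upper[OF m1 km n1 \<sigma>1 eq r0])
      also have "\<dots> \<le> 4 * W\<^sup>2 * (real m * T) ^ 3"
        using k(2) km by (intro mult_left_mono power_mono) (auto simp: algebra_simps)
      also have "\<dots> = real m * x" by (rule mx)
      finally have "real_of_int (height (int m * k) (n * int l) (int m * n + \<sigma>)) \<le> x"
        using ml by simp
      then show "k \<in> F" using k(1) n0 n' by (auto simp: F_def fibre_def)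
    qed
    then have "card (C (T - 2) - {1, 2}) \<le> card F" using fin by (intro card_mono)
    moreover have "card (C (T - 2)) - card {1, 2 :: int} \<le> card (C (T - 2) - {1, 2})"
      by (intro diff_card_le_card_Diff) auto
    moreover have "card {1, 2 :: int} = 2" by simp
    ultimately have "real (card (C (T - 2))) - 2 \<le> real (card F)" by linarith
    then show ?thesis using C(2)[of "T - 2"] False by linarith
  qed linarith
  show "\<bar>real (card F) - T\<bar> \<le> 6" using up low by linarith
  have "{k \<in> F. k \<le> 4 * int m} \<subseteq> C 4"
    using dvd by (auto simp: C_def F_def fibre_def)
  then have "card {k \<in> F. k \<le> 4 * int m} \<le> card (C 4)" using C(1)[of 4] by (intro card_mono) auto
  then show "real (card {k \<in> F. k \<le> 4 * int m}) \<le> 4" using C(3)[of 4] by linarith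
qed

section \<open>Solutions of k l - m n = 2 \<open>\<sigma>\<close>\<close>

definition solutions :: "int \<Rightarrow> real \<Rightarrow> (int \<times> int \<times> int \<times> int) set" where
  "solutions \<sigma> x = {(k, l, m, n). 0 < k \<and> 0 < l \<and> 0 < m \<and> 0 < n \<and> k * l - m * n = 2 * \<sigma> \<and>
     coprime m l \<and> m \<le> k \<and> real_of_int (height (m * k) (n * l) (m * n + \<sigma>)) \<le> x}"

definition solution_fibres :: "int \<Rightarrow> real \<Rightarrow> ((nat \<times> nat) \<times> int) set" where
  "solution_fibres \<sigma> x = (SIGMA z:coprime_region (sqrt (3 * x)). fibre \<sigma> x (int (fst z)) (int (snd z)))"

text \<open>n is recovered by division, and \<open>height_ge_form\<close> places (m, l) in the
  region.\<close>

lemma bij_betw_solutions: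
  assumes \<sigma>: "\<bar>\<sigma>\<bar> = 1" and x: "0 < x"
  shows "bij_betw (\<lambda>(k, l, m, n). ((nat m, nat l), k)) (solutions \<sigma> x) (solution_fibres \<sigma> x)"
proof (rule bij_betw_byWitness[where f' = "\<lambda>((m, l), k). (k, int l, int m, (k * int l - 2 * \<sigma>) div int m)"])
  show "\<forall>z\<in>solutions \<sigma> x. (\<lambda>((m, l), k). (k, int l, int m, (k * int l - 2 * \<sigma>) div int m))
      ((\<lambda>(k, l, m, n). ((nat m, nat l), k)) z) = z"
  proof
    fix z assume z: "z \<in> solutions \<sigma> x"
    obtain k l m n where zz: "z = (k, l, m, n)" by (cases z)
    have "0 < l" "0 < m" "k * l - m * n = 2 * \<sigma>" using z by (auto simp: zz solutions_def)
    then have "k * l - 2 * \<sigma> = m * n" by simp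
    then show "(\<lambda>((m, l), k). (k, int l, int m, (k * int l - 2 * \<sigma>) div int m))
      ((\<lambda>(k, l, m, n). ((nat m, nat l), k)) z) = z"
      using \<open>0 < l\<close> \<open>0 < m\<close> by (simp add: zz)
  qed
  show "\<forall>z\<in>solution_fibres \<sigma> x. (\<lambda>(k, l, m, n). ((nat m, nat l), k))
      ((\<lambda>((m, l), k). (k, int l, int m, (k * int l - 2 * \<sigma>) div int m)) z) = z"
    by auto
  show "(\<lambda>(k, l, m, n). ((nat m, nat l), k)) ` solutions \<sigma> x \<subseteq> solution_fibres \<sigma> x"
  proof
    fix w assume "w \<in> (\<lambda>(k, l, m, n). ((nat m, nat l), k)) ` solutions \<sigma> x"
    then obtain k l m n where w: "w = ((nat m, nat l), k)" and z: "(k, l, m, n) \<in> solutions \<sigma> x" by auto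
    have h: "0 < k" "0 < l" "0 < m" "0 < n" "k * l - m * n = 2 * \<sigma>" "coprime m l" "m \<le> k"
      "real_of_int (height (m * k) (n * l) (m * n + \<sigma>)) \<le> x" using z by (auto simp: solutions_def)
    have "real_of_int ((m * l * (m + l))\<^sup>2) \<le> real_of_int (3 * height (m * k) (n * l) (m * n + \<sigma>))"
      unfolding of_int_le_iff by (rule height_ge_form[OF h(3,2,7,4) \<sigma> h(5)])
    also have "\<dots> \<le> 3 * x" using h(8) by simp
    finally have "(real_of_int (m * l * (m + l)))\<^sup>2 \<le> 3 * x" by simp
    then have "real_of_int (m * l * (m + l)) \<le> sqrt (3 * x)" by (rule real_le_rsqrt)
    moreover have "real_of_int (m * l * (m + l)) = pair_form (nat m) (nat l)"
      using h by (simp add: pair_form_def)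
    moreover have "coprime (nat m) (nat l)" using h by (simp add: coprime_int_iff flip: coprime_int_iff)
    ultimately have "(nat m, nat l) \<in> coprime_region (sqrt (3 * x))"
      using h by (simp add: coprime_region_def region_def)
    moreover have "k \<in> fibre \<sigma> x (int (nat m)) (int (nat l))" using h by (auto simp: fibre_def)
    ultimately show "w \<in> solution_fibres \<sigma> x" by (simp add: w solution_fibres_def)
  qed
  show "(\<lambda>((m, l), k). (k, int l, int m, (k * int l - 2 * \<sigma>) div int m)) ` solution_fibres \<sigma> x \<subseteq> solutions \<sigma> x"
  proof
    fix w assume "w \<in> (\<lambda>((m, l), k). (k, int l, int m, (k * int l - 2 * \<sigma>) div int m)) ` solution_fibres \<sigma> x"
    then obtain m l k where w: "w = (k, int l, int m, (k * int l - 2 * \<sigma>) div int m)"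
      and z: "((m, l), k) \<in> solution_fibres \<sigma> x" by auto
    have h: "0 < m" "0 < l" "coprime m l" "k \<in> fibre \<sigma> x (int m) (int l)"
      using z by (auto simp: solution_fibres_def coprime_region_def region_def)
    then obtain n where n: "int m \<le> k" "0 < n" "k * int l - int m * n = 2 * \<sigma>"
      "real_of_int (height (int m * k) (n * int l) (int m * n + \<sigma>)) \<le> x"
      by (auto simp: fibre_def)
    have "k * int l - 2 * \<sigma> = int m * n" using n(3) by simp
    then have "(k * int l - 2 * \<sigma>) div int m = n" using h(1) by simp
    then show "w \<in> solutions \<sigma> x" using h n by (simp add: w solutions_def)
  qed
qed

lemma card_solutions:
  assumes \<sigma>: "\<bar>\<sigma>\<bar> = 1" and x: "0 < x"
  shows "finite (solutions \<sigma> x)"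
    and "\<bar>real (card (solutions \<sigma> x)) - (x / 4) powr (1 / 3) * weight_sum (coprime_region (sqrt (3 * x)))\<bar>
       \<le> 6 * real (card (region (sqrt (3 * x))))"
    and "real (card {(k, l, m, n) \<in> solutions \<sigma> x. k \<le> 4 * m}) \<le> 4 * real (card (region (sqrt (3 * x))))"
proof -
  define R where "R = coprime_region (sqrt (3 * x))"
  define F where "F = (\<lambda>z::nat \<times> nat. fibre \<sigma> x (int (fst z)) (int (snd z)))"
  have finR: "finite R" by (simp add: R_def finite_coprime_region)
  have cardR: "card R \<le> card (region (sqrt (3 * x)))"
    by (intro card_mono finite_region) (auto simp: R_def coprime_region_def)
  have z: "finite (F z)" "\<bar>real (card (F z)) - threshold x (pair_form (fst z) (snd z))\<bar> \<le> 6"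
    "real (card {k \<in> F z. k \<le> 4 * int (fst z)}) \<le> 4" if "z \<in> R" for z
  proof -
    have "0 < fst z" "0 < snd z" "coprime (fst z) (snd z)" using that
      by (auto simp: R_def coprime_region_def region_def)
    from fibre_card[OF this \<sigma> x] show "finite (F z)" "\<bar>real (card (F z)) - threshold x (pair_form (fst z) (snd z))\<bar> \<le> 6"
      "real (card {k \<in> F z. k \<le> 4 * int (fst z)}) \<le> 4" by (simp_all add: F_def)
  qed
  note bij = bij_betw_solutions[OF \<sigma> x]
  have fib: "solution_fibres \<sigma> x = Sigma R F" by (simp add: solution_fibres_def R_def F_def)
  have finF: "finite (solution_fibres \<sigma> x)" unfolding fib using finR z(1) by (intro finite_SigmaI)
  then show fin: "finite (solutions \<sigma> x)" using bij_betw_finite[OF bij] by simp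
  have "card (solutions \<sigma> x) = card (Sigma R F)" using bij_betw_same_card[OF bij] by (simp add: fib)
  also have "\<dots> = (\<Sum>z\<in>R. card (F z))" using finR z(1) by (intro card_SigmaI) auto
  finally have "real (card (solutions \<sigma> x)) = (\<Sum>z\<in>R. real (card (F z)))" by simp
  moreover have "(x / 4) powr (1 / 3) * weight_sum R = (\<Sum>z\<in>R. threshold x (pair_form (fst z) (snd z)))"
    unfolding sum_distrib_left by (intro sum.cong) (auto simp: threshold_def pair_weight_form)
  ultimately have "real (card (solutions \<sigma> x)) - (x / 4) powr (1 / 3) * weight_sum R
      = (\<Sum>z\<in>R. real (card (F z)) - threshold x (pair_form (fst z) (snd z)))"
    by (simp add: sum_subtractf)
  also have "\<bar>\<dots>\<bar> \<le> (\<Sum>z\<in>R. \<bar>real (card (F z)) - threshold x (pair_form (fst z) (snd z))\<bar>)" by (rule sum_abs)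
  also have "\<dots> \<le> real (card R) * 6" using z(2) by (intro sum_bounded_above)
  also have "\<dots> \<le> 6 * real (card (region (sqrt (3 * x))))" using cardR by simp
  finally show "\<bar>real (card (solutions \<sigma> x)) - (x / 4) powr (1 / 3) * weight_sum (coprime_region (sqrt (3 * x)))\<bar>
       \<le> 6 * real (card (region (sqrt (3 * x))))" by (simp add: R_def)
  define G where "G = (\<lambda>z::nat \<times> nat. {k \<in> F z. k \<le> 4 * int (fst z)})"
  define S where "S = {(k, l, m, n) \<in> solutions \<sigma> x. k \<le> 4 * m}"
  have "(\<lambda>(k, l, m, n). ((nat m, nat l), k)) ` S \<subseteq> Sigma R G"
  proof
    fix w assume "w \<in> (\<lambda>(k, l, m, n). ((nat m, nat l), k)) ` S"
    then obtain k l m n where w: "w = ((nat m, nat l), k)" and s: "(k, l, m, n) \<in> solutions \<sigma> x" "k \<le> 4 * m"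
      by (auto simp: S_def)
    have "w \<in> solution_fibres \<sigma> x" using bspec[OF bij_betwE[OF bij] s(1)] by (simp add: w)
    moreover have "0 < m" using s(1) by (auto simp: solutions_def)
    ultimately show "w \<in> Sigma R G" using s(2) unfolding fib by (auto simp: w G_def)
  qed
  moreover have finG: "finite (Sigma R G)" using finR z(1) by (intro finite_SigmaI) (auto simp: G_def)
  moreover have "inj_on (\<lambda>(k, l, m, n). ((nat m, nat l), k)) S"
    by (rule inj_on_subset[OF bij_betw_imp_inj_on[OF bij]]) (auto simp: S_def)
  ultimately have "card S \<le> card (Sigma R G)" by (intro card_inj_on_le)
  also have "card (Sigma R G) = (\<Sum>z\<in>R. card (G z))" using finR z(1) by (intro card_SigmaI) (auto simp: G_def)
  finally have "real (card S) \<le> (\<Sum>z\<in>R. real (card (G z)))" by (simp flip: of_nat_sum)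
  also have "\<dots> \<le> real (card R) * 4" using z(3) by (intro sum_bounded_above) (simp add: G_def)
  also have "\<dots> \<le> 4 * real (card (region (sqrt (3 * x))))" using cardR by simp
  finally show "real (card {(k, l, m, n) \<in> solutions \<sigma> x. k \<le> 4 * m}) \<le> 4 * real (card (region (sqrt (3 * x))))"
    by (simp add: S_def)
qed

lemma card_region_sqrt_le:
  assumes "1 \<le> x"
  shows "real (card (region (sqrt (3 * x)))) \<le> 75 * x powr (1 / 3)"
proof -
  have "real (card (region (sqrt (3 * x)))) \<le> 25 * sqrt (3 * x) powr (2 / 3)"
    using assms by (intro card_region_le) simp
  also have "sqrt (3 * x) powr (2 / 3) = ((3 * x) powr (1 / 2)) powr (2 / 3)"
    using assms by (simp add: powr_half_sqrt)
  also have "\<dots> = (3 * x) powr (1 / 3)" by (simp only: powr_powr) simp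
  also have "\<dots> = 3 powr (1 / 3) * x powr (1 / 3)" by (rule powr_mult)
  also have "3 powr (1 / 3) \<le> (3::real) powr 1" by (intro powr_mono) auto
  then have "25 * (3 powr (1 / 3) * x powr (1 / 3)) \<le> 25 * (3 * x powr (1 / 3))"
    by (intro mult_left_mono mult_right_mono) auto
  finally show ?thesis by simp
qed

lemma card_solutions_asymp:
  assumes \<sigma>: "\<bar>\<sigma>\<bar> = 1"
  obtains K where "0 \<le> K" "\<And>x. 1 \<le> x \<Longrightarrow>
    \<bar>real (card (solutions \<sigma> x)) - (x / 4) powr (1 / 3) * (beta_third / pi\<^sup>2 * ln x)\<bar> \<le> K * x powr (1 / 3)"
proof -
  define B where "B = 2 / pi\<^sup>2 * beta_third"
  obtain A where A: "0 \<le> A" "\<And>Y. 1 \<le> Y \<Longrightarrow> \<bar>weight_sum (coprime_region Y) - B * ln Y\<bar> \<le> A"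
    using coprime_region_weight unfolding B_def by blast
  define A' where "A' = A + \<bar>B * ln 3 / 2\<bar>"
  have main: "\<bar>real (card (solutions \<sigma> x)) - (x / 4) powr (1 / 3) * (beta_third / pi\<^sup>2 * ln x)\<bar> \<le> (450 + A') * x powr (1 / 3)"
    if x: "1 \<le> x" for x
  proof -
    define W where "W = weight_sum (coprime_region (sqrt (3 * x)))"
    define c where "c = (x / 4) powr (1 / 3)"
    have "1 \<le> sqrt (3 * x)" using x by simp
    then have "\<bar>W - B * ln (sqrt (3 * x))\<bar> \<le> A" unfolding W_def by (rule A(2))
    \<comment> \<open>The square root halves \<open>B\<close>; the constant 3 only affects the
      bounded part.\<close>
    moreover have "B * ln (sqrt (3 * x)) = B * ln 3 / 2 + beta_third / pi\<^sup>2 * ln x"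
    proof -
      have "ln (sqrt (3 * x)) = (ln 3 + ln x) / 2" using x by (simp add: ln_sqrt ln_mult)
      then have "B * ln (sqrt (3 * x)) = B * ((ln 3 + ln x) / 2)" by (simp only:)
      also have "\<dots> = B * ln 3 / 2 + B / 2 * ln x" by (simp add: distrib_left add_divide_distrib)
      also have "B / 2 = beta_third / pi\<^sup>2" by (simp add: B_def)
      finally show ?thesis .
    qed
    ultimately have "\<bar>W - beta_third / pi\<^sup>2 * ln x\<bar> \<le> A'" unfolding A'_def by linarith
    then have "c * \<bar>W - beta_third / pi\<^sup>2 * ln x\<bar> \<le> c * A'" by (intro mult_left_mono) (auto simp: c_def)
    also have "c * A' \<le> x powr (1 / 3) * A'"
      using x A(1) unfolding c_def A'_def by (intro mult_right_mono powr_mono2) auto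
    finally have 1: "\<bar>c * W - c * (beta_third / pi\<^sup>2 * ln x)\<bar> \<le> A' * x powr (1 / 3)"
      unfolding right_diff_distrib[symmetric] abs_mult by (simp add: c_def mult.commute)
    have "\<bar>real (card (solutions \<sigma> x)) - c * W\<bar> \<le> 6 * real (card (region (sqrt (3 * x))))"
      unfolding c_def W_def using x by (intro card_solutions(2)[OF \<sigma>]) auto
    also have "\<dots> \<le> 6 * (75 * x powr (1 / 3))" using card_region_sqrt_le[OF x] by simp
    finally have 2: "\<bar>real (card (solutions \<sigma> x)) - c * W\<bar> \<le> 450 * x powr (1 / 3)" by simp
    show ?thesis using 1 2 unfolding c_def[symmetric] distrib_right by linarith
  qed
  show thesis using main A(1) by (intro that[of "450 + A'"]) (auto simp: A'_def)
qed

section \<open>Triples (a, b, r) and their factorizations\<close>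

definition regular_triples :: "real \<Rightarrow> (int \<times> int \<times> int) set" where
  "regular_triples x = {(a, b, r). 0 < a \<and> 0 < b \<and> 0 < r \<and> a * b + 1 = r\<^sup>2 \<and> real_of_int (height a b r) \<le> x}"

definition solution_triple :: "int \<Rightarrow> int \<times> int \<times> int \<times> int \<Rightarrow> int \<times> int \<times> int" where
  "solution_triple \<sigma> = (\<lambda>(k, l, m, n). (m * k, n * l, m * n + \<sigma>))"

text \<open>Here a = m k and r + \<open>\<sigma>\<close> = l k with m, l coprime. Recovering k in
  this way makes the parametrization injective.\<close>

lemma solution_triple_gcd:
  assumes "(k, l, m, n) \<in> solutions \<sigma> x"
  shows "gcd (m * k) (m * n + \<sigma> + \<sigma>) = k"
proof -
  have h: "0 < k" "k * l - m * n = 2 * \<sigma>" "coprime m l" using assms by (auto simp: solutions_def)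
  have "m * n + \<sigma> + \<sigma> = l * k" using h(2) by (simp add: algebra_simps)
  then have "gcd (m * k) (m * n + \<sigma> + \<sigma>) = gcd (m * k) (l * k)" by simp
  also have "\<dots> = gcd m l * k" using h(1) by (simp add: gcd_mult_right gcd.commute)
  also have "\<dots> = k" using h(3) by simp
  finally show ?thesis .
qed

lemma inj_on_solution_triple: "inj_on (solution_triple \<sigma>) (solutions \<sigma> x)"
proof (rule inj_onI)
  fix z w assume zw: "z \<in> solutions \<sigma> x" "w \<in> solutions \<sigma> x" "solution_triple \<sigma> z = solution_triple \<sigma> w"
  obtain k l m n where z: "z = (k, l, m, n)" by (cases z)
  obtain k' l' m' n' where w: "w = (k', l', m', n')" by (cases w)
  have eq: "m * k = m' * k'" "n * l = n' * l'" "m * n = m' * n'" using zw(3) by (auto simp: z w solution_triple_def)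
  have h: "0 < k" "0 < l" "0 < m" "0 < n" "k * l - m * n = 2 * \<sigma>" using zw(1) by (auto simp: z solutions_def)
  have h': "0 < k'" "0 < l'" "0 < m'" "0 < n'" "k' * l' - m' * n' = 2 * \<sigma>" using zw(2) by (auto simp: w solutions_def)
  have k: "k = k'" using solution_triple_gcd[OF zw(1)[unfolded z]] solution_triple_gcd[OF zw(2)[unfolded w]] eq by simp
  then have m: "m = m'" using eq(1) h by simp
  then have n: "n = n'" using eq(3) h by simp
  then have "l = l'" using eq(2) h by simp
  then show "z = w" using k m n by (simp add: z w)
qed

text \<open>As k = gcd(a, r + \<open>\<sigma>\<close>) and a = m k, the condition m <= k reads a <=
  k^2. Conversely, dividing by this gcd leaves m coprime to l, and a b = (r +
  \<open>\<sigma>\<close>) (r - \<open>\<sigma>\<close>) forces m to divide r -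
  \<open>\<sigma>\<close>.\<close>

lemma solution_triple_image:
  assumes \<sigma>: "\<bar>\<sigma>\<bar> = 1"
  shows "solution_triple \<sigma> ` solutions \<sigma> x = {(a, b, r) \<in> regular_triples x. a \<le> (gcd a (r + \<sigma>))\<^sup>2}"
proof (intro equalityI subsetI)
  have ss: "\<sigma> * \<sigma> = 1" using \<sigma> by (metis abs_mult_self_eq mult_1)
  fix t assume "t \<in> solution_triple \<sigma> ` solutions \<sigma> x"
  then obtain z where zt: "z \<in> solutions \<sigma> x" "t = solution_triple \<sigma> z" by blast
  obtain k l m n where z: "z = (k, l, m, n)" by (cases z)
  have h: "0 < k" "0 < l" "0 < m" "0 < n" "k * l - m * n = 2 * \<sigma>" "m \<le> k"
    "real_of_int (height (m * k) (n * l) (m * n + \<sigma>)) \<le> x" using zt(1) by (auto simp: z solutions_def)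
  have "1 \<le> m * n" "1 \<le> k * l" using h by (simp_all add: int_one_le_iff_zero_less)
  then have "0 < m * n + \<sigma>" using \<sigma> h(5) by (cases "\<sigma> = 1") auto
  moreover have "m * k * (n * l) + 1 = (m * n + \<sigma>)\<^sup>2" using h(5) ss by algebra
  ultimately have "(m * k, n * l, m * n + \<sigma>) \<in> regular_triples x" using h by (simp add: regular_triples_def)
  moreover have "m * k \<le> (gcd (m * k) (m * n + \<sigma> + \<sigma>))\<^sup>2"
    using solution_triple_gcd[OF zt(1)[unfolded z]] h by (simp add: power2_eq_square)
  ultimately show "t \<in> {(a, b, r) \<in> regular_triples x. a \<le> (gcd a (r + \<sigma>))\<^sup>2}"
    by (simp add: zt(2) z solution_triple_def)
next
  have ss: "\<sigma> * \<sigma> = 1" using \<sigma> by (metis abs_mult_self_eq mult_1)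
  fix t assume t: "t \<in> {(a, b, r) \<in> regular_triples x. a \<le> (gcd a (r + \<sigma>))\<^sup>2}"
  obtain a b r where abr: "t = (a, b, r)" by (cases t)
  have h: "0 < a" "0 < b" "0 < r" "a * b + 1 = r\<^sup>2" "real_of_int (height a b r) \<le> x" "a \<le> (gcd a (r + \<sigma>))\<^sup>2"
    using t by (auto simp: abr regular_triples_def)
  \<comment> \<open>r = 1 would make a b = 0; with r >= 2 both r + \<open>\<sigma>\<close> and r -
    \<open>\<sigma>\<close> are positive.\<close>
  have "r \<noteq> 1" using h by auto
  then have r2: "2 \<le> r" using h(3) by linarith
  have pos: "0 < r + \<sigma>" "0 < r - \<sigma>" using r2 \<sigma> by linarith+
  define k where "k = gcd a (r + \<sigma>)"
  have k0: "0 < k" using h(1) by (simp add: k_def)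
  obtain m where m: "a = k * m" unfolding k_def by (meson dvdE gcd_dvd1)
  obtain l where l: "r + \<sigma> = k * l" unfolding k_def by (meson dvdE gcd_dvd2)
  have m0: "0 < m" using m h(1) k0 by (simp add: zero_less_mult_iff)
  have l0: "0 < l" using l pos(1) k0 by (simp add: zero_less_mult_iff)
  have "coprime (a div k) ((r + \<sigma>) div k)" unfolding k_def using h(1) by (intro div_gcd_coprime) auto
  then have cop: "coprime m l" using m l k0 by simp
  have "a * b = (r + \<sigma>) * (r - \<sigma>)" using h(4) ss by algebra
  then have mb: "m * b = l * (r - \<sigma>)" using m l k0 by simp
  then have "m dvd l * (r - \<sigma>)" by (metis dvd_triv_left)
  then have "m dvd r - \<sigma>" using cop by (simp add: coprime_dvd_mult_right_iff)
  then obtain n where n: "r - \<sigma> = m * n" by (rule dvdE)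
  have n0: "0 < n" using n pos(2) m0 by (simp add: zero_less_mult_iff)
  have "b = n * l" using mb n m0 by simp
  have r: "m * n + \<sigma> = r" using n by simp
  have "a \<le> k\<^sup>2" using h(6) unfolding k_def .
  then have "k * m \<le> k * k" using m by (simp add: power2_eq_square)
  then have "m \<le> k" using k0 by simp
  moreover have "k * l - m * n = 2 * \<sigma>" using l n by linarith
  moreover have "m * k = a" using m by simp
  ultimately have "(k, l, m, n) \<in> solutions \<sigma> x" using k0 l0 m0 n0 cop h(5) r \<open>b = n * l\<close>
    by (simp add: solutions_def)
  moreover have "t = solution_triple \<sigma> (k, l, m, n)"
    using \<open>m * k = a\<close> \<open>b = n * l\<close> r by (simp add: abr solution_triple_def)
  ultimately show "t \<in> solution_triple \<sigma> ` solutions \<sigma> x" by blast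
qed

text \<open>Since \<open>a\<close> divides \<open>(r + 1)(r - 1)\<close>, one of \<open>gcd(a, r + 1)\<close>, \<open>gcd(a, r - 1)\<close> is at least
  \<open>\<surd>a\<close>; the corresponding factorization is a solution with \<open>m \<le> k\<close>.\<close>

lemma regular_triples_union:
  "regular_triples x = solution_triple 1 ` solutions 1 x \<union> solution_triple (- 1) ` solutions (- 1) x"
proof -
  have "a \<le> (gcd a (r + 1))\<^sup>2 \<or> a \<le> (gcd a (r + - 1))\<^sup>2" if "(a, b, r) \<in> regular_triples x" for a b r
  proof (rule ccontr)
    assume neg: "\<not> ?thesis"
    define u where "u = gcd a (r + 1)"
    define v where "v = gcd a (r - 1)"
    have a: "0 < a" "a * b + 1 = r\<^sup>2" using that by (auto simp: regular_triples_def)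
    have uv: "0 < u" "0 < v" using a by (auto simp: u_def v_def)
    have sq: "u\<^sup>2 < a" "v\<^sup>2 < a" using neg by (auto simp: u_def v_def)
    have "(r + 1) * (r - 1) = a * b" using a(2) by algebra
    then have "a dvd (r + 1) * (r - 1)" by simp
    then obtain s t where st: "a = s * t" "s dvd r + 1" "t dvd r - 1" using division_decomp by blast
    have "s dvd u" unfolding u_def using st by simp
    moreover have "t dvd v" unfolding v_def using st by simp
    ultimately have "a dvd u * v" unfolding st(1) by (rule mult_dvd_mono)
    then have "a \<le> u * v" using uv by (intro zdvd_imp_le) auto
    then have "a * a \<le> (u * v) * (u * v)" using a by (intro mult_mono) auto
    also have "\<dots> = u\<^sup>2 * v\<^sup>2" by (simp add: power2_eq_square)
    also have "\<dots> < a * a" using sq uv a(1) by (intro mult_strict_mono) auto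
    finally show False by simp
  qed
  then show ?thesis by (auto simp: solution_triple_image)
qed

text \<open>The images for the two signs overlap little: a common triple has m k <= (m gcd(k, n))^2,
  and gcd(k, n) divides k l - m n = 2, so k <= 4 m.\<close>

lemma card_regular_triples:
  assumes x: "1 \<le> x"
  shows "finite (regular_triples x)"
    and "\<bar>real (card (regular_triples x)) - (real (card (solutions 1 x)) + real (card (solutions (- 1) x)))\<bar> \<le> 300 * x powr (1 / 3)"
proof -
  define A where "A = solution_triple 1 ` solutions 1 x"
  define B where "B = solution_triple (- 1) ` solutions (- 1) x"
  have fin: "finite A" "finite B" unfolding A_def B_def using x by (auto intro!: finite_imageI card_solutions(1))
  have cA: "card A = card (solutions 1 x)" unfolding A_def by (intro card_image inj_on_solution_triple)
  have cB: "card B = card (solutions (- 1) x)" unfolding B_def by (intro card_image inj_on_solution_triple)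
  have un: "regular_triples x = A \<union> B" unfolding A_def B_def by (rule regular_triples_union)
  then show "finite (regular_triples x)" using fin by simp
  define S where "S = {(k, l, m, n) \<in> solutions 1 x. k \<le> 4 * m}"
  have "A \<inter> B \<subseteq> solution_triple 1 ` S"
  proof
    fix t assume t: "t \<in> A \<inter> B"
    then obtain k l m n where z: "(k, l, m, n) \<in> solutions 1 x" "t = solution_triple 1 (k, l, m, n)"
      unfolding A_def by auto
    have h: "0 < k" "0 < l" "0 < m" "0 < n" "k * l - m * n = 2" using z(1) by (auto simp: solutions_def)
    have "m * k \<le> (gcd (m * k) (m * n))\<^sup>2"
    proof -
      have "t \<in> {(a, b, r) \<in> regular_triples x. a \<le> (gcd a (r + - 1))\<^sup>2}"
        using t solution_triple_image[of "- 1" x] unfolding B_def by simp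
      then show ?thesis by (simp add: z(2) solution_triple_def)
    qed
    also have "gcd (m * k) (m * n) = m * gcd k n" using h by (simp add: gcd_mult_left)
    finally have 1: "m * k \<le> (m * gcd k n)\<^sup>2" .
    have "gcd k n dvd k * l - m * n" by (intro dvd_diff) auto
    then have "gcd k n \<le> 2" unfolding h(5) by (intro zdvd_imp_le) auto
    then have "m * gcd k n \<le> m * 2" using h by (intro mult_left_mono) auto
    then have "(m * gcd k n)\<^sup>2 \<le> (m * 2)\<^sup>2" using h by (intro power_mono) auto
    then have "m * k \<le> m * (4 * m)" using 1 by (simp add: power2_eq_square)
    then have "k \<le> 4 * m" using h by simp
    then show "t \<in> solution_triple 1 ` S" using z by (auto simp: S_def)
  qed
  moreover have "finite S" unfolding S_def using x by (intro finite_subset[OF _ card_solutions(1)[of 1 x]]) auto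
  ultimately have "card (A \<inter> B) \<le> card S" by (meson surj_card_le)
  then have "real (card (A \<inter> B)) \<le> real (card S)" by simp
  also have "\<dots> \<le> 4 * real (card (region (sqrt (3 * x))))" unfolding S_def using x by (intro card_solutions(3)) auto
  also have "\<dots> \<le> 4 * (75 * x powr (1 / 3))" using card_region_sqrt_le[OF x] by simp
  finally have 1: "real (card (A \<inter> B)) \<le> 300 * x powr (1 / 3)" by simp
  have "card A + card B = card (A \<union> B) + card (A \<inter> B)" using fin by (rule card_Un_Int)
  then have "real (card A) + real (card B) = real (card (regular_triples x)) + real (card (A \<inter> B))"
    unfolding un by (simp flip: of_nat_add)
  then show "\<bar>real (card (regular_triples x)) - (real (card (solutions 1 x)) + real (card (solutions (- 1) x)))\<bar> \<le> 300 * x powr (1 / 3)"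
    using 1 unfolding cA cB by linarith
qed

lemma card_regular_triples_asymp:
  obtains K where "0 \<le> K" "\<And>x. 1 \<le> x \<Longrightarrow>
    \<bar>real (card (regular_triples x)) - 2 * ((x / 4) powr (1 / 3) * (beta_third / pi\<^sup>2 * ln x))\<bar> \<le> K * x powr (1 / 3)"
proof -
  obtain K1 where K1: "0 \<le> K1" "\<And>x. 1 \<le> x \<Longrightarrow>
    \<bar>real (card (solutions 1 x)) - (x / 4) powr (1 / 3) * (beta_third / pi\<^sup>2 * ln x)\<bar> \<le> K1 * x powr (1 / 3)"
    using card_solutions_asymp[of 1] by auto
  obtain K2 where K2: "0 \<le> K2" "\<And>x. 1 \<le> x \<Longrightarrow>
    \<bar>real (card (solutions (- 1) x)) - (x / 4) powr (1 / 3) * (beta_third / pi\<^sup>2 * ln x)\<bar> \<le> K2 * x powr (1 / 3)"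
    using card_solutions_asymp[of "- 1"] by auto
  show thesis
  proof (rule that[of "300 + K1 + K2"])
    fix x :: real assume x: "1 \<le> x"
    show "\<bar>real (card (regular_triples x)) - 2 * ((x / 4) powr (1 / 3) * (beta_third / pi\<^sup>2 * ln x))\<bar> \<le> (300 + K1 + K2) * x powr (1 / 3)"
      using card_regular_triples(2)[OF x] K1(2)[OF x] K2(2)[OF x] unfolding distrib_right by linarith
  qed (use K1 K2 in auto)
qed

section \<open>The constant\<close>

text \<open>The cube of \<open>Gamma_series\<close> at 2/3 without its power of n. Cubing turns
  n^(2/3) into n^2, so Gamma(2/3)^3 is reached through rational numbers only.\<close>

definition gamma_cube_seq :: "nat \<Rightarrow> real" where
  "gamma_cube_seq n = (fact n / pochhammer (2 / 3) (Suc n)) ^ 3"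

lemma gamma_cube_seq_Suc:
  "gamma_cube_seq (Suc n) = gamma_cube_seq n * (real n + 1) ^ 3 / (real n + 5 / 3) ^ 3"
proof -
  have "pochhammer (2 / 3 :: real) (Suc (Suc n)) = pochhammer (2 / 3) (Suc n) * (real n + 5 / 3)"
    by (subst pochhammer_Suc) (simp add: algebra_simps)
  moreover have "fact (Suc n) = fact n * (real n + 1)" by (simp add: algebra_simps)
  ultimately show ?thesis
    by (simp only: gamma_cube_seq_def power_divide power_mult_distrib times_divide_eq_left divide_divide_eq_left)
qed

lemma gamma_cube_seq_pos: "0 < gamma_cube_seq n"
  unfolding gamma_cube_seq_def by (intro zero_less_power divide_pos_pos pochhammer_pos) auto

lemma gamma_cube_seq_limit:
  "(\<lambda>n. gamma_cube_seq n * (real n)\<^sup>2) \<longlonglongrightarrow> Gamma (2 / 3) ^ 3"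
proof -
  have "(\<lambda>n. Gamma_series (2 / 3 :: real) n ^ 3) \<longlonglongrightarrow> Gamma (2 / 3) ^ 3"
    by (intro tendsto_intros)
  moreover have "eventually (\<lambda>n. Gamma_series (2 / 3 :: real) n ^ 3 = gamma_cube_seq n * (real n)\<^sup>2) sequentially"
    using eventually_gt_at_top[of 0]
  proof eventually_elim
    case (elim n)
    have "exp (2 / 3 * ln (real n)) ^ 3 = exp (2 * ln (real n))"
      by (simp flip: exp_of_nat_mult)
    also have "\<dots> = (real n)\<^sup>2" using elim by (metis exp_ln exp_double of_nat_0_less_iff)
    finally show ?case
      by (simp add: Gamma_series_def gamma_cube_seq_def power_mult_distrib power_divide)
  qed
  ultimately show ?thesis by (rule Lim_transform_eventually)
qed

text \<open>n^2 is replaced by N^2 - N/3 + 2/27 with N = n + 1, the leading terms of the expansion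
  of (Gamma(N + 2/3) / Gamma(N))^3. The limit is the same, but convergence is fast and monotone, so
  n = 9 suffices.\<close>

lemma gamma_cube_upper: "Gamma (2 / 3) ^ 3 \<le> gamma_cube_seq 9 * (10 ^ 2 - 10 / 3 + 2 / 27)"
proof -
  define P where "P = (\<lambda>t::real. (t + 10) ^ 2 - (t + 10) / 3 + 2 / 27)"
  define s where "s = (\<lambda>j. gamma_cube_seq (j + 9) * P (real j))"
  have "s \<longlonglongrightarrow> Gamma (2 / 3) ^ 3"
  proof -
    have "(\<lambda>j. P (real j) / (real (j + 9))\<^sup>2) \<longlonglongrightarrow> 1"
      unfolding P_def by real_asymp
    then have "(\<lambda>j. (gamma_cube_seq (j + 9) * (real (j + 9))\<^sup>2) * (P (real j) / (real (j + 9))\<^sup>2)) \<longlonglongrightarrow> Gamma (2 / 3) ^ 3 * 1"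
      by (intro tendsto_mult LIMSEQ_ignore_initial_segment[OF gamma_cube_seq_limit])
    then show ?thesis by (simp add: s_def)
  qed
  moreover have "decseq s"
  proof (rule decseq_SucI)
    fix j
    define t where "t = real j"
    have t: "0 \<le> t" by (simp add: t_def)
    have step: "gamma_cube_seq (Suc j + 9) = gamma_cube_seq (j + 9) * ((t + 10) ^ 3 / (t + 10 + 2 / 3) ^ 3)"
      using gamma_cube_seq_Suc[of "j + 9"] by (simp add: t_def add_ac)
    \<comment> \<open>All powers of t cancel, and the left side is the constant 16/729.\<close>
    have "(t + 10 + 2 / 3) ^ 3 * P t - (t + 10) ^ 3 * P (t + 1) \<ge> 0"
      unfolding P_def using t by (simp add: field_simps power2_eq_square power3_eq_cube)
    then have "(t + 10) ^ 3 * P (t + 1) / (t + 10 + 2 / 3) ^ 3 \<le> P t"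
      using t by (simp add: divide_simps mult_ac)
    then have "gamma_cube_seq (j + 9) * ((t + 10) ^ 3 * P (t + 1) / (t + 10 + 2 / 3) ^ 3) \<le> gamma_cube_seq (j + 9) * P t"
      using gamma_cube_seq_pos[of "j + 9"] by (intro mult_left_mono) auto
    then show "s (Suc j) \<le> s j"
      using step by (simp add: s_def t_def add_ac)
  qed
  ultimately have "Gamma (2 / 3) ^ 3 \<le> s 0" by (metis decseq_ge)
  then show ?thesis by (simp add: s_def P_def)
qed

text \<open>The term 1 / (100 N^2) reverses the monotonicity: in the same difference it contributes
  about 4/100, which outweighs 16/729.\<close>

lemma gamma_cube_lower: "gamma_cube_seq 9 * (10 ^ 2 - 10 / 3 + 2 / 27 - 1 / 10 ^ 4) \<le> Gamma (2 / 3) ^ 3"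
proof -
  define P where "P = (\<lambda>t::real. (t + 10) ^ 2 - (t + 10) / 3 + 2 / 27 - 1 / (100 * (t + 10) ^ 2))"
  define s where "s = (\<lambda>j. gamma_cube_seq (j + 9) * P (real j))"
  have "s \<longlonglongrightarrow> Gamma (2 / 3) ^ 3"
  proof -
    have "(\<lambda>j. P (real j) / (real (j + 9))\<^sup>2) \<longlonglongrightarrow> 1"
      unfolding P_def by real_asymp
    then have "(\<lambda>j. (gamma_cube_seq (j + 9) * (real (j + 9))\<^sup>2) * (P (real j) / (real (j + 9))\<^sup>2)) \<longlonglongrightarrow> Gamma (2 / 3) ^ 3 * 1"
      by (intro tendsto_mult LIMSEQ_ignore_initial_segment[OF gamma_cube_seq_limit])
    then show ?thesis by (simp add: s_def)
  qed
  moreover have "incseq s"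
  proof (rule incseq_SucI)
    fix j
    define t where "t = real j"
    have t: "0 \<le> t" by (simp add: t_def)
    have step: "gamma_cube_seq (Suc j + 9) = gamma_cube_seq (j + 9) * ((t + 10) ^ 3 / (t + 10 + 2 / 3) ^ 3)"
      using gamma_cube_seq_Suc[of "j + 9"] by (simp add: t_def add_ac)
    define A where "A = (t + 10)\<^sup>2 * (t + 11)\<^sup>2"
    have A: "0 < A" using t by (simp add: A_def)
    have P1: "A * P t = (t + 11)\<^sup>2 * ((t + 10) ^ 4 - (t + 10) ^ 3 / 3 + 2 / 27 * (t + 10)\<^sup>2 - 1 / 100)"
      using t unfolding A_def P_def by (simp add: divide_simps) (simp add: algebra_simps power_numeral_reduce)
    have P2: "A * P (t + 1) = (t + 10)\<^sup>2 * ((t + 11) ^ 4 - (t + 11) ^ 3 / 3 + 2 / 27 * (t + 11)\<^sup>2 - 1 / 100)"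
      using t unfolding A_def P_def by (simp add: divide_simps) (simp add: algebra_simps power_numeral_reduce)
    have "0 \<le> (t + 10) ^ 3 * (A * P (t + 1)) - (t + 10 + 2 / 3) ^ 3 * (A * P t)"
      unfolding P1 P2 using t by (simp add: field_simps power_numeral_reduce)
    then have "0 \<le> A * ((t + 10) ^ 3 * P (t + 1) - (t + 10 + 2 / 3) ^ 3 * P t)" by (simp add: algebra_simps)
    then have "0 \<le> (t + 10) ^ 3 * P (t + 1) - (t + 10 + 2 / 3) ^ 3 * P t"
      using A by (simp add: zero_le_mult_iff)
    then have "P t \<le> (t + 10) ^ 3 * P (t + 1) / (t + 10 + 2 / 3) ^ 3"
      using t by (simp add: pos_le_divide_eq mult_ac)
    then have "gamma_cube_seq (j + 9) * P t \<le> gamma_cube_seq (j + 9) * ((t + 10) ^ 3 * P (t + 1) / (t + 10 + 2 / 3) ^ 3)"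
      using gamma_cube_seq_pos[of "j + 9"] by (intro mult_left_mono) auto
    then show "s j \<le> s (Suc j)"
      using step by (simp add: s_def t_def add_ac)
  qed
  ultimately have "s 0 \<le> Gamma (2 / 3) ^ 3" by (metis incseq_le)
  then show ?thesis by (simp add: s_def P_def)
qed

lemma quadruple_constant_numeric: "\<bar>quadruple_constant - 0.338285\<bar> < 5 / 10 ^ 7"
proof -
  define p :: real where "p = 2 powr (4 / 3)"
  have p3: "p ^ 3 = 16" "0 < p"
  proof -
    have "p ^ 3 = 2 powr (real 3 * (4 / 3))"
      unfolding p_def by (subst powr_powr[symmetric, of _ _ "4/3" , simplified mult.commute]) (simp add: powr_powr flip: powr_realpow powr_numeral)
    then show "p ^ 3 = 16" by simp
  qed (simp add: p_def)
  have p_lower: "2.519842 < p"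
    by (rule power_less_imp_less_base[of _ 3]) (use p3 in \<open>simp_all add: power3_eq_cube\<close>)
  have p_upper: "p < 2.5198422"
    by (rule power_less_imp_less_base[of _ 3]) (use p3 in \<open>simp_all add: power3_eq_cube\<close>)
  have "{0..9::nat} = {0,1,2,3,4,5,6,7,8,9}" by auto
  then have v: "gamma_cube_seq 9 = (fact 9 / (\<Prod>i\<in>{0,1,2,3,4,5,6,7,8,9::nat}. 2 / 3 + real i)) ^ 3"
    unfolding gamma_cube_seq_def pochhammer_Suc_prod by simp
  have fact9: "fact 9 = (362880 :: real)" by (simp add: fact_numeral)
  have u: "Gamma (2 / 3) ^ 3 < (2.482961 :: real)"
    by (rule le_less_trans[OF gamma_cube_upper]) (simp add: v fact9 power3_eq_cube)
  have l: "(2.4829565 :: real) < Gamma (2 / 3) ^ 3"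
    by (rule less_le_trans[OF _ gamma_cube_lower]) (simp add: v fact9 power3_eq_cube)
  have "quadruple_constant < 0.3382855"
    unfolding quadruple_constant_def p_def[symmetric] using p_upper l
    by (simp add: divide_less_eq)
  moreover have "0.3382845 < quadruple_constant"
    unfolding quadruple_constant_def p_def[symmetric] using p_lower u l
    by (simp add: less_divide_eq)
  ultimately show ?thesis unfolding abs_less_iff by simp
qed

section \<open>The asymptotic formula\<close>

definition regular_quadruple :: "int \<times> int \<times> int \<Rightarrow> nat set" where
  "regular_quadruple = (\<lambda>(a, b, r). {nat a, nat b, nat (a + b + 2 * r), nat (height a b r)})"

definition ordered_regular_triples :: "real \<Rightarrow> (int \<times> int \<times> int) set" where
  "ordered_regular_triples x = {(a, b, r) \<in> regular_triples x. a < b}"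

lemma height_commute: "height a b r = height b a r"
  by (simp add: height_def)

text \<open>Swapping a and b is an involution of the triples without fixed points, since a^2 + 1 is
  never a square for positive a.\<close>

lemma card_ordered_regular_triples:
  assumes "1 \<le> x"
  shows "card (regular_triples x) = 2 * card (ordered_regular_triples x)"
proof -
  define S where "S = {(a, b, r) \<in> regular_triples x. b < a}"
  have "a \<noteq> b" if "(a, b, r) \<in> regular_triples x" for a b r
  proof
    assume "a = b"
    then have h: "0 < a" "0 < r" "a * a + 1 = r\<^sup>2" using that by (auto simp: regular_triples_def)
    have "a\<^sup>2 < r\<^sup>2" using h by (simp add: power2_eq_square)
    then have "a < r" using h by (intro power_less_imp_less_base[of a 2 r]) auto
    then have "(a + 1)\<^sup>2 \<le> r\<^sup>2" using h by (intro power_mono) auto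
    then show False using h by (simp add: power2_eq_square algebra_simps)
  qed
  then have "regular_triples x = ordered_regular_triples x \<union> S"
    by (fastforce simp: ordered_regular_triples_def S_def)
  moreover have "ordered_regular_triples x \<inter> S = {}" by (auto simp: ordered_regular_triples_def S_def)
  moreover have "finite (ordered_regular_triples x)" "finite S"
    by (rule finite_subset[OF _ card_regular_triples(1)[OF assms]]; auto simp: ordered_regular_triples_def S_def)+
  ultimately have "card (regular_triples x) = card (ordered_regular_triples x) + card S"
    by (simp add: card_Un_disjoint)
  moreover have "bij_betw (\<lambda>(a, b, r). (b, a, r)) (ordered_regular_triples x) S"
    by (rule bij_betw_byWitness[where f' = "\<lambda>(a, b, r). (b, a, r)"])
      (auto simp: ordered_regular_triples_def S_def regular_triples_def mult.commute height_commute)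
  then have "card (ordered_regular_triples x) = card S" by (rule bij_betw_same_card)
  ultimately show ?thesis by simp
qed

lemma regular_quadruple_order:
  assumes "(a, b, r) \<in> ordered_regular_triples x"
  shows "0 < a" "a < b" "b < a + b + 2 * r" "a + b + 2 * r < height a b r"
proof -
  have h: "0 < a" "a < b" "0 < r" using assms by (auto simp: ordered_regular_triples_def regular_triples_def)
  then show "0 < a" "a < b" "b < a + b + 2 * r" by auto
  define p where "p = a + r"
  define q where "q = b + r"
  have pq: "1 \<le> p" "1 \<le> q" using h by (auto simp: p_def q_def)
  have "p * 1 \<le> p * q" "1 * q \<le> p * q" using pq by (intro mult_mono; simp)+
  moreover have "1 * (p * q) \<le> r * (p * q)" using h pq by (intro mult_right_mono) auto
  moreover have "height a b r = 4 * (r * (p * q))" by (simp add: height_def p_def q_def)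
  moreover have "a + b + 2 * r = p + q" by (simp add: p_def q_def)
  ultimately show "a + b + 2 * r < height a b r" using pq by linarith
qed

lemma Min_sorted_4:
  fixes s t u v :: nat
  assumes "s < t" "t < u" "u < v"
  shows "Min {s, t, u, v} = s" "Min ({s, t, u, v} - {s}) = t"
proof -
  show "Min {s, t, u, v} = s" using assms by simp
  have "{s, t, u, v} - {s} = {t, u, v}" using assms by auto
  then show "Min ({s, t, u, v} - {s}) = t" using assms by simp
qed

text \<open>The two smallest elements are a and b, and they determine the positive root r.\<close>

lemma inj_on_regular_quadruple: "inj_on regular_quadruple (ordered_regular_triples x)"
proof (rule inj_onI)
  fix s t assume st: "s \<in> ordered_regular_triples x" "t \<in> ordered_regular_triples x"
    "regular_quadruple s = regular_quadruple t"
  have min: "Min (regular_quadruple (a, b, r)) = nat a" "Min (regular_quadruple (a, b, r) - {nat a}) = nat b"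
    if "(a, b, r) \<in> ordered_regular_triples x" for a b r
  proof -
    note o = regular_quadruple_order[OF that]
    have nl: "nat a < nat b" "nat b < nat (a + b + 2 * r)" "nat (a + b + 2 * r) < nat (height a b r)"
      unfolding zless_nat_conj using o by (auto intro: order.strict_trans)
    show "Min (regular_quadruple (a, b, r)) = nat a" "Min (regular_quadruple (a, b, r) - {nat a}) = nat b"
      unfolding regular_quadruple_def prod.case by (rule Min_sorted_4[OF nl])+
  qed
  obtain a b r where s: "s = (a, b, r)" by (cases s)
  obtain a' b' r' where t: "t = (a', b', r')" by (cases t)
  have pos: "0 < a" "0 < b" "0 < r" "a * b + 1 = r\<^sup>2" "0 < a'" "0 < b'" "0 < r'" "a' * b' + 1 = r'\<^sup>2"
    using st(1,2) unfolding s t ordered_regular_triples_def regular_triples_def by simp_all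
  have eq: "regular_quadruple (a, b, r) = regular_quadruple (a', b', r')" using st(3) by (simp only: s t)
  note o = st(1)[unfolded s] and o' = st(2)[unfolded t]
  have na: "nat a = nat a'" using min(1)[OF o] min(1)[OF o'] unfolding eq by linarith
  have nb: "nat b = nat b'" using min(2)[OF o] min(2)[OF o'] unfolding eq na by linarith
  have ab: "a = a'" "b = b'" using na nb pos(1,2,5,6) by linarith+
  have "r\<^sup>2 = r'\<^sup>2" using pos(4,8) unfolding ab by linarith
  then have "r = r'" using pos(3,7) by (simp add: power2_eq_iff_nonneg)
  then show "s = t" using ab by (simp add: s t)
qed

lemma is_square_nat_mult:
  fixes y z w :: int
  assumes "0 \<le> y" "0 \<le> z" "y * z + 1 = w\<^sup>2"
  shows "is_square (nat y * nat z + 1)"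
proof -
  have "int (nat y * nat z + 1) = int ((nat \<bar>w\<bar>)\<^sup>2)" using assms by simp
  then have "nat y * nat z + 1 = (nat \<bar>w\<bar>)\<^sup>2" by (simp only: of_nat_eq_iff)
  then show ?thesis unfolding is_nth_power_def by blast
qed

lemma regular_quadruple_diophantine:
  assumes "(a, b, r) \<in> ordered_regular_triples x"
  shows "regular_quadruple (a, b, r) \<in> diophantine_quadruples_upto x"
proof -
  note o = regular_quadruple_order[OF assms]
  define c where "c = a + b + 2 * r"
  define d where "d = height a b r"
  have r: "a * b + 1 = r\<^sup>2" "real_of_int d \<le> x"
    using assms by (auto simp: d_def ordered_regular_triples_def regular_triples_def)
  have lt: "0 < a" "a < b" "b < c" "c < d" using o by (simp_all add: c_def d_def)
  have e: "a * c + 1 = (a + r)\<^sup>2" "b * c + 1 = (b + r)\<^sup>2" "a * d + 1 = (2 * r * (a + r) - 1)\<^sup>2"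
    "b * d + 1 = (2 * r * (b + r) - 1)\<^sup>2" "c * d + 1 = (2 * (a + r) * (b + r) + 1)\<^sup>2"
    using r(1) unfolding c_def d_def height_def by algebra+
  have nn: "0 \<le> a" "0 \<le> b" "0 \<le> c" "0 \<le> d" using lt by linarith+
  note sq = is_square_nat_mult[OF nn(1,2) r(1)] is_square_nat_mult[OF nn(1,3) e(1)]
    is_square_nat_mult[OF nn(2,3) e(2)] is_square_nat_mult[OF nn(1,4) e(3)]
    is_square_nat_mult[OF nn(2,4) e(4)] is_square_nat_mult[OF nn(3,4) e(5)]
  have eq: "regular_quadruple (a, b, r) = {nat a, nat b, nat c, nat d}"
    by (simp add: regular_quadruple_def c_def d_def)
  have nl: "nat a < nat b" "nat b < nat c" "nat c < nat d" using lt by simp_all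
  have "card {s, t, u, v} = 4" if "s < t" "t < u" "u < v" for s t u v :: nat
    using that by simp
  from this[OF nl] have "card {nat a, nat b, nat c, nat d} = 4" .
  moreover have "\<forall>y\<in>{nat a, nat b, nat c, nat d}. \<forall>z\<in>{nat a, nat b, nat c, nat d}. y \<noteq> z \<longrightarrow> is_square (y * z + 1)"
    using sq by (simp add: mult.commute)
  moreover have "\<forall>y\<in>{nat a, nat b, nat c, nat d}. real y \<le> x"
    using lt r(2) by auto
  ultimately show ?thesis using lt unfolding eq diophantine_quadruples_upto_def diophantine_tuple_def by auto
qed

lemma card_4_sorted:
  fixes A :: "nat set"
  assumes "finite A" "card A = 4"
  obtains a b c d where "A = {a, b, c, d}" "a < b" "b < c" "c < d"
proof -
  define xs where "xs = sorted_list_of_set A"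
  have xs: "set xs = A" "length xs = 4" "sorted_wrt (<) xs"
    using assms by (simp_all add: xs_def)
  then obtain a b c d where "xs = [a, b, c, d]"
    by (auto simp: length_Suc_conv numeral_eq_Suc)
  then show ?thesis using xs by (intro that[of a b c d]) auto
qed

text \<open>For c = a + b + 2 r the three square roots are r, a + r and b + r. This identifies the
  regular case of \<open>quadruple_cases\<close> with \<open>height\<close>.\<close>

lemma dplus_regular:
  assumes "r\<^sup>2 = a * b + 1" "0 \<le> a" "0 \<le> b" "0 \<le> r"
  shows "dplus a b 0 = a + b + 2 * r" "dplus a b (a + b + 2 * r) = 4 * r * (a + r) * (b + r)"
proof -
  have "sqrt (a * b + 1) = r" using assms by (simp flip: assms(1))
  then show "dplus a b 0 = a + b + 2 * r" by (simp add: dplus_0)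
  have "(a * b + 1) * (a * (a + b + 2 * r) + 1) * (b * (a + b + 2 * r) + 1) = (r * (a + r) * (b + r))\<^sup>2"
    using assms(1) by algebra
  then have "sqrt ((a * b + 1) * (a * (a + b + 2 * r) + 1) * (b * (a + b + 2 * r) + 1)) = r * (a + r) * (b + r)"
    using assms by simp
  then have "dplus a b (a + b + 2 * r) = a + b + (a + b + 2 * r) + 2 * a * b * (a + b + 2 * r) + 2 * (r * (a + r) * (b + r))"
    by (simp add: dplus_def)
  also have "\<dots> = 4 * r * (a + r) * (b + r)" using assms(1) by algebra
  finally show "dplus a b (a + b + 2 * r) = 4 * r * (a + r) * (b + r)" .
qed

lemma diophantine_quadruples_cases:
  "diophantine_quadruples_upto x \<subseteq> regular_quadruple ` ordered_regular_triples x \<union> sporadic_quadruples x"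
proof
  fix A assume A: "A \<in> diophantine_quadruples_upto x"
  then have fin: "finite A" "card A = 4" by (auto simp: diophantine_quadruples_upto_def diophantine_tuple_def)
  then obtain a b c d where abcd: "A = {a, b, c, d}" "a < b" "b < c" "c < d" by (rule card_4_sorted)
  have dp: "dpair y z" if "y \<in> A" "z \<in> A" "y \<noteq> z" for y z
    using A that by (auto simp: diophantine_quadruples_upto_def diophantine_tuple_def dpair_def)
  have pairs: "dpair a b" "dpair a c" "dpair a d" "dpair b c" "dpair b d" "dpair c d"
    using abcd by (auto intro!: dp)
  have dx: "real d \<le> x" using A abcd by (auto simp: diophantine_quadruples_upto_def)
  show "A \<in> regular_quadruple ` ordered_regular_triples x \<union> sporadic_quadruples x"
  proof (cases "real c = dplus a b 0 \<and> real d = dplus a b c")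
    case False
    then have "A \<in> sporadic_quadruples x" unfolding sporadic_quadruples_def using abcd pairs dx by blast
    then show ?thesis ..
  next
    case True
    obtain r where r: "0 < r" "r\<^sup>2 = a * b + 1" using dpairE[OF pairs(1)] by blast
    have rr: "(real r)\<^sup>2 = real a * real b + 1" using arg_cong[OF r(2), of real] by simp
    note dr = dplus_regular[OF rr of_nat_0_le_iff of_nat_0_le_iff of_nat_0_le_iff]
    have "real c = real (a + b + 2 * r)" using True dr by simp
    then have c: "c = a + b + 2 * r" by (simp only: of_nat_eq_iff)
    then have "real d = 4 * real r * (real a + real r) * (real b + real r)" using True dr by simp
    then have "real d = real (4 * r * (a + r) * (b + r))" by simp
    then have d: "d = 4 * r * (a + r) * (b + r)" by (simp only: of_nat_eq_iff)
    have h: "height (int a) (int b) (int r) = int d" unfolding d height_def by simp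
    have "(int a, int b, int r) \<in> ordered_regular_triples x"
    proof -
      have "int a * int b + 1 = (int r)\<^sup>2" using arg_cong[OF r(2), of int] by simp
      then show ?thesis using abcd pairs(1) r(1) dx
        by (simp add: ordered_regular_triples_def regular_triples_def h dpair_def)
    qed
    moreover have "A = regular_quadruple (int a, int b, int r)"
    proof -
      have "nat (int a + int b + 2 * int r) = c" unfolding c by simp
      then show ?thesis by (simp add: regular_quadruple_def h abcd(1))
    qed
    ultimately show ?thesis by blast
  qed
qed

text \<open>B(1/3, 1/3) Gamma(2/3)^3 = (Gamma(1/3) Gamma(2/3))^2, and reflection evaluates the
  product inside as 2 pi / sqrt 3.\<close>

lemma quadruple_constant_eq: "quadruple_constant = (1 / 4) powr (1 / 3) * (beta_third / pi\<^sup>2)"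
proof -
  define g :: real where "g = Gamma (1 / 3)"
  define h :: real where "h = Gamma (2 / 3)"
  have h: "0 < h" by (simp add: h_def Gamma_real_pos)
  have "Gamma (1 / 3 :: complex) * Gamma (1 - 1 / 3) = of_real pi / sin (of_real pi * (1 / 3))"
    by (rule Gamma_reflection_complex)
  then have "complex_of_real (g * h) = complex_of_real (pi / sin (pi * (1 / 3)))"
    by (simp add: g_def h_def flip: Gamma_complex_of_real sin_of_real)
  then have "g * h = pi / sin (pi / 3)" by (simp only: of_real_eq_iff) simp
  then have gh: "g * h = 2 * pi / sqrt 3" by (simp add: sin_60)
  have "(g * h)\<^sup>2 = 4 / 3 * pi\<^sup>2" unfolding gh by (simp add: power_divide power_mult_distrib)
  moreover have "beta_third = g\<^sup>2 / h" by (simp add: Beta_def g_def h_def power2_eq_square)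
  then have "beta_third * h = g\<^sup>2" using h by simp
  then have "beta_third * h ^ 3 = (g * h)\<^sup>2" by algebra
  ultimately have "beta_third * h ^ 3 = 4 / 3 * pi\<^sup>2" by simp
  then have B: "beta_third / pi\<^sup>2 = 4 / (3 * h ^ 3)" using h by (simp add: field_simps)
  have q: "(1 / 4 :: real) powr (1 / 3) * 4 = 2 powr (4 / 3)"
  proof -
    have "(1 / 4 :: real) = 2 powr (- 2)" using powr_minus_divide[of "2::real" 2] by simp
    then have "(1 / 4 :: real) powr (1 / 3) = (2 powr (- 2)) powr (1 / 3)" by (simp only:)
    also have "\<dots> = 2 powr (- 2 / 3)" by (simp only: powr_powr) simp
    finally have "(1 / 4 :: real) powr (1 / 3) * 4 = 2 powr (- 2 / 3) * 2 powr 2" by simp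
    also have "\<dots> = 2 powr (4 / 3)" by (simp only: powr_add[symmetric]) simp
    finally show ?thesis .
  qed
  show ?thesis unfolding quadruple_constant_def B h_def[symmetric] q[symmetric] by simp
qed

lemma card_diophantine_quadruples_upto:
  obtains K where "0 \<le> K" "\<And>x. 1 \<le> x \<Longrightarrow>
    \<bar>real (card (diophantine_quadruples_upto x)) - quadruple_constant * x powr (1 / 3) * ln x\<bar> \<le> K * x powr (1 / 3)"
proof -
  obtain K1 where K1: "0 \<le> K1" "\<And>x. 1 \<le> x \<Longrightarrow>
    \<bar>real (card (regular_triples x)) - 2 * ((x / 4) powr (1 / 3) * (beta_third / pi\<^sup>2 * ln x))\<bar> \<le> K1 * x powr (1 / 3)"
    using card_regular_triples_asymp by blast
  obtain K2 where K2: "0 \<le> K2" "\<And>x. 1 \<le> x \<Longrightarrow> finite (sporadic_quadruples x)"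
    "\<And>x. 1 \<le> x \<Longrightarrow> real (card (sporadic_quadruples x)) \<le> K2 * x powr (1 / 3)"
    using card_sporadic_quadruples by blast
  show thesis
  proof (rule that[of "K1 + K2"])
    fix x :: real assume x: "1 \<le> x"
    define R where "R = regular_quadruple ` ordered_regular_triples x"
    define D where "D = diophantine_quadruples_upto x"
    have finO: "finite (ordered_regular_triples x)"
      by (rule finite_subset[OF _ card_regular_triples(1)[OF x]]) (auto simp: ordered_regular_triples_def)
    have cR: "card R = card (ordered_regular_triples x)" unfolding R_def by (intro card_image inj_on_regular_quadruple)
    have "R \<subseteq> D" using regular_quadruple_diophantine by (auto simp: R_def D_def)
    then have lower: "card R \<le> card D" unfolding D_def by (intro card_mono finite_diophantine_quadruples_upto)
    have "D \<subseteq> R \<union> sporadic_quadruples x" unfolding D_def R_def by (rule diophantine_quadruples_cases)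
    then have "card D \<le> card (R \<union> sporadic_quadruples x)" using finO K2(2)[OF x] by (intro card_mono) (auto simp: R_def)
    also have "\<dots> \<le> card R + card (sporadic_quadruples x)" by (rule card_Un_le)
    finally have upper: "card D \<le> card R + card (sporadic_quadruples x)" .
    \<comment> \<open>Two ordered triples per quadruple; this cancels the factor 2 that comes from
      the two signs.\<close>
    have cT: "real (card (regular_triples x)) = 2 * real (card R)"
      using card_ordered_regular_triples[OF x] cR by simp
    have main: "(x / 4) powr (1 / 3) * (beta_third / pi\<^sup>2 * ln x) = quadruple_constant * x powr (1 / 3) * ln x"
      using powr_mult[of x "1 / 4" "1 / 3"] by (simp add: quadruple_constant_eq)
    have "\<bar>2 * real (card R) - 2 * (quadruple_constant * x powr (1 / 3) * ln x)\<bar> \<le> K1 * x powr (1 / 3)"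
      using K1(2)[OF x] unfolding cT main .
    moreover have "0 \<le> K1 * x powr (1 / 3)" using K1(1) by simp
    ultimately show "\<bar>real (card D) - quadruple_constant * x powr (1 / 3) * ln x\<bar> \<le> (K1 + K2) * x powr (1 / 3)"
      using lower upper K2(3)[OF x] unfolding distrib_right by linarith
  qed (use K1 K2 in auto)
qed

theorem theorem1p1:
  shows "(\<lambda>x::real. real (card (diophantine_quadruples_upto x))
            - quadruple_constant * x powr (1 / 3) * ln x)
         \<in> O[at_top](\<lambda>x. x powr (1 / 3) * ln x powr (2 / 3 + sqrt 2 / 6)
                         * ln (ln x) powr (5 / 12))
       \<and> \<bar>quadruple_constant - 0.338285\<bar> < 5 / 10 ^ 7"
proof
  obtain K where K: "0 \<le> K" "\<And>x. 1 \<le> x \<Longrightarrow>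
    \<bar>real (card (diophantine_quadruples_upto x)) - quadruple_constant * x powr (1 / 3) * ln x\<bar> \<le> K * x powr (1 / 3)"
    using card_diophantine_quadruples_upto by blast
  \<comment> \<open>Beyond these points both logarithmic factors of the claimed error term are at
    least 1, so the bound K x^(1/3) suffices.\<close>
  have large: "eventually (\<lambda>x::real. 1 \<le> x) at_top" "eventually (\<lambda>x::real. 1 \<le> ln x) at_top"
    "eventually (\<lambda>x::real. 1 \<le> ln (ln x)) at_top"
    by real_asymp+
  show "(\<lambda>x::real. real (card (diophantine_quadruples_upto x)) - quadruple_constant * x powr (1 / 3) * ln x)
         \<in> O[at_top](\<lambda>x. x powr (1 / 3) * ln x powr (2 / 3 + sqrt 2 / 6) * ln (ln x) powr (5 / 12))"
  proof (rule bigoI)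
    show "eventually (\<lambda>x. norm (real (card (diophantine_quadruples_upto x)) - quadruple_constant * x powr (1 / 3) * ln x)
        \<le> K * norm (x powr (1 / 3) * ln x powr (2 / 3 + sqrt 2 / 6) * ln (ln x) powr (5 / 12))) at_top"
      using large
    proof eventually_elim
      case (elim x)
      have "1 \<le> ln x powr (2 / 3 + sqrt 2 / 6)" "1 \<le> ln (ln x) powr (5 / 12)"
        using elim by (auto intro!: ge_one_powr_ge_zero)
      then have "x powr (1 / 3) * 1 * 1 \<le> x powr (1 / 3) * ln x powr (2 / 3 + sqrt 2 / 6) * ln (ln x) powr (5 / 12)"
        by (intro mult_mono) auto
      then have "K * x powr (1 / 3) \<le> K * (x powr (1 / 3) * ln x powr (2 / 3 + sqrt 2 / 6) * ln (ln x) powr (5 / 12))"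
        using K(1) by (intro mult_left_mono) auto
      then show ?case using K(2)[OF elim(1)] by (simp add: abs_mult)
    qed
  qed
  show "\<bar>quadruple_constant - 0.338285\<bar> < 5 / 10 ^ 7" by (rule quadruple_constant_numeric)
qed

end
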